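(* Let $p>1$ be odd and let $\epsilon\in\mathbb{C}$ be a primitive $p$th root of unity. Let $s>0$ be an integer, written $s=s_0+ps_1$ with integers $s_0,s_1$ and $0\le s_0<p$, and suppose $s_0\neq0$. Let $v_m=g(m,m+s)\in\mathcal{F}_\epsilon^2(2)$ for integers $m\ge0$, and let $$V'=\mathrm{span}_{\mathbb{C}}\{v_m : m\ge 0,\ p>m_0\geq p-s_0\},$$ where $m=m_0+pm_1$ with integers $m_0,m_1$ and $0\le m_0<p$. Then the $U_\epsilon^{res}(sl_2)$-module $V'$ is isomorphic to $V_\epsilon^{res}(\lambda)$ with $\lambda=-(p-s_0+(s_1+1)p+1)$.
   Context: Let $q$ be an indeterminate, $\mathcal{A}=\mathbb{C}[q,q^{-1}]$, $\mathbb{N}=\{1,2,\dots\}$, $\mathbb{Z}^+=\{0,1,2,\dots\}$. For $n\in\mathbb{Z}$, $m\in\mathbb{N}$: $[n]_q=\frac{q^n-q^{-n}}{q-q^{-1}}$, $[m]_q!=[m]_q\cdots[1]_q$, $\left[{n\atop m}\right]_q=\frac{[n]_q[n-1]_q\cdots[n-m+1]_q}{[m]_q!}$; also $\left[{n\atop 0}\right]_q=1$ and $\left[{n\atop m}\right]_q=0$ for $m<0$. These lie in $\mathcal{A}$, and $\left[{n\atop m}\right]_\epsilon$ denotes the value at $q=\epsilon$. $U_q(sl_2)$ is the associative $\mathbb{C}(q)$-algebra with generators $e,f,K^{\pm1}$ and relations $KK^{-1}=K^{-1}K=1$, $KeK^{-1}=q^2e$, $KfK^{-1}=q^{-2}f$,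 $[e,f]=\frac{K-K^{-1}}{q-q^{-1}}$. $U_{\mathcal{A}}^{res}(sl_2)$ is its $\mathcal{A}$-subalgebra generated by $K^{\pm1}$, $e^{(r)}=e^r/[r]_q!$, $f^{(r)}=f^r/[r]_q!$ ($r\in\mathbb{N}$). $U_\epsilon^{res}(sl_2)=U_{\mathcal{A}}^{res}(sl_2)\otimes_{\mathcal{A}}\mathbb{C}$ via $q\mapsto\epsilon$; elements $x\otimes1$ are written $x$. A $U_\epsilon^{res}(sl_2)$-module is of type 1 if $K$ is diagonalizable on it and $K^{\pm p}=1$. Let $\left[{K;0\atop p}\right]_q=\prod_{s=1}^p\frac{Kq^{1-s}-K^{-1}q^{s-1}}{q^s-q^{-s}}\in U_{\mathcal{A}}^{res}(sl_2)$. For $m\in\mathbb{Z}$, the weight space of weight $m$ of a type 1 module $V$ is $\{v\in V: Kv=\epsilon^m v,\ \left[{K;0\atop p}\right]_q v=\left[{m\atop p}\right]_\epsilon v\}$. A type 1 module is a highest weight module of highest weight $\lambda\in\mathbb{Z}$ if it is generated by a nonzero vector $v_\lambda$ of weight $\lambda$ with $ev_\lambda=e^{(p)}v_\lambda=0$. $V_\epsilon^{res}(\lambda)$ denotes the irreducible highest weight module of type 1 of highest weight $\lambda$ (unique up to isomorphism). The restricted q-Fock space $\mathcal{F}_\epsilon^2(2)$ is the complex vector space with basis $\{g(r_1,r_2): r_1,r_2\in\mathbb{Z}^+\}$ (specialization at $q=\epsilon$ of an $\mathcal{A}$-form of the q-Fock space of the rank-2 q-boson algebra, $g(r_1,r_2)=a_1^{+(r_1)}a_2^{+r_2}|0\rangle$).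 It is a type 1 $U_\epsilon^{res}(sl_2)$-module by (for $r\in\mathbb{N}$) $K^{\pm1}g(r_1,r_2)=\epsilon^{\mp(r_1+r_2+1)}g(r_1,r_2)$, $e^{(r)}g(r_1,r_2)=\left[{r_2\atop r_2-r}\right]_\epsilon g(r_1-r,r_2-r)$, $f^{(r)}g(r_1,r_2)=(-1)^r\left[{r+r_1\atop r}\right]_\epsilon g(r_1+r,r_2+r)$, where $g(\cdot,\cdot)$ with a negative index means $0$. The subspace $V'$ is a $U_\epsilon^{res}(sl_2)$-submodule of $\mathcal{F}_\epsilon^2(2)$. *)

theory Defs
  imports
    Complex_Main
    "HOL-Library.Poly_Mapping"
    "HOL-Computational_Algebra.Polynomial"
    "HOL-Computational_Algebra.Fraction_Field"
    "HOL-Algebra.Module"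
    "HOL-Algebra.QuotRing"
    "HOL-Algebra.Generated_Rings"
begin

section \<open>Laurent polynomials and q-numbers\<close>

type_synonym ratfun = "complex poly fract"

definition q :: ratfun
  where "q = Fraction_Field.Fract [:0, 1:] 1"

text \<open>The ring \<open>\<complex>[q, q\<inverse>]\<close>, as a subset of \<open>\<complex>(q)\<close>.\<close>

definition laurent :: "ratfun set"
  where "laurent = {Fraction_Field.Fract P ([:0, 1:] ^ n) | P n. True}"

text \<open>The value at \<open>q = \<epsilon>\<close> of a Laurent polynomial (for \<open>\<epsilon> \<noteq> 0\<close>).\<close>

definition value_at :: "complex \<Rightarrow> ratfun \<Rightarrow> complex"
  where "value_at \<epsilon> a =
    (THE c. \<exists>P n. a = Fraction_Field.Fract P ([:0, 1:] ^ n) \<and> c = poly P \<epsilon> / \<epsilon> ^ n)"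

definition qint :: "int \<Rightarrow> ratfun"
  where "qint n = (q powi n - q powi (- n)) / (q - inverse q)"

definition qfact :: "nat \<Rightarrow> ratfun"
  where "qfact m = (\<Prod>i = 1..m. qint (int i))"

definition qbinom :: "int \<Rightarrow> int \<Rightarrow> ratfun"
  where "qbinom n m =
    (if m < 0 then 0 else (\<Prod>i<nat m. qint (n - int i)) / qfact (nat m))"

definition qbinom_at :: "complex \<Rightarrow> int \<Rightarrow> int \<Rightarrow> complex"
  where "qbinom_at \<epsilon> n m = value_at \<epsilon> (qbinom n m)"


section \<open>Monoid algebras\<close>

text \<open>
  The algebra of finite formal sums of elements of a monoid; \<open>Poly_Mapping.single x c\<close>
  is the term \<open>c x\<close>. Over the monoid of words it is the free associative algebra.
\<close>

definition monoid_algebra :: "('m, 'b) monoid_scheme \<Rightarrow> ('m \<Rightarrow>\<^sub>0 'k::comm_ring_1) ring"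
  where "monoid_algebra M =
    \<lparr>carrier = {x. Poly_Mapping.keys x \<subseteq> carrier M},
     monoid.mult = (\<lambda>x y. \<Sum>a\<in>Poly_Mapping.keys x. \<Sum>b\<in>Poly_Mapping.keys y.
        Poly_Mapping.single (a \<otimes>\<^bsub>M\<^esub> b) (Poly_Mapping.lookup x a * Poly_Mapping.lookup y b)),
     one = Poly_Mapping.single \<one>\<^bsub>M\<^esub> 1,
     zero = 0,
     add = (+)\<rparr>"

definition coset_of :: "('a, 'b) ring_scheme \<Rightarrow> 'a set \<Rightarrow> 'a \<Rightarrow> 'a set"
  where "coset_of R S x = (Idl\<^bsub>R\<^esub> S) +>\<^bsub>R\<^esub> x"


section \<open>The algebra \<open>U\<^sub>q(sl\<^sub>2)\<close>\<close>

datatype gen = E | F | K | Kinv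

definition words :: "gen list monoid"
  where "words = \<lparr>carrier = UNIV, monoid.mult = (@), one = []\<rparr>"

abbreviation free_alg :: "(gen list \<Rightarrow>\<^sub>0 ratfun) ring"
  where "free_alg \<equiv> monoid_algebra words"

text \<open>A word stands for the product of its letters, so that for instance the third element
  is \<open>K e K\<inverse> - q\<^sup>2 e\<close>.\<close>

definition uq_relators :: "(gen list \<Rightarrow>\<^sub>0 ratfun) set"
  where "uq_relators =
   {Poly_Mapping.single [K, Kinv] 1 - Poly_Mapping.single [] 1,
    Poly_Mapping.single [Kinv, K] 1 - Poly_Mapping.single [] 1,
    Poly_Mapping.single [K, E, Kinv] 1 - Poly_Mapping.single [E] (q ^ 2),
    Poly_Mapping.single [K, F, Kinv] 1 - Poly_Mapping.single [F] (inverse q ^ 2),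
    Poly_Mapping.single [E, F] 1 - Poly_Mapping.single [F, E] 1
      - (Poly_Mapping.single [K] (1 / (q - inverse q))
         - Poly_Mapping.single [Kinv] (1 / (q - inverse q)))}"

type_synonym uq = "(gen list \<Rightarrow>\<^sub>0 ratfun) set"

definition Uq :: "uq ring"
  where "Uq = free_alg Quot (Idl\<^bsub>free_alg\<^esub> uq_relators)"

definition uq_gen :: "gen \<Rightarrow> uq"
  where "uq_gen x = coset_of free_alg uq_relators (Poly_Mapping.single [x] 1)"

definition uq_scale :: "ratfun \<Rightarrow> uq \<Rightarrow> uq"
  where "uq_scale a x = coset_of free_alg uq_relators (Poly_Mapping.single [] a) \<otimes>\<^bsub>Uq\<^esub> x"

text \<open>The divided power \<open>x\<^sup>r / [r]\<^sub>q!\<close> of a generator.\<close>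

definition uq_dpow :: "gen \<Rightarrow> nat \<Rightarrow> uq"
  where "uq_dpow x r = uq_scale (inverse (qfact r)) (uq_gen x [^]\<^bsub>Uq\<^esub> r)"

text \<open>The element \<open>[K; 0; r]\<^sub>q\<close>.\<close>

primrec uq_Kbinom :: "nat \<Rightarrow> uq"
  where
    "uq_Kbinom 0 = \<one>\<^bsub>Uq\<^esub>"
  | "uq_Kbinom (Suc r) = uq_Kbinom r \<otimes>\<^bsub>Uq\<^esub>
      uq_scale (1 / (q powi int (Suc r) - q powi (- int (Suc r))))
        (uq_scale (q powi (1 - int (Suc r))) (uq_gen K)
          \<ominus>\<^bsub>Uq\<^esub> uq_scale (q powi (int (Suc r) - 1)) (uq_gen Kinv))"


section \<open>The restricted form and its specialization\<close>

text \<open>The subalgebra over the Laurent polynomials is generated, as a ring, by the scalars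
  \<open>a \<cdot> 1\<close> and the algebra generators.\<close>

definition Ures :: "uq ring"
  where "Ures = Uq\<lparr>carrier := generate_ring Uq
    ((\<lambda>a. uq_scale a \<one>\<^bsub>Uq\<^esub>) ` laurent \<union> {uq_gen K, uq_gen Kinv}
      \<union> {uq_dpow E r | r. 1 \<le> r} \<union> {uq_dpow F r | r. 1 \<le> r})\<rparr>"

text \<open>
  \<open>Ures \<otimes> \<complex>\<close> over the Laurent polynomials, which act on \<open>\<complex>\<close> through \<open>q \<mapsto> \<epsilon>\<close>.
  In the complex algebra of formal sums of elements \<open>x\<close> of \<open>Ures\<close>, where
  \<open>Poly_Mapping.single x c\<close> represents \<open>x \<otimes> c\<close> and \<open>(x \<otimes> c)(y \<otimes> d) = xy \<otimes> cd\<close>,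
  we divide by \<open>(x + y) \<otimes> 1 - x \<otimes> 1 - y \<otimes> 1\<close> and \<open>ax \<otimes> 1 - x \<otimes> a(\<epsilon>)\<close>.
  The linear span of these elements is already an ideal, since Laurent polynomials are
  central; hence the quotient is the usual tensor product.
\<close>

definition tensor_relators :: "complex \<Rightarrow> (uq \<Rightarrow>\<^sub>0 complex) set"
  where "tensor_relators \<epsilon> =
    {Poly_Mapping.single (x \<oplus>\<^bsub>Ures\<^esub> y) 1 - Poly_Mapping.single x 1 - Poly_Mapping.single y 1
      | x y. x \<in> carrier Ures \<and> y \<in> carrier Ures}
    \<union> {Poly_Mapping.single (uq_scale a x) 1 - Poly_Mapping.single x (value_at \<epsilon> a)
      | a x. a \<in> laurent \<and> x \<in> carrier Ures}"

type_synonym ueps = "(uq \<Rightarrow>\<^sub>0 complex) set"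

definition Ueps :: "complex \<Rightarrow> ueps ring"
  where "Ueps \<epsilon> = monoid_algebra Ures Quot (Idl\<^bsub>monoid_algebra Ures\<^esub> (tensor_relators \<epsilon>))"

definition tensor :: "complex \<Rightarrow> uq \<Rightarrow> complex \<Rightarrow> ueps"
  where "tensor \<epsilon> x c =
    coset_of (monoid_algebra Ures) (tensor_relators \<epsilon>) (Poly_Mapping.single x c)"

abbreviation spec :: "complex \<Rightarrow> uq \<Rightarrow> ueps"
  where "spec \<epsilon> x \<equiv> tensor \<epsilon> x 1"

abbreviation ueps_const :: "complex \<Rightarrow> complex \<Rightarrow> ueps"
  where "ueps_const \<epsilon> c \<equiv> tensor \<epsilon> \<one>\<^bsub>Ures\<^esub> c"


section \<open>Modules\<close>

text \<open>The library's locale \<open>module\<close> requires a commutative ring of scalars. As \<open>Ueps \<epsilon>\<close>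
  contains the complex numbers \<open>ueps_const \<epsilon> c\<close>, its left modules are complex vector spaces.\<close>

locale left_module = R?: ring R + M?: abelian_group M
  for R :: "('a, 'b) ring_scheme" (structure) and M :: "('a, 'c, 'd) module_scheme" (structure) +
  assumes smult_closed:
      "\<lbrakk>a \<in> carrier R; x \<in> carrier M\<rbrakk> \<Longrightarrow> a \<odot>\<^bsub>M\<^esub> x \<in> carrier M"
    and smult_l_distr:
      "\<lbrakk>a \<in> carrier R; b \<in> carrier R; x \<in> carrier M\<rbrakk> \<Longrightarrow>
        (a \<oplus>\<^bsub>R\<^esub> b) \<odot>\<^bsub>M\<^esub> x = a \<odot>\<^bsub>M\<^esub> x \<oplus>\<^bsub>M\<^esub> b \<odot>\<^bsub>M\<^esub> x"
    and smult_r_distr: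
      "\<lbrakk>a \<in> carrier R; x \<in> carrier M; y \<in> carrier M\<rbrakk> \<Longrightarrow>
        a \<odot>\<^bsub>M\<^esub> (x \<oplus>\<^bsub>M\<^esub> y) = a \<odot>\<^bsub>M\<^esub> x \<oplus>\<^bsub>M\<^esub> a \<odot>\<^bsub>M\<^esub> y"
    and smult_assoc:
      "\<lbrakk>a \<in> carrier R; b \<in> carrier R; x \<in> carrier M\<rbrakk> \<Longrightarrow>
        (a \<otimes>\<^bsub>R\<^esub> b) \<odot>\<^bsub>M\<^esub> x = a \<odot>\<^bsub>M\<^esub> (b \<odot>\<^bsub>M\<^esub> x)"
    and smult_one: "x \<in> carrier M \<Longrightarrow> \<one>\<^bsub>R\<^esub> \<odot>\<^bsub>M\<^esub> x = x"

definition irreducible_module :: "('r, 'c) ring_scheme \<Rightarrow> ('r, 'v) module \<Rightarrow> bool"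
  where "irreducible_module R M \<longleftrightarrow>
    left_module R M \<and> carrier M \<noteq> {\<zero>\<^bsub>M\<^esub>} \<and>
    (\<forall>N. submodule N R M \<longrightarrow> N = {\<zero>\<^bsub>M\<^esub>} \<or> N = carrier M)"

definition module_iso ::
    "('r, 'c) ring_scheme \<Rightarrow> ('r, 'v) module \<Rightarrow> ('r, 'w) module \<Rightarrow> ('v \<Rightarrow> 'w) \<Rightarrow> bool"
  where "module_iso R M N h \<longleftrightarrow>
    bij_betw h (carrier M) (carrier N) \<and>
    (\<forall>x\<in>carrier M. \<forall>y\<in>carrier M. h (x \<oplus>\<^bsub>M\<^esub> y) = h x \<oplus>\<^bsub>N\<^esub> h y) \<and>
    (\<forall>a\<in>carrier R. \<forall>x\<in>carrier M. h (a \<odot>\<^bsub>M\<^esub> x) = a \<odot>\<^bsub>N\<^esub> h x)"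

definition isomorphic_modules ::
    "('r, 'c) ring_scheme \<Rightarrow> ('r, 'v) module \<Rightarrow> ('r, 'w) module \<Rightarrow> bool"
  where "isomorphic_modules R M N \<longleftrightarrow> (\<exists>h. module_iso R M N h)"

text \<open>Diagonalizability of \<open>K\<close> is expressed as: every vector is a finite sum of eigenvectors
  (or zeros) of \<open>K\<close>.\<close>

definition type_one :: "nat \<Rightarrow> complex \<Rightarrow> (ueps, 'v) module \<Rightarrow> bool"
  where "type_one p \<epsilon> M \<longleftrightarrow>
    left_module (Ueps \<epsilon>) M \<and>
    (\<forall>v\<in>carrier M. \<exists>(n::nat) w c.
      (\<forall>i<n. w i \<in> carrier M \<and> spec \<epsilon> (uq_gen K) \<odot>\<^bsub>M\<^esub> w i = ueps_const \<epsilon> (c i) \<odot>\<^bsub>M\<^esub> w i) \<and>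
      v = (\<Oplus>\<^bsub>M\<^esub>i\<in>{..<n}. w i)) \<and>
    (\<forall>v\<in>carrier M. (spec \<epsilon> (uq_gen K) [^]\<^bsub>Ueps \<epsilon>\<^esub> p) \<odot>\<^bsub>M\<^esub> v = v \<and>
      (spec \<epsilon> (uq_gen Kinv) [^]\<^bsub>Ueps \<epsilon>\<^esub> p) \<odot>\<^bsub>M\<^esub> v = v)"

definition weight_space :: "nat \<Rightarrow> complex \<Rightarrow> (ueps, 'v) module \<Rightarrow> int \<Rightarrow> 'v set"
  where "weight_space p \<epsilon> M m =
    {v \<in> carrier M.
      spec \<epsilon> (uq_gen K) \<odot>\<^bsub>M\<^esub> v = ueps_const \<epsilon> (\<epsilon> powi m) \<odot>\<^bsub>M\<^esub> v \<and>
      spec \<epsilon> (uq_Kbinom p) \<odot>\<^bsub>M\<^esub> v = ueps_const \<epsilon> (qbinom_at \<epsilon> m (int p)) \<odot>\<^bsub>M\<^esub> v}"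

definition highest_weight_module :: "nat \<Rightarrow> complex \<Rightarrow> int \<Rightarrow> (ueps, 'v) module \<Rightarrow> bool"
  where "highest_weight_module p \<epsilon> hw M \<longleftrightarrow>
    type_one p \<epsilon> M \<and>
    (\<exists>v\<in>weight_space p \<epsilon> M hw. v \<noteq> \<zero>\<^bsub>M\<^esub> \<and>
      spec \<epsilon> (uq_gen E) \<odot>\<^bsub>M\<^esub> v = \<zero>\<^bsub>M\<^esub> \<and>
      spec \<epsilon> (uq_dpow E p) \<odot>\<^bsub>M\<^esub> v = \<zero>\<^bsub>M\<^esub> \<and>
      carrier M = {u \<odot>\<^bsub>M\<^esub> v | u. u \<in> carrier (Ueps \<epsilon>)})"

text \<open>\<open>M\<close> is a model of the irreducible highest weight module, which is unique only up to
  isomorphism.\<close>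

definition is_Vres :: "nat \<Rightarrow> complex \<Rightarrow> int \<Rightarrow> (ueps, 'v) module \<Rightarrow> bool"
  where "is_Vres p \<epsilon> hw M \<longleftrightarrow>
    highest_weight_module p \<epsilon> hw M \<and> irreducible_module (Ueps \<epsilon>) M"


section \<open>The restricted q-Fock space at \<open>q = \<epsilon>\<close>\<close>

type_synonym fock = "nat \<times> nat \<Rightarrow>\<^sub>0 complex"

definition fscale :: "complex \<Rightarrow> fock \<Rightarrow> fock"
  where "fscale c x = Poly_Mapping.map ((*) c) x"

interpretation fock: vector_space fscale
proof
  have l: "Poly_Mapping.lookup (fscale c x) k = c * Poly_Mapping.lookup x k" for c x k
    by (simp add: fscale_def Poly_Mapping.map.rep_eq when_def)
  show "fscale a (x + y) = fscale a x + fscale a y" for a x y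
    by (rule poly_mapping_eqI) (simp add: l lookup_add distrib_left)
  show "fscale (a + b) x = fscale a x + fscale b x" for a b x
    by (rule poly_mapping_eqI) (simp add: l lookup_add distrib_right)
  show "fscale a (fscale b x) = fscale (a * b) x" for a b x
    by (rule poly_mapping_eqI) (simp add: l)
  show "fscale 1 x = x" for x
    by (rule poly_mapping_eqI) (simp add: l)
qed

definition g :: "int \<Rightarrow> int \<Rightarrow> fock"
  where "g r1 r2 =
    (if r1 < 0 \<or> r2 < 0 then 0 else Poly_Mapping.single (nat r1, nat r2) 1)"

text \<open>\<open>M\<close> is the module structure on the complex vector space \<open>fock\<close> given by the action of the
  generators; this determines the action of all of \<open>Ueps \<epsilon>\<close>.\<close>

definition is_fock_module :: "complex \<Rightarrow> (ueps, fock) module \<Rightarrow> bool"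
  where "is_fock_module \<epsilon> M \<longleftrightarrow>
    left_module (Ueps \<epsilon>) M \<and>
    carrier M = UNIV \<and> \<zero>\<^bsub>M\<^esub> = 0 \<and> (\<forall>x y. x \<oplus>\<^bsub>M\<^esub> y = x + y) \<and>
    (\<forall>c x. ueps_const \<epsilon> c \<odot>\<^bsub>M\<^esub> x = fscale c x) \<and>
    (\<forall>r1\<ge>0. \<forall>r2\<ge>0.
      spec \<epsilon> (uq_gen K) \<odot>\<^bsub>M\<^esub> g r1 r2 = fscale (\<epsilon> powi (- (r1 + r2 + 1))) (g r1 r2) \<and>
      spec \<epsilon> (uq_gen Kinv) \<odot>\<^bsub>M\<^esub> g r1 r2 = fscale (\<epsilon> powi (r1 + r2 + 1)) (g r1 r2) \<and>
      (\<forall>r\<ge>1.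
        spec \<epsilon> (uq_dpow E r) \<odot>\<^bsub>M\<^esub> g r1 r2 =
          fscale (qbinom_at \<epsilon> r2 (r2 - int r)) (g (r1 - int r) (r2 - int r)) \<and>
        spec \<epsilon> (uq_dpow F r) \<odot>\<^bsub>M\<^esub> g r1 r2 =
          fscale ((- 1) ^ r * qbinom_at \<epsilon> (int r + r1) (int r)) (g (r1 + int r) (r2 + int r))))"

definition V' :: "nat \<Rightarrow> nat \<Rightarrow> nat \<Rightarrow> fock set"
  where "V' p s s0 = fock.span
    {g (int m) (int (m + s)) | m m0 m1. m = m0 + p * m1 \<and> m0 < p \<and> p - s0 \<le> m0}"

end

theory Submission
  imports Defs
begin

text \<open>
  On the vectors \<open>v\<^sub>m = g(m, m + s)\<close> the divided powers \<open>e\<^bsup>(r)\<^esup>\<close> and \<open>f\<^bsup>(r)\<^esup>\<close> shift the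
  index by \<open>- r\<close> and \<open>r\<close>, and the coefficient is up to sign a q-binomial at \<open>\<epsilon>\<close>. As in Lucas'
  theorem, a q-binomial with \<open>r \<le> n\<close> vanishes exactly when the last base-\<open>p\<close> digit of \<open>r\<close>
  exceeds that of \<open>n\<close> (\<open>B_eq_0_iff\<close>). Comparing digits shows that the coefficients leading out of the
  index set of \<open>V'\<close> vanish (\<open>E_leaves_zero\<close>, \<open>F_leaves_zero\<close>), so that \<open>V'\<close> is a submodule, and
  that the coefficients leading from any \<open>v\<^sub>m\<close> in \<open>V'\<close> to the one with the lowest index
  \<open>p - s\<^sub>0\<close>, and from there to any other, do not. Given a nonzero vector of \<open>V'\<close> with top index \<open>t\<close>,
  the operator \<open>e\<^bsup>(t - (p - s\<^sub>0))\<^esup>\<close> sends all its other terms to \<open>0\<close>. Hence every nonzero submodule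
  contains \<open>v\<close> with index \<open>p - s\<^sub>0\<close>, and then everything: \<open>V'\<close> is irreducible, and the lowest index
  gives a highest weight vector.

  Its weight consists of the eigenvalues of \<open>K\<close> and \<open>[K; 0; p]\<close>. The second element is not one of the
  generators. Kac's formula for \<open>e\<^bsup>(r)\<^esup> f\<^bsup>(n)\<^esup>\<close> (\<open>Kac\<close>) contains \<open>[K; 0; p]\<close> as the last term
  for \<open>r = n = p\<close>. This puts it into the restricted form (\<open>res_KB\<close>), and shows that it acts like
  \<open>e\<^bsup>(p)\<^esup> f\<^bsup>(p)\<^esup>\<close> on a vector that all \<open>e\<^bsup>(r)\<^esup>\<close> annihilate (\<open>E_F_on_killed\<close>).

  For the uniqueness let \<open>w\<close> be a highest weight vector of weight \<open>\<lambda>\<close>. Again by Kac's formula the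
  vectors \<open>f\<^bsup>(a)\<^esup> w\<close> span a submodule. Their weights \<open>\<lambda> - 2 a\<close> are pairwise distinguished by
  \<open>K\<close>, which sees \<open>a\<close> modulo \<open>p\<close>, and \<open>[K; 0; p]\<close>, which sees the quotient. So the vectors of weight
  \<open>\<lambda>\<close> in the module generated by \<open>w\<close> are the multiples of \<open>w\<close> (\<open>hw_weight_space\<close>). For two irreducible
  highest weight modules this is applied to the pair \<open>(v, w)\<close> of their generators in the product
  module: the generators have the same annihilator (\<open>annihilator_subset\<close>), and \<open>u v \<mapsto> u w\<close> is an
  isomorphism (\<open>Vres_unique\<close>).

  That the formulas for the Fock module do define an action (\<open>fock_module_exists\<close>) is easy over
  \<open>\<complex>(q)\<close>, where only the defining relations must be checked. Elements of the restricted form act there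
  by matrices over \<open>\<complex>[q, q\<inverse>]\<close>, and evaluation of the entries at \<open>\<epsilon>\<close> gives the module.
\<close>

section \<open>Laurent polynomials and q-binomials\<close>

lemma q_power: "q ^ n = Fraction_Field.Fract ([:0, 1:] ^ n) 1"
  by (induction n) (simp_all add: q_def One_fract_def)

lemma q_neq_0: "q \<noteq> 0"
  by (simp add: q_def Zero_fract_def eq_fract)

lemma q_power_neq_1: assumes "n > 0" shows "q ^ n \<noteq> 1"
proof
  assume "q ^ n = 1"
  hence "[:0, 1:] ^ n = (1 :: complex poly)" by (simp add: q_power One_fract_def eq_fract)
  hence "poly ([:0, 1:] ^ n) 0 = poly (1 :: complex poly) 0" by simp
  thus False using assms by (simp add: zero_power)
qed

lemma q_powi_eq_1: assumes "q powi n = 1" shows "n = 0"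
proof (rule ccontr)
  assume n: "n \<noteq> 0"
  have "q ^ nat \<bar>n\<bar> = 1"
    using assms n by (auto simp: power_int_def abs_if power_inverse split: if_splits)
  thus False using q_power_neq_1[of "nat \<bar>n\<bar>"] n by simp
qed

definition qdiff :: ratfun where "qdiff = q - inverse q"

lemma q_powi_diff_neq_0: assumes "n \<noteq> 0" shows "q powi n - q powi (- n) \<noteq> 0"
proof
  assume "q powi n - q powi (- n) = 0"
  hence "q powi n * q powi n = 1"
    by (simp add: power_int_minus q_neq_0 field_simps)
  hence "q powi (n + n) = 1" by (subst power_int_add) (simp_all add: q_neq_0)
  thus False using q_powi_eq_1[of "n + n"] assms by simp
qed

lemma qdiff_neq_0: "qdiff \<noteq> 0"
  using q_powi_diff_neq_0[of 1] by (simp add: qdiff_def power_int_minus)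

lemma qint_eq: "qint n = (q powi n - q powi (- n)) / qdiff"
  by (simp add: qint_def qdiff_def)

lemma qint_neq_0: "n \<noteq> 0 \<Longrightarrow> qint n \<noteq> 0"
  using q_powi_diff_neq_0 qdiff_neq_0 by (simp add: qint_eq)

lemma qint_0 [simp]: "qint 0 = 0" and qint_1 [simp]: "qint 1 = 1"
  using qdiff_neq_0 by (simp_all add: qint_eq power_int_minus) (simp add: qdiff_def)

lemma qfact_neq_0: "qfact m \<noteq> 0"
  by (auto simp: qfact_def qint_neq_0)

lemma qfact_0 [simp]: "qfact 0 = 1"
  by (simp add: qfact_def)

lemma qfact_Suc: "qfact (Suc m) = qfact m * qint (int (Suc m))"
  by (simp add: qfact_def)

lemma qint_add: "qint (a + b) = q powi a * qint b + q powi (- b) * qint a"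
  using qdiff_neq_0 q_neq_0
  by (simp add: qint_eq power_int_add power_int_minus power_int_diff divide_simps) (simp add: algebra_simps)

lemma qint_three_term:
  "qint x * qint (b - c) + qint c * qint (x + b) = qint b * qint (x + c)"
proof -
  define X B C where "X = q powi x" and "B = q powi b" and "C = q powi c"
  have nz: "X \<noteq> 0" "B \<noteq> 0" "C \<noteq> 0" by (auto simp: X_def B_def C_def q_neq_0)
  show ?thesis
    unfolding qint_eq power_int_minus using nz qdiff_neq_0
    by (simp add: power_int_add power_int_diff q_neq_0 X_def[symmetric] B_def[symmetric] C_def[symmetric])
       (simp add: field_simps)
qed

lemma Fract_in_laurent: "Fraction_Field.Fract P ([:0, 1:] ^ n) \<in> laurent"
  by (auto simp: laurent_def)

text \<open>
  Two fractions with a power of the variable as denominator that represent the same Laurent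
  polynomial have equal cross products, and the variable takes the value \<open>\<epsilon> \<noteq> 0\<close>.
\<close>
lemma value_at_Fract:
  assumes "\<epsilon> \<noteq> 0"
  shows "value_at \<epsilon> (Fraction_Field.Fract P ([:0, 1:] ^ n)) = poly P \<epsilon> / \<epsilon> ^ n"
  unfolding value_at_def
proof (rule the_equality)
  show "\<exists>Pa na. Fraction_Field.Fract P ([:0, 1:] ^ n) = Fraction_Field.Fract Pa ([:0, 1:] ^ na) \<and>
      poly P \<epsilon> / \<epsilon> ^ n = poly Pa \<epsilon> / \<epsilon> ^ na" by blast
next
  fix c assume "\<exists>Pa na. Fraction_Field.Fract P ([:0, 1:] ^ n) = Fraction_Field.Fract Pa ([:0, 1:] ^ na) \<and>
      c = poly Pa \<epsilon> / \<epsilon> ^ na"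
  then obtain Q m where eq: "Fraction_Field.Fract P ([:0, 1:] ^ n) = Fraction_Field.Fract Q ([:0, 1:] ^ m)"
    and c: "c = poly Q \<epsilon> / \<epsilon> ^ m" by blast
  from eq have "P * [:0, 1:] ^ m = Q * [:0, 1:] ^ n" by (simp add: eq_fract mult.commute)
  hence "poly (P * [:0, 1:] ^ m) \<epsilon> = poly (Q * [:0, 1:] ^ n) \<epsilon>" by simp
  hence "poly P \<epsilon> * \<epsilon> ^ m = poly Q \<epsilon> * \<epsilon> ^ n" by simp
  thus "c = poly P \<epsilon> / \<epsilon> ^ n" using assms by (simp add: c frac_eq_eq)
qed

lemma laurentE:
  assumes "a \<in> laurent"
  obtains P n where "a = Fraction_Field.Fract P ([:0, 1:] ^ n)"
  using assms by (auto simp: laurent_def)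

lemma Fract_add_X:
  "Fraction_Field.Fract P ([:0, 1:] ^ n) + Fraction_Field.Fract Q ([:0, 1:] ^ m) =
   Fraction_Field.Fract (P * [:0, 1:] ^ m + Q * [:0, 1:] ^ n) ([:0, 1:] ^ (n + m))"
  by (simp add: power_add)

lemma Fract_mult_X:
  "Fraction_Field.Fract P ([:0, 1:] ^ n) * Fraction_Field.Fract Q ([:0, 1:] ^ m) =
   Fraction_Field.Fract (P * Q) ([:0, 1:] ^ (n + m))"
  by (simp add: power_add)

lemma laurent_add: assumes "a \<in> laurent" "b \<in> laurent" shows "a + b \<in> laurent"
  using assms by (elim laurentE) (simp only: Fract_add_X Fract_in_laurent)

lemma laurent_mult: assumes "a \<in> laurent" "b \<in> laurent" shows "a * b \<in> laurent"
  using assms by (elim laurentE) (simp only: Fract_mult_X Fract_in_laurent)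

lemma const_Fract: "Fraction_Field.Fract [:c:] 1 = Fraction_Field.Fract [:c:] ([:0, 1:] ^ 0)"
  by simp

lemma laurent_const: "Fraction_Field.Fract [:c:] 1 \<in> laurent"
  by (subst const_Fract) (rule Fract_in_laurent)

lemma laurent_0: "0 \<in> laurent"
  using laurent_const[of 0] by (simp add: Zero_fract_def)

lemma laurent_1: "1 \<in> laurent"
  using laurent_const[of 1] by (simp add: One_fract_def one_pCons)

lemma laurent_m1: "-1 \<in> laurent"
proof -
  have "(-1 :: ratfun) = Fraction_Field.Fract [:-1:] 1" by (simp add: One_fract_def one_pCons)
  thus ?thesis by (simp only: laurent_const)
qed

lemma laurent_uminus: assumes "a \<in> laurent" shows "- a \<in> laurent"
  using laurent_mult[OF laurent_m1 assms] by simp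

lemma laurent_diff: assumes "a \<in> laurent" "b \<in> laurent" shows "a - b \<in> laurent"
  using laurent_add[OF assms(1) laurent_uminus[OF assms(2)]] by simp

lemma laurent_power: "a \<in> laurent \<Longrightarrow> a ^ n \<in> laurent"
  by (induction n) (simp_all add: laurent_1 laurent_mult)

lemma q_Fract: "q = Fraction_Field.Fract [:0, 1:] ([:0, 1:] ^ 0)"
  by (simp add: q_def)

lemma q_inverse_Fract: "inverse q = Fraction_Field.Fract 1 ([:0, 1:] ^ 1)"
  by (simp add: q_def)

lemma laurent_q: "q \<in> laurent"
  by (subst q_Fract) (rule Fract_in_laurent)

lemma laurent_q_inverse: "inverse q \<in> laurent"
  by (subst q_inverse_Fract) (rule Fract_in_laurent)

lemma laurent_q_powi: "q powi n \<in> laurent"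
  by (simp add: power_int_def laurent_q laurent_q_inverse laurent_power)

lemma laurent_sum: "(\<And>i. i \<in> A \<Longrightarrow> f i \<in> laurent) \<Longrightarrow> sum f A \<in> laurent"
  by (induction A rule: infinite_finite_induct) (simp_all add: laurent_0 laurent_add)

lemma laurent_prod: "(\<And>i. i \<in> A \<Longrightarrow> f i \<in> laurent) \<Longrightarrow> prod f A \<in> laurent"
  by (induction A rule: infinite_finite_induct) (simp_all add: laurent_1 laurent_mult)

text \<open>
  The denominator \<open>q - q\<inverse>\<close> is not a unit among the Laurent polynomials, so integrality comes from
  the recursion \<open>qint_add\<close> instead, in both directions from \<open>0\<close>.
\<close>
lemma laurent_qint: "qint n \<in> laurent"
proof (induction n rule: int_induct[where k = 0])
  case base show ?case by (simp add: laurent_0)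
next
  case (step1 i)
  have "qint (i + 1) = q powi i * 1 + q powi (- 1) * qint i"
    by (subst qint_add) simp
  thus ?case using step1 by (simp only: laurent_add laurent_mult laurent_q_powi laurent_1)
next
  case (step2 i)
  have "qint (i + (- 1)) = q powi i * qint (-1) + q powi 1 * qint i"
    by (subst qint_add) simp
  moreover have "qint (-1) = -1"
    using qdiff_neq_0 by (simp add: qint_eq power_int_minus) (simp add: qdiff_def divide_simps)
  ultimately have "qint (i - 1) = q powi i * (-1) + q powi 1 * qint i" by simp
  thus ?case using step2 by (simp only: laurent_add laurent_mult laurent_q_powi laurent_m1)
qed

context
  fixes \<epsilon> :: complex assumes eps: "\<epsilon> \<noteq> 0"
begin

lemma value_at_add:
  assumes "a \<in> laurent" "b \<in> laurent"
  shows "value_at \<epsilon> (a + b) = value_at \<epsilon> a + value_at \<epsilon> b"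
  using assms
  by (elim laurentE) (simp only: Fract_add_X value_at_Fract[OF eps], simp add: eps field_simps power_add)

lemma value_at_mult:
  assumes "a \<in> laurent" "b \<in> laurent"
  shows "value_at \<epsilon> (a * b) = value_at \<epsilon> a * value_at \<epsilon> b"
  using assms
  by (elim laurentE) (simp only: Fract_mult_X value_at_Fract[OF eps], simp add: eps power_add)

lemma value_at_const: "value_at \<epsilon> (Fraction_Field.Fract [:c:] 1) = c"
  by (subst const_Fract) (simp only: value_at_Fract[OF eps], simp)

lemma value_at_0 [simp]: "value_at \<epsilon> 0 = 0"
  using value_at_const[of 0] by (simp add: Zero_fract_def)

lemma value_at_1 [simp]: "value_at \<epsilon> 1 = 1"
  using value_at_const[of 1] by (simp add: One_fract_def one_pCons)

lemma value_at_uminus: assumes "a \<in> laurent" shows "value_at \<epsilon> (- a) = - value_at \<epsilon> a"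
  using value_at_add[OF assms laurent_uminus[OF assms]] by (simp add: eq_neg_iff_add_eq_0 add.commute)

lemma value_at_diff:
  assumes "a \<in> laurent" "b \<in> laurent"
  shows "value_at \<epsilon> (a - b) = value_at \<epsilon> a - value_at \<epsilon> b"
  using value_at_add[OF assms(1) laurent_uminus[OF assms(2)]] by (simp add: value_at_uminus assms)

lemma value_at_q: "value_at \<epsilon> q = \<epsilon>"
  by (subst q_Fract) (simp only: value_at_Fract[OF eps], simp)

lemma value_at_q_inverse: "value_at \<epsilon> (inverse q) = inverse \<epsilon>"
  by (subst q_inverse_Fract) (simp only: value_at_Fract[OF eps], simp add: field_simps)

lemma value_at_power: "a \<in> laurent \<Longrightarrow> value_at \<epsilon> (a ^ n) = value_at \<epsilon> a ^ n"
  by (induction n) (simp_all add: laurent_power value_at_mult)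

lemma value_at_q_powi: "value_at \<epsilon> (q powi n) = \<epsilon> powi n"
  by (simp add: power_int_def value_at_power laurent_q laurent_q_inverse value_at_q value_at_q_inverse)

lemma value_at_sum:
  "(\<And>i. i \<in> A \<Longrightarrow> f i \<in> laurent) \<Longrightarrow> value_at \<epsilon> (sum f A) = (\<Sum>i\<in>A. value_at \<epsilon> (f i))"
  by (induction A rule: infinite_finite_induct) (simp_all add: laurent_sum value_at_add)

lemma value_at_prod:
  "(\<And>i. i \<in> A \<Longrightarrow> f i \<in> laurent) \<Longrightarrow> value_at \<epsilon> (prod f A) = (\<Prod>i\<in>A. value_at \<epsilon> (f i))"
  by (induction A rule: infinite_finite_induct) (simp_all add: laurent_prod value_at_mult)

lemma value_at_qint: "value_at \<epsilon> (qint n) * (\<epsilon> - inverse \<epsilon>) = \<epsilon> powi n - \<epsilon> powi (- n)"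
proof -
  have "qint n * (q - inverse q) = q powi n - q powi (- n)"
    using qdiff_neq_0 by (simp add: qint_eq) (simp add: qdiff_def)
  hence "value_at \<epsilon> (qint n * (q - inverse q)) = value_at \<epsilon> (q powi n - q powi (- n))" by simp
  thus ?thesis
    by (simp add: value_at_mult value_at_diff laurent_diff laurent_q laurent_q_inverse laurent_qint
      laurent_q_powi value_at_q value_at_q_inverse value_at_q_powi)
qed

end

lemma qbinom_0 [simp]: "qbinom n 0 = 1"
  by (simp add: qbinom_def)

lemma qbinom_Suc: "qbinom n (int (Suc m)) = qbinom n (int m) * qint (n - int m) / qint (int (Suc m))"
proof -
  have "nat (1 + int m) = Suc m" by simp
  thus ?thesis by (simp add: qbinom_def qfact_Suc)
qed

lemma qbinom_1: "qbinom n 1 = qint n"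
  using qbinom_Suc[of n 0] by simp

text \<open>
  The coefficients of this recursion are Laurent polynomials, and the one of
  \<open>qbinom n (Suc m)\<close> is a unit.
  Starting from \<open>n = 0\<close>, it shows that q-binomials with positive or negative upper entry can be
  evaluated at a root of unity, although the q-factorial in their denominator may vanish there.
\<close>
lemma qbinom_Pascal:
  "qbinom (n + 1) (int (Suc m)) =
     q powi (int (Suc m)) * qbinom n (int (Suc m)) + q powi (int m - n) * qbinom n (int m)"
proof (induction m)
  case 0
  show ?case using qint_add[of 1 n] by (simp add: qbinom_1 add.commute)
next
  case (Suc m)
  have front: "qbinom (n + 1) (int (Suc k)) = qint (n + 1) / qint (int (Suc k)) * qbinom n (int k)" for k
  proof (induction k)
    case 0 show ?case by (simp add: qbinom_1)
  next
    case (Suc k)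
    show ?case
      by (subst qbinom_Suc, subst Suc.IH, subst qbinom_Suc) (simp add: algebra_simps)
  qed
  have nz: "qint (int (Suc (Suc m))) \<noteq> 0" by (rule qint_neq_0) simp
  have s: "qint (n + 1) = q powi int (Suc (Suc m)) * qint (n - int (Suc m)) + q powi (int (Suc m) - n) * qint (int (Suc (Suc m)))"
    using qint_add[of "int (Suc (Suc m))" "n - int (Suc m)"] by (simp add: algebra_simps)
  have "qbinom (n + 1) (int (Suc (Suc m))) = qint (n + 1) / qint (int (Suc (Suc m))) * qbinom n (int (Suc m))"
    by (rule front)
  also have "\<dots> = q powi int (Suc (Suc m)) * (qbinom n (int (Suc m)) * qint (n - int (Suc m)) / qint (int (Suc (Suc m))))
     + q powi (int (Suc m) - n) * qbinom n (int (Suc m))"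
    unfolding s using nz by (simp add: add_divide_distrib algebra_simps)
  finally show ?case by (simp only: qbinom_Suc[symmetric])
qed

lemma qbinom_zero: "qbinom 0 (int (Suc m)) = 0"
  by (auto simp: qbinom_def intro!: bexI[of _ 0])

lemma laurent_qbinom: "qbinom n m \<in> laurent"
proof -
  have *: "qbinom n (int k) \<in> laurent" for k
  proof (induction k arbitrary: n)
    case 0 show ?case by (simp add: laurent_1)
  next
    case (Suc k)
    show ?case
    proof (induction n rule: int_induct[where k = 0])
      case base show ?case by (simp only: qbinom_zero laurent_0)
    next
      case (step1 i)
      thus ?case unfolding qbinom_Pascal by (intro laurent_add laurent_mult laurent_q_powi Suc.IH)
    next
      case (step2 i)
      have "qbinom (i - 1 + 1) (int (Suc k)) =
        q powi (int (Suc k)) * qbinom (i - 1) (int (Suc k)) + q powi (int k - (i - 1)) * qbinom (i - 1) (int k)"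
        by (rule qbinom_Pascal)
      hence "qbinom (i - 1) (int (Suc k)) =
        q powi (- int (Suc k)) * (qbinom i (int (Suc k)) - q powi (int k - (i - 1)) * qbinom (i - 1) (int k))"
        by (simp add: power_int_minus q_neq_0 field_simps del: of_nat_Suc)
      thus ?case using step2
        by (simp only: laurent_diff laurent_mult laurent_q_powi Suc.IH)
    qed
  qed
  show ?thesis
  proof (cases "m < 0")
    case True thus ?thesis by (simp add: qbinom_def laurent_0)
  next
    case False thus ?thesis using *[of "nat m"] by simp
  qed
qed

lemma qbinom_nat: "qbinom (int (a + b)) (int a) = qfact (a + b) / (qfact a * qfact b)"
proof -
  have "(\<Prod>i<a. qint (int (a + b) - int i)) * qfact b = qfact (a + b)"
  proof (induction a)
    case 0 show ?case by simp
  next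
    case (Suc a)
    have "(\<Prod>i<Suc a. qint (int (Suc a + b) - int i)) = qint (int (Suc a + b)) * (\<Prod>i<a. qint (int (a + b) - int i))"
      by (subst prod.lessThan_Suc_shift) simp
    thus ?case using Suc.IH by (simp add: qfact_Suc ac_simps)
  qed
  thus ?thesis by (simp add: qbinom_def field_simps qfact_neq_0)
qed

text \<open>
  Both sides group the \<open>a + b\<close> factors of the numerator \<open>[n][n - 1]\<dots>\<close> as the first \<open>a\<close> and the
  remaining \<open>b\<close>. At a root of unity the identity computes \<open>qbinom n (a + b)\<close> from shorter q-binomials
  whenever \<open>qbinom (a + b) a\<close> stays nonzero; all facts on zeros below are derived in this way.
\<close>
lemma qbinom_mult:
  "qbinom n (int a) * qbinom (n - int a) (int b) = qbinom (int (a + b)) (int a) * qbinom n (int (a + b))"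
proof (induction b)
  case 0
  show ?case using qbinom_nat[of a 0] by (simp add: qfact_neq_0)
next
  case (Suc b)
  have nz: "qint (int (Suc b)) \<noteq> 0" "qint (int (Suc (a + b))) \<noteq> 0" by (auto intro!: qint_neq_0)
  have step: "qbinom (int (a + Suc b)) (int a) * qint (int (Suc b)) = qbinom (int (a + b)) (int a) * qint (int (Suc (a + b)))"
  proof -
    have cancel: "x * u = y * v" if "x * (s * (t * u)) = z * v" "y * (s * t) = z" "s \<noteq> 0" "t \<noteq> 0"
      for x y z s t u v :: ratfun
    proof -
      have "(x * u) * (s * t) = (y * v) * (s * t)" using that(1) that(2)[symmetric] by (simp add: ac_simps)
      thus ?thesis using that(3,4) by simp
    qed
    show ?thesis
    proof (rule cancel)
      show "qbinom (int (a + Suc b)) (int a) * (qfact a * (qfact b * qint (int (Suc b)))) = qfact (a + b) * qint (int (Suc (a + b)))"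
        using qbinom_nat[of a "Suc b"] nz qfact_neq_0
        by (simp only: qfact_Suc add_Suc_right) (simp add: qfact_neq_0 del: of_nat_Suc)
      show "qbinom (int (a + b)) (int a) * (qfact a * qfact b) = qfact (a + b)"
        unfolding qbinom_nat using qfact_neq_0 by simp
    qed (rule qfact_neq_0)+
  qed
  have "qbinom n (int a) * qbinom (n - int a) (int (Suc b))
     = (qbinom n (int a) * qbinom (n - int a) (int b)) * qint (n - int a - int b) / qint (int (Suc b))"
    by (simp add: qbinom_Suc del: of_nat_Suc)
  also have "\<dots> = (qbinom (int (a + b)) (int a) * qint (int (Suc (a + b)))) * qbinom n (int (a + b)) * qint (n - int (a + b)) / qint (int (Suc b)) / qint (int (Suc (a + b)))"
    using nz by (simp add: Suc.IH algebra_simps del: of_nat_Suc)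
  also have "\<dots> = qbinom (int (a + Suc b)) (int a) * (qbinom n (int (a + b)) * qint (n - int (a + b)) / qint (int (Suc (a + b))))"
    unfolding step[symmetric] using nz by simp
  finally show ?case by (simp only: qbinom_Suc[symmetric] add_Suc_right)
qed

section \<open>q-binomials at a root of unity\<close>

locale odd_root_of_unity =
  fixes p :: nat and \<epsilon> :: complex
  assumes p_gt_1: "p > 1" and odd_p: "odd p" and eps_p: "\<epsilon> ^ p = 1"
    and primitive: "\<forall>k. 0 < k \<and> k < p \<longrightarrow> \<epsilon> ^ k \<noteq> 1"
begin

lemma eps_neq_0: "\<epsilon> \<noteq> 0"
  using eps_p p_gt_1 by (auto simp: zero_power)

lemma eps_powi_eq_1_iff: "\<epsilon> powi n = 1 \<longleftrightarrow> int p dvd n"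
proof -
  have red: "\<epsilon> powi n = \<epsilon> ^ nat (n mod int p)"
  proof -
    have "\<epsilon> powi n = \<epsilon> powi (int p * (n div int p) + n mod int p)" by simp
    also have "\<dots> = (\<epsilon> powi int p) powi (n div int p) * \<epsilon> powi (n mod int p)"
      by (subst power_int_add) (simp_all add: eps_neq_0 power_int_mult)
    also have "\<dots> = \<epsilon> powi (n mod int p)" by (simp add: eps_p)
    also have "\<dots> = \<epsilon> ^ nat (n mod int p)" using p_gt_1 by (simp add: power_int_def)
    finally show ?thesis .
  qed
  show ?thesis
  proof
    assume "int p dvd n" thus "\<epsilon> powi n = 1" by (simp add: red)
  next
    assume "\<epsilon> powi n = 1"
    hence "\<epsilon> ^ nat (n mod int p) = 1" by (simp add: red)
    moreover have "nat (n mod int p) < p" using p_gt_1 by (simp add: nat_less_iff)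
    ultimately have "nat (n mod int p) = 0" using primitive by (metis gr0I)
    moreover have "n mod int p \<ge> 0" using p_gt_1 by simp
    ultimately show "int p dvd n" by auto
  qed
qed

lemma eps_powi_eq_iff: "\<epsilon> powi m = \<epsilon> powi n \<longleftrightarrow> int p dvd m - n"
  using eps_powi_eq_1_iff[of "m - n"] eps_neq_0 by (simp add: power_int_diff)

text \<open>
  Here the oddness of \<open>p\<close> enters: a q-integer compares \<open>\<epsilon>\<^sup>n\<close> with \<open>\<epsilon>\<close> to the power \<open>- n\<close>, and \<open>f\<close>
  changes weights by \<open>2\<close>.
\<close>
lemma p_dvd_2_mult: "int p dvd 2 * n \<longleftrightarrow> int p dvd n"
proof -
  have "coprime (int p) 2" using odd_p by simp
  thus ?thesis by (metis coprime_dvd_mult_right_iff)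
qed

abbreviation val :: "ratfun \<Rightarrow> complex" where "val \<equiv> value_at \<epsilon>"

lemmas val_simps =
  value_at_add[OF eps_neq_0] value_at_mult[OF eps_neq_0] value_at_diff[OF eps_neq_0]
  value_at_0[OF eps_neq_0] value_at_1[OF eps_neq_0] value_at_q_powi[OF eps_neq_0]
  value_at_prod[OF eps_neq_0]

lemma eps_diff_neq_0: "\<epsilon> - inverse \<epsilon> \<noteq> 0"
proof
  assume "\<epsilon> - inverse \<epsilon> = 0"
  hence "\<epsilon> powi 1 = \<epsilon> powi (-1)" by (simp add: power_int_minus)
  hence "int p dvd 2 * 1" by (subst (asm) eps_powi_eq_iff) simp
  hence "int p dvd 1" by (simp only: p_dvd_2_mult)
  thus False using p_gt_1 by simp
qed

lemma val_qint: "val (qint n) = (\<epsilon> powi n - \<epsilon> powi (- n)) / (\<epsilon> - inverse \<epsilon>)"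
  using value_at_qint[OF eps_neq_0, of n] eps_diff_neq_0 by (simp add: field_simps)

lemma val_qint_eq_0_iff: "val (qint n) = 0 \<longleftrightarrow> int p dvd n"
proof -
  have "val (qint n) = 0 \<longleftrightarrow> \<epsilon> powi n = \<epsilon> powi (- n)" using eps_diff_neq_0 by (simp add: val_qint)
  also have "\<dots> \<longleftrightarrow> int p dvd 2 * n" by (subst eps_powi_eq_iff) simp
  finally show ?thesis by (simp only: p_dvd_2_mult)
qed

lemma val_qint_cong: "int p dvd m - n \<Longrightarrow> val (qint m) = val (qint n)"
proof -
  assume d: "int p dvd m - n"
  hence "int p dvd (- m) - (- n)" by (metis dvd_minus_iff minus_diff_minus)
  thus ?thesis unfolding val_qint using d eps_powi_eq_iff by metis
qed

text \<open>
  At \<open>\<epsilon>\<close> the quotient \<open>[p k] / [p]\<close> has the form \<open>0 / 0\<close>. It is the q-integer of \<open>k\<close> in the variable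
  \<open>q\<^sup>p\<close>, which takes the value \<open>1\<close>.
\<close>
lemma qint_mult_quotient:
  "\<exists>c\<in>laurent. qint (int p * k) = c * qint (int p) \<and> val c = of_int k"
proof (induction k rule: int_induct[where k = 0])
  case base
  show ?case by (intro bexI[of _ 0]) (simp_all add: laurent_0 val_simps)
next
  case (step1 k)
  then obtain c where c: "c \<in> laurent" "qint (int p * k) = c * qint (int p)" "val c = of_int k" by blast
  let ?d = "q powi (int p * k) + q powi (- int p) * c"
  have "qint (int p * (k + 1)) = ?d * qint (int p)"
    using qint_add[of "int p * k" "int p"] c(2) by (simp add: algebra_simps)
  moreover have "?d \<in> laurent" by (intro laurent_add laurent_mult laurent_q_powi c)
  moreover have "val ?d = of_int (k + 1)"
  proof -
    have "\<epsilon> powi (int p * k) = 1" "\<epsilon> powi (- int p) = 1" by (simp_all only: eps_powi_eq_1_iff) simp_all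
    thus ?thesis by (simp add: val_simps laurent_q_powi laurent_mult c)
  qed
  ultimately show ?case by blast
next
  case (step2 k)
  then obtain c where c: "c \<in> laurent" "qint (int p * k) = c * qint (int p)" "val c = of_int k" by blast
  let ?d = "q powi (int p) * c - q powi (int p * k)"
  have m: "qint (- int p) = - qint (int p)" unfolding qint_eq by (simp add: minus_divide_left)
  have "qint (int p * (k - 1)) = ?d * qint (int p)"
    using qint_add[of "int p * k" "- int p"] c(2) by (simp add: algebra_simps m)
  moreover have "?d \<in> laurent" by (intro laurent_diff laurent_mult laurent_q_powi c)
  moreover have "val ?d = of_int (k - 1)"
  proof -
    have "\<epsilon> powi (int p * k) = 1" "\<epsilon> powi (int p) = 1" by (simp_all only: eps_powi_eq_1_iff) simp_all
    thus ?thesis by (simp add: val_simps laurent_q_powi laurent_mult c del: power_int_of_nat)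
  qed
  ultimately show ?case by blast
qed

abbreviation B :: "int \<Rightarrow> nat \<Rightarrow> complex" where "B n r \<equiv> qbinom_at \<epsilon> n (int r)"

lemma B_0 [simp]: "qbinom_at \<epsilon> n 0 = 1"
  by (simp add: qbinom_at_def val_simps)

lemma B_mult: "B n a * B (n - int a) b = B (int (a + b)) a * B n (a + b)"
  unfolding qbinom_at_def
  by (simp only: value_at_mult[OF eps_neq_0, symmetric] laurent_qbinom qbinom_mult)

lemma laurent_qfact: "qfact r \<in> laurent"
  unfolding qfact_def by (intro laurent_prod laurent_qint)

lemma qbinom_qfact: "qbinom n (int r) * qfact r = (\<Prod>i<r. qint (n - int i))"
  using qfact_neq_0 by (simp add: qbinom_def)

lemma B_qfact: "B n r * val (qfact r) = (\<Prod>i<r. val (qint (n - int i)))"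
proof -
  have "val (qbinom n (int r) * qfact r) = val (\<Prod>i<r. qint (n - int i))"
    by (simp only: qbinom_qfact)
  thus ?thesis by (simp add: val_simps laurent_qbinom laurent_qfact laurent_qint qbinom_at_def)
qed

lemma val_qfact: "val (qfact r) = (\<Prod>i=1..r. val (qint (int i)))"
  unfolding qfact_def by (simp add: val_simps laurent_qint)

lemma val_qfact_neq_0: "r < p \<Longrightarrow> val (qfact r) \<noteq> 0"
  by (auto simp: val_qfact val_qint_eq_0_iff dest: dvd_imp_le)

text \<open>
  The denominator \<open>[r]!\<close> is nonzero at \<open>\<epsilon>\<close>, so the zeros are those of the numerator: one of
  \<open>n, n - 1, \<dots>, n - r + 1\<close> is a multiple of \<open>p\<close>.
\<close>
lemma B_small_eq_0_iff:
  assumes "r < p" shows "B n r = 0 \<longleftrightarrow> n mod int p < int r"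
proof -
  have "B n r = 0 \<longleftrightarrow> (\<exists>i<r. int p dvd n - int i)"
    using B_qfact[of n r] val_qfact_neq_0[OF assms]
    by (metis (no_types, lifting) finite_lessThan lessThan_iff mult_eq_0_iff prod_zero_iff val_qint_eq_0_iff)
  also have "\<dots> \<longleftrightarrow> n mod int p < int r"
  proof
    assume "\<exists>i<r. int p dvd n - int i"
    then obtain i where i: "i < r" "int p dvd n - int i" by blast
    hence "n mod int p = int i mod int p" by (simp add: mod_eq_dvd_iff)
    thus "n mod int p < int r" using i assms by simp
  next
    assume a: "n mod int p < int r"
    have "n mod int p \<ge> 0" using p_gt_1 by simp
    thus "\<exists>i<r. int p dvd n - int i" using a
      by (intro exI[of _ "nat (n mod int p)"]) (auto simp: nat_less_iff)
  qed
  finally show ?thesis .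
qed

text \<open>
  Among the \<open>p\<close> integers \<open>n, \<dots>, n - p + 1\<close> exactly one is a multiple of \<open>p\<close>, namely
  \<open>p (n div p)\<close>. Its q-integer divided by \<open>[p]\<close> has the value \<open>n div p\<close>. The others represent all
  nonzero residues, and their q-integers cancel with \<open>[p - 1]!\<close>.
\<close>
lemma B_p: "B n p = of_int (n div int p)"
proof -
  define i0 where "i0 = nat (n mod int p)"
  have m0: "n mod int p \<ge> 0" "n mod int p < int p" using p_gt_1 by auto
  have i0: "i0 < p" "int i0 = n mod int p" using m0 by (auto simp: i0_def)
  have n_i0: "n - int i0 = int p * (n div int p)" by (simp add: i0 minus_mod_eq_mult_div)
  \<comment> \<open>The factor \<open>[p]\<close> vanishes at \<open>\<epsilon>\<close> and must be cancelled before evaluation.\<close>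
  obtain c where c: "c \<in> laurent" "qint (n - int i0) = c * qint (int p)" "val c = of_int (n div int p)"
    using qint_mult_quotient[of "n div int p"] n_i0 by metis
  have p: "p = Suc (p - 1)" using p_gt_1 by simp
  have fp: "qfact p = qfact (p - 1) * qint (int p)" using qfact_Suc[of "p - 1"] p by simp
  have "qbinom n (int p) * qfact (p - 1) * qint (int p) = (\<Prod>i<p. qint (n - int i))"
    using qbinom_qfact[of n p] by (simp add: fp mult.assoc)
  also have "\<dots> = qint (n - int i0) * (\<Prod>i\<in>{..<p} - {i0}. qint (n - int i))"
    by (rule prod.remove) (use i0 in auto)
  also have "\<dots> = c * (\<Prod>i\<in>{..<p} - {i0}. qint (n - int i)) * qint (int p)" by (simp add: c)
  finally have "qbinom n (int p) * qfact (p - 1) = c * (\<Prod>i\<in>{..<p} - {i0}. qint (n - int i))"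
    using p_gt_1 by (simp add: qint_neq_0)
  hence "val (qbinom n (int p) * qfact (p - 1)) = val (c * (\<Prod>i\<in>{..<p} - {i0}. qint (n - int i)))" by simp
  hence "B n p * val (qfact (p - 1)) = of_int (n div int p) * (\<Prod>i\<in>{..<p} - {i0}. val (qint (n - int i)))"
    by (simp add: val_simps laurent_qbinom laurent_qfact laurent_qint laurent_prod c qbinom_at_def)
  also have "(\<Prod>i\<in>{..<p} - {i0}. val (qint (n - int i))) = (\<Prod>i=1..p-1. val (qint (int i)))"
  proof (rule prod.reindex_bij_witness[of _ "\<lambda>j. nat ((n - int j) mod int p)" "\<lambda>i. nat ((n - int i) mod int p)"])
    fix i assume i: "i \<in> {..<p} - {i0}"
    have nn: "(n - int i) mod int p \<ge> 0" "(n - int i) mod int p < int p" using p_gt_1 by auto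
    have e: "int (nat ((n - int i) mod int p)) = (n - int i) mod int p" using nn by simp
    have "(n - int ((nat ((n - int i) mod int p)))) mod int p = int i mod int p"
      unfolding e by (simp add: mod_diff_right_eq)
    thus "nat ((n - int (nat ((n - int i) mod int p))) mod int p) = i" using i by simp
    have "(n - int i) mod int p \<noteq> 0"
    proof
      assume "(n - int i) mod int p = 0"
      hence "int p dvd n - int i" by (simp add: mod_eq_0_iff_dvd)
      hence "n mod int p = int i mod int p" by (simp add: mod_eq_dvd_iff)
      thus False using i i0 by simp
    qed
    thus "nat ((n - int i) mod int p) \<in> {1..p - 1}" using nn by (auto simp: nat_le_iff nat_less_iff)
    show "val (qint (int (nat ((n - int i) mod int p)))) = val (qint (n - int i))"
      unfolding e by (rule val_qint_cong) (simp add: mod_eq_dvd_iff[symmetric])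
  next
    fix j assume j: "j \<in> {1..p - 1}"
    have nn: "(n - int j) mod int p \<ge> 0" "(n - int j) mod int p < int p" using p_gt_1 by auto
    have e: "int (nat ((n - int j) mod int p)) = (n - int j) mod int p" using nn by simp
    have "(n - int ((nat ((n - int j) mod int p)))) mod int p = int j mod int p"
      unfolding e by (simp add: mod_diff_right_eq)
    also have "\<dots> = int j" using j by auto
    finally show "nat ((n - int (nat ((n - int j) mod int p))) mod int p) = j" by simp
    have "(n - int j) mod int p \<noteq> n mod int p"
    proof
      assume "(n - int j) mod int p = n mod int p"
      hence "int p dvd (n - int j) - n" by (simp only: mod_eq_dvd_iff)
      hence "int p dvd int j" by simp
      thus False using j by (auto dest: dvd_imp_le)
    qed
    thus "nat ((n - int j) mod int p) \<in> {..<p} - {i0}" using nn m0 by (auto simp: i0_def nat_less_iff nat_eq_iff2)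
  qed
  also have "\<dots> = val (qfact (p - 1))" by (simp add: val_qfact)
  finally show ?thesis using val_qfact_neq_0[of "p - 1"] p_gt_1 by simp
qed

text \<open>
  The product of divided powers of degrees \<open>d\<close> and \<open>r - d\<close> is the one of degree \<open>r\<close> times this
  q-binomial. As it is invertible, induction shows that degrees \<open>1\<close> and \<open>p\<close> generate all divided powers.
\<close>
lemma exists_invertible_split:
  assumes "r \<ge> 1" obtains d where "d \<in> {1, p}" "d \<le> r" "B (int r) d \<noteq> 0"
proof (cases "r < p")
  case True
  have "B (int r) 1 \<noteq> 0" using B_small_eq_0_iff[of 1 "int r"] p_gt_1 True assms by simp
  thus ?thesis using that[of 1] assms by simp
next
  case False
  have "B (int r) p \<noteq> 0" using False p_gt_1 by (simp add: B_p div_eq_0_iff flip: zdiv_int)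
  thus ?thesis using that[of p] False by simp
qed

lemma B_mult_p_neq_0: "int p * int j \<le> n \<Longrightarrow> B n (p * j) \<noteq> 0"
proof (induction j)
  case 0 show ?case by simp
next
  case (Suc j)
  have "B n (p * j) * B (n - int (p * j)) p = B (int (p * j + p)) (p * j) * B n (p * j + p)"
    by (rule B_mult)
  moreover have "B n (p * j) \<noteq> 0" using Suc by (intro Suc.IH) (simp add: algebra_simps)
  moreover have "B (n - int (p * j)) p \<noteq> 0"
  proof -
    have "(n - int (p * j)) div int p \<ge> 1"
      using Suc.prems p_gt_1 zdiv_mono1[of "int p" "n - int (p * j)" "int p"] by (simp add: algebra_simps)
    thus ?thesis by (simp add: B_p)
  qed
  ultimately show ?case by (metis add.commute mult_Suc_right mult_eq_0_iff)
qed

text \<open>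
  The part of Lucas' theorem that concerns the last digit. Splitting \<open>r\<close> as \<open>p (r div p) + r mod p\<close>
  in \<open>B_mult\<close>, the two factors that involve a multiple of \<open>p\<close> are nonzero, and the remaining factor
  depends only on the last digits.
\<close>
theorem B_eq_0_iff:
  assumes "r \<le> n" shows "B (int n) r = 0 \<longleftrightarrow> n mod p < r mod p"
proof -
  define a b where "a = p * (r div p)" and "b = r mod p"
  have ab: "a + b = r" "b < p" using p_gt_1 by (auto simp: a_def b_def)
  have "B (int n) a * B (int n - int a) b = B (int (a + b)) a * B (int n) (a + b)" by (rule B_mult)
  moreover have "B (int n) a \<noteq> 0" unfolding a_def
    by (rule B_mult_p_neq_0) (metis ab(1) a_def assms le_add1 le_trans of_nat_le_iff of_nat_mult)
  moreover have "B (int (a + b)) a \<noteq> 0" unfolding a_def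
    by (rule B_mult_p_neq_0) simp
  ultimately have "B (int n) r = 0 \<longleftrightarrow> B (int n - int a) b = 0" using ab(1) by (metis mult_eq_0_iff)
  also have "\<dots> \<longleftrightarrow> (int n - int a) mod int p < int b" by (rule B_small_eq_0_iff[OF ab(2)])
  also have "(int n - int a) mod int p = int (n mod p)"
    by (metis a_def mod_mult_self2 diff_add_cancel mult.commute of_nat_mult zmod_int)
  finally show ?thesis by (simp add: b_def)
qed

end

section \<open>Linear extension to formal sums\<close>

abbreviation single where "single \<equiv> Poly_Mapping.single"
abbreviation lookup where "lookup \<equiv> Poly_Mapping.lookup"
abbreviation keys where "keys \<equiv> Poly_Mapping.keys"

definition scal :: "'k::comm_ring_1 \<Rightarrow> ('b \<Rightarrow>\<^sub>0 'k) \<Rightarrow> ('b \<Rightarrow>\<^sub>0 'k)"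
  where "scal c x = Poly_Mapping.map ((*) c) x"

lemma lookup_scal [simp]: "lookup (scal c x) k = c * lookup x k"
  by (simp add: scal_def Poly_Mapping.map.rep_eq when_def)

lemma scal_simps:
  "scal c (x + y) = scal c x + scal c y" "scal (c + d) x = scal c x + scal d x"
  "scal c (scal d x) = scal (c * d) x" "scal 1 x = x" "scal 0 x = 0" "scal c 0 = 0"
  "scal c (single k a) = single k (c * a)"
  by (rule poly_mapping_eqI, simp add: algebra_simps lookup_add lookup_single when_def)+

lemma scal_sum: "scal c (\<Sum>i\<in>A. f i) = (\<Sum>i\<in>A. scal c (f i))"
  by (induction A rule: infinite_finite_induct) (simp_all add: scal_simps)

text \<open>
  Besides a linear extension, \<open>lin \<phi> x\<close> is the product of a vector \<open>x\<close> with the matrix that has the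
  columns \<open>\<phi> a\<close>. The product of two column-finite matrices is then \<open>\<lambda>i. lin \<phi> (\<psi> i)\<close>.
\<close>
definition lin :: "('a \<Rightarrow> ('b \<Rightarrow>\<^sub>0 'k::comm_ring_1)) \<Rightarrow> ('a \<Rightarrow>\<^sub>0 'k) \<Rightarrow> ('b \<Rightarrow>\<^sub>0 'k)"
  where "lin \<phi> x = (\<Sum>a\<in>keys x. scal (lookup x a) (\<phi> a))"

lemma lin_superset:
  assumes "finite A" "keys x \<subseteq> A"
  shows "lin \<phi> x = (\<Sum>a\<in>A. scal (lookup x a) (\<phi> a))"
  unfolding lin_def
  by (rule sum.mono_neutral_left) (use assms in \<open>auto simp: in_keys_iff scal_simps\<close>)

lemma lin_add: "lin \<phi> (x + y) = lin \<phi> x + lin \<phi> y"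
proof -
  let ?A = "keys x \<union> keys y"
  have "keys (x + y) \<subseteq> ?A" by (rule Poly_Mapping.keys_add)
  thus ?thesis
    by (simp add: lin_superset[of ?A] lookup_add scal_simps sum.distrib)
qed

lemma lin_scal: "lin \<phi> (scal c x) = scal c (lin \<phi> x)"
proof -
  have "keys (scal c x) \<subseteq> keys x" by (auto simp: in_keys_iff)
  thus ?thesis
    by (simp add: lin_superset[of "keys x"] scal_sum scal_simps)
qed

lemma lin_0 [simp]: "lin \<phi> 0 = 0"
  by (simp add: lin_def)

lemma lin_single [simp]: "lin \<phi> (single a c) = scal c (\<phi> a)"
  by (subst lin_superset[of "{a}"]) auto

lemma lin_uminus: "lin \<phi> (- x) = - lin \<phi> x"
  using lin_add[of \<phi> x "- x"] by (simp add: eq_neg_iff_add_eq_0 add.commute)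

lemma lin_diff: "lin \<phi> (x - y) = lin \<phi> x - lin \<phi> y"
  using lin_add[of \<phi> x "- y"] by (simp add: lin_uminus)

lemma lin_sum: "lin \<phi> (\<Sum>i\<in>A. f i) = (\<Sum>i\<in>A. lin \<phi> (f i))"
  by (induction A rule: infinite_finite_induct) (simp_all add: lin_add)

lemma lin_lin: "lin \<phi> (lin \<psi> x) = lin (\<lambda>a. lin \<phi> (\<psi> a)) x"
  by (simp add: lin_def[of \<psi>] lin_def[of "\<lambda>a. lin \<phi> (\<psi> a)"] lin_sum lin_scal)

lemma lin_cong: "(\<And>a. a \<in> keys x \<Longrightarrow> \<phi> a = \<psi> a) \<Longrightarrow> lin \<phi> x = lin \<psi> x"
  by (simp add: lin_def)

lemma lin_fun_add: "lin (\<lambda>a. \<phi> a + \<psi> a) x = lin \<phi> x + lin \<psi> x"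
  by (simp add: lin_def scal_simps sum.distrib)

lemma lin_fun_scal: "lin (\<lambda>a. scal c (\<phi> a)) x = scal c (lin \<phi> x)"
  by (simp add: lin_def scal_simps scal_sum mult.commute)

lemma lin_fun_0 [simp]: "lin (\<lambda>a. 0) x = 0"
  by (simp add: lin_def scal_simps)

lemma lin_single_id: "lin (\<lambda>a. single a 1) x = x"
proof (rule poly_mapping_eqI)
  fix k
  have "lookup (lin (\<lambda>a. single a 1) x) k =
    (\<Sum>a\<in>keys x. if a = k then lookup x a else 0)"
    by (simp add: lin_def lookup_sum lookup_single when_def if_distrib cong: if_cong)
  also have "\<dots> = lookup x k" by (simp add: in_keys_iff)
  finally show "lookup (lin (\<lambda>a. single a 1) x) k = lookup x k" .
qed

lemma lin_swap: "lin (\<lambda>a. lin (\<lambda>b. \<phi> a b) y) x = lin (\<lambda>b. lin (\<lambda>a. \<phi> a b) x) y"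
proof -
  have "lin (\<lambda>a. lin (\<lambda>b. \<phi> a b) y) x =
      (\<Sum>a\<in>keys x. \<Sum>b\<in>keys y. scal (lookup x a * lookup y b) (\<phi> a b))"
    by (simp add: lin_def scal_sum scal_simps)
  also have "\<dots> = (\<Sum>b\<in>keys y. \<Sum>a\<in>keys x. scal (lookup y b * lookup x a) (\<phi> a b))"
    by (subst sum.swap) (simp add: mult.commute)
  also have "\<dots> = lin (\<lambda>b. lin (\<lambda>a. \<phi> a b) x) y"
    by (simp add: lin_def scal_sum scal_simps)
  finally show ?thesis .
qed

lemma keys_lin_subset:
  assumes "\<And>a. a \<in> keys x \<Longrightarrow> keys (\<phi> a) \<subseteq> S"
  shows "keys (lin \<phi> x) \<subseteq> S"
proof
  fix k assume "k \<in> keys (lin \<phi> x)"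
  hence "(\<Sum>a\<in>keys x. lookup x a * lookup (\<phi> a) k) \<noteq> 0"
    by (simp add: lin_def in_keys_iff lookup_sum)
  then obtain a where "a \<in> keys x" "lookup (\<phi> a) k \<noteq> 0"
    by (metis (no_types, lifting) mult_zero_right sum.neutral)
  hence "k \<in> keys (\<phi> a)" "keys (\<phi> a) \<subseteq> S"
    using assms by (auto simp only: in_keys_iff)
  thus "k \<in> S" by blast
qed

section \<open>Quotients of monoid algebras and their representations\<close>

lemma monoid_algebra_simps:
  "carrier (monoid_algebra M) = {x. keys x \<subseteq> carrier M}"
  "\<one>\<^bsub>monoid_algebra M\<^esub> = single \<one>\<^bsub>M\<^esub> 1"
  "\<zero>\<^bsub>monoid_algebra M\<^esub> = 0"
  "x \<oplus>\<^bsub>monoid_algebra M\<^esub> y = x + y"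
  by (simp_all add: monoid_algebra_def)

text \<open>
  In this form the ring axioms are instances of the rules for \<open>lin\<close>.
\<close>
lemma monoid_algebra_mult:
  "x \<otimes>\<^bsub>monoid_algebra M\<^esub> y = lin (\<lambda>a. lin (\<lambda>b. single (a \<otimes>\<^bsub>M\<^esub> b) 1) y) x"
  by (simp add: monoid_algebra_def lin_def scal_sum scal_simps)

locale monoid_with_algebra = Group.monoid G for G :: "('m, 'z) monoid_scheme" (structure)
begin

abbreviation alg :: "('m \<Rightarrow>\<^sub>0 'k::comm_ring_1) ring" where "alg \<equiv> monoid_algebra G"

lemma single_in_alg: "x \<in> carrier G \<Longrightarrow> single x c \<in> carrier alg"
  by (simp add: monoid_algebra_simps)

lemma alg_mult_single:
  "single x c \<otimes>\<^bsub>alg\<^esub> single y d = single (x \<otimes> y) (c * d)"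
  by (simp add: monoid_algebra_mult scal_simps)

lemma alg_mult_closed:
  assumes "x \<in> carrier alg" "y \<in> carrier alg" shows "x \<otimes>\<^bsub>alg\<^esub> y \<in> carrier alg"
proof -
  have "keys (x \<otimes>\<^bsub>alg\<^esub> y) \<subseteq> carrier G"
    unfolding monoid_algebra_mult
  proof (intro keys_lin_subset)
    fix a b assume "a \<in> keys x" "b \<in> keys y"
    hence "a \<otimes> b \<in> carrier G" using assms by (auto simp: monoid_algebra_simps)
    thus "keys (single (a \<otimes> b) 1) \<subseteq> carrier G" by simp
  qed
  thus ?thesis by (simp add: monoid_algebra_simps)
qed

lemma alg_mult_assoc:
  assumes "x \<in> carrier alg" "y \<in> carrier alg" "z \<in> carrier alg"
  shows "(x \<otimes>\<^bsub>alg\<^esub> y) \<otimes>\<^bsub>alg\<^esub> z = x \<otimes>\<^bsub>alg\<^esub> (y \<otimes>\<^bsub>alg\<^esub> z)"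
proof -
  have "(x \<otimes>\<^bsub>alg\<^esub> y) \<otimes>\<^bsub>alg\<^esub> z = lin (\<lambda>a. lin (\<lambda>b. lin (\<lambda>c. single (a \<otimes> b \<otimes> c) 1) z) y) x"
    by (simp add: monoid_algebra_mult lin_lin scal_simps)
  also have "\<dots> = lin (\<lambda>a. lin (\<lambda>b. lin (\<lambda>c. single (a \<otimes> (b \<otimes> c)) 1) z) y) x"
    using assms by (intro lin_cong) (auto simp: monoid_algebra_simps m_assoc subset_iff)
  also have "\<dots> = x \<otimes>\<^bsub>alg\<^esub> (y \<otimes>\<^bsub>alg\<^esub> z)"
    by (simp add: monoid_algebra_mult lin_lin scal_simps)
  finally show ?thesis .
qed

lemma alg_one_mult:
  assumes "x \<in> carrier alg" shows "\<one>\<^bsub>alg\<^esub> \<otimes>\<^bsub>alg\<^esub> x = x" "x \<otimes>\<^bsub>alg\<^esub> \<one>\<^bsub>alg\<^esub> = x"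
proof -
  have "lin (\<lambda>b. single (\<one> \<otimes> b) 1) x = lin (\<lambda>b. single b 1) x"
    "lin (\<lambda>b. single (b \<otimes> \<one>) 1) x = lin (\<lambda>b. single b 1) x"
    using assms by (auto intro!: lin_cong simp: monoid_algebra_simps subset_iff)
  thus "\<one>\<^bsub>alg\<^esub> \<otimes>\<^bsub>alg\<^esub> x = x" "x \<otimes>\<^bsub>alg\<^esub> \<one>\<^bsub>alg\<^esub> = x"
    by (simp_all add: monoid_algebra_mult monoid_algebra_simps scal_simps lin_single_id)
qed

lemma alg_ring: "ring alg"
proof (rule ringI)
  show "abelian_group alg"
  proof (rule abelian_groupI)
    fix x assume "x \<in> carrier alg"
    thus "\<exists>y\<in>carrier alg. y \<oplus>\<^bsub>alg\<^esub> x = \<zero>\<^bsub>alg\<^esub>"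
      by (intro bexI[of _ "- x"]) (simp_all add: monoid_algebra_simps)
  qed (auto simp: monoid_algebra_simps add.assoc add.commute dest: Poly_Mapping.keys_add[THEN subsetD])
  show "Group.monoid alg"
    by (rule monoidI) (auto simp: alg_mult_closed alg_mult_assoc alg_one_mult, simp add: monoid_algebra_simps)
  show "(x \<oplus>\<^bsub>alg\<^esub> y) \<otimes>\<^bsub>alg\<^esub> z = x \<otimes>\<^bsub>alg\<^esub> z \<oplus>\<^bsub>alg\<^esub> y \<otimes>\<^bsub>alg\<^esub> z" for x y z
    by (simp add: monoid_algebra_simps monoid_algebra_mult lin_add)
  show "z \<otimes>\<^bsub>alg\<^esub> (x \<oplus>\<^bsub>alg\<^esub> y) = z \<otimes>\<^bsub>alg\<^esub> x \<oplus>\<^bsub>alg\<^esub> z \<otimes>\<^bsub>alg\<^esub> y" for x y z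
    by (simp add: monoid_algebra_simps monoid_algebra_mult lin_add lin_fun_add)
qed

lemma alg_uminus: assumes "x \<in> carrier alg" shows "\<ominus>\<^bsub>alg\<^esub> x = - x"
proof -
  interpret A: ring alg by (rule alg_ring)
  have "- x \<oplus>\<^bsub>alg\<^esub> x = \<zero>\<^bsub>alg\<^esub>" "- x \<in> carrier alg" using assms by (simp_all add: monoid_algebra_simps)
  thus ?thesis using assms A.minus_equality by metis
qed

lemma alg_minus: "x \<in> carrier alg \<Longrightarrow> y \<in> carrier alg \<Longrightarrow> x \<ominus>\<^bsub>alg\<^esub> y = x - y"
  by (simp add: a_minus_def alg_uminus) (simp add: monoid_algebra_simps)

end

text \<open>
  Both \<open>U\<^sub>q(sl\<^sub>2)\<close>, from words, and its specialization, from elements of the restricted form, are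
  quotients of this kind. The coset map is \<open>cs\<close>.
\<close>
locale monoid_algebra_quotient = monoid_with_algebra G for G :: "('m, 'z) monoid_scheme" (structure) +
  fixes S :: "('m \<Rightarrow>\<^sub>0 'k::comm_ring_1) set"
  assumes S_carrier: "S \<subseteq> carrier (monoid_algebra G)"
begin

sublocale A: ring "monoid_algebra G :: ('m \<Rightarrow>\<^sub>0 'k) ring" by (rule alg_ring)

abbreviation I where "I \<equiv> Idl\<^bsub>alg\<^esub> S"
abbreviation Q where "Q \<equiv> monoid_algebra G Quot I"
abbreviation cs where "cs \<equiv> coset_of (monoid_algebra G) S"

lemma ideal_I: "ideal I (monoid_algebra G)"
  by (rule A.genideal_ideal[OF S_carrier])

sublocale Q: ring Q by (rule ideal.quotient_is_ring[OF ideal_I])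

lemma cs_hom: "cs \<in> ring_hom (monoid_algebra G) Q"
  using ideal.rcos_ring_hom[OF ideal_I] by (simp add: coset_of_def[abs_def])

lemmas cs_simps = ring_hom_closed[OF cs_hom] ring_hom_add[OF cs_hom] ring_hom_mult[OF cs_hom]
  ring_hom_one[OF cs_hom]

lemma Q_carrierE: assumes "X \<in> carrier Q" obtains x where "x \<in> carrier alg" "X = cs x"
  using assms by (auto simp: FactRing_def A_RCOSETS_def' coset_of_def)

lemma cs_eq_iff:
  assumes "x \<in> carrier alg" "y \<in> carrier alg"
  shows "cs x = cs y \<longleftrightarrow> x - y \<in> I"
proof -
  have "cs x = cs y \<longleftrightarrow> x \<ominus>\<^bsub>alg\<^esub> y \<in> I"
    unfolding coset_of_def
    using assms A.quotient_eq_iff_same_a_r_cos ideal_I by metis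
  thus ?thesis using assms by (simp add: alg_minus)
qed

lemma cs_relator: assumes "x - y \<in> S" "x \<in> carrier alg" "y \<in> carrier alg"
  shows "cs x = cs y"
  using assms A.genideal_self[OF S_carrier] by (auto simp: cs_eq_iff)

lemma Q_induct [consumes 1, case_names single zero add]:
  assumes "X \<in> carrier Q"
    and single: "\<And>x c. x \<in> carrier G \<Longrightarrow> P (cs (single x c))"
    and zero: "P \<zero>\<^bsub>Q\<^esub>"
    and add: "\<And>X Y. X \<in> carrier Q \<Longrightarrow> Y \<in> carrier Q \<Longrightarrow> P X \<Longrightarrow> P Y \<Longrightarrow> P (X \<oplus>\<^bsub>Q\<^esub> Y)"
  shows "P X"
proof -
  obtain x where x: "x \<in> carrier alg" "X = cs x" using assms(1) by (rule Q_carrierE)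
  have "finite A \<Longrightarrow> A \<subseteq> carrier G \<Longrightarrow>
      (\<Sum>a\<in>A. single a (lookup x a)) \<in> carrier alg \<and>
      P (cs (\<Sum>a\<in>A. single a (lookup x a)))" for A
  proof (induction A rule: finite_induct)
    case empty
    have "cs 0 = \<zero>\<^bsub>Q\<^esub>"
      using ring_hom_zero[OF cs_hom A.ring_axioms Q.ring_axioms] by (simp add: monoid_algebra_simps)
    thus ?case using zero A.zero_closed by (simp add: monoid_algebra_simps)
  next
    case (insert a A)
    let ?s = "single a (lookup x a)"
    let ?t = "\<Sum>a\<in>A. single a (lookup x a)"
    have a: "a \<in> carrier G" using insert by auto
    have t: "?t \<in> carrier alg" "P (cs ?t)" using insert by auto
    have s: "?s \<in> carrier alg" by (rule single_in_alg[OF a])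
    have "cs (?s + ?t) = cs ?s \<oplus>\<^bsub>Q\<^esub> cs ?t" using cs_simps(2)[OF s t(1)] by (simp add: monoid_algebra_simps)
    moreover have "?s + ?t \<in> carrier alg"
      using A.a_closed[OF s t(1)] by (simp add: monoid_algebra_simps)
    moreover have "P (cs ?s \<oplus>\<^bsub>Q\<^esub> cs ?t)"
      by (rule add) (use s t single[OF a] cs_simps(1) in auto)
    ultimately show ?case using insert by simp
  qed
  from this[of "keys x"] x
  have "P (cs (\<Sum>a\<in>keys x. single a (lookup x a)))"
    by (simp add: monoid_algebra_simps)
  also have "(\<Sum>a\<in>keys x. single a (lookup x a)) = x"
    using lin_single_id[of x] by (simp add: lin_def scal_simps)
  finally show ?thesis using x by simp
qed

end

text \<open>
  A representation of the monoid by column-finite matrices extends to the monoid algebra, and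
  descends to the quotient as soon as the relators act by zero.
\<close>
locale monoid_algebra_quotient_rep = monoid_algebra_quotient G S
  for G :: "('m, 'z) monoid_scheme" (structure) and S :: "('m \<Rightarrow>\<^sub>0 'k::comm_ring_1) set" +
  fixes \<rho> :: "'m \<Rightarrow> 'i \<Rightarrow> ('i \<Rightarrow>\<^sub>0 'k)"
  assumes rho_one: "\<rho> \<one> i = single i 1"
    and rho_mult: "x \<in> carrier G \<Longrightarrow> y \<in> carrier G \<Longrightarrow> \<rho> (x \<otimes> y) i = lin (\<rho> x) (\<rho> y i)"
    and rho_S: "z \<in> S \<Longrightarrow> lin (\<lambda>a. \<rho> a i) z = 0"
begin

definition alg_rep where "alg_rep x i = lin (\<lambda>a. \<rho> a i) x"

lemma alg_rep_mult:
  assumes "x \<in> carrier alg" "y \<in> carrier alg"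
  shows "alg_rep (x \<otimes>\<^bsub>alg\<^esub> y) i = lin (alg_rep x) (alg_rep y i)"
proof -
  have "alg_rep (x \<otimes>\<^bsub>alg\<^esub> y) i = lin (\<lambda>a. lin (\<lambda>b. \<rho> (a \<otimes> b) i) y) x"
    by (simp add: alg_rep_def monoid_algebra_mult lin_lin scal_simps)
  also have "\<dots> = lin (\<lambda>a. lin (\<lambda>b. lin (\<rho> a) (\<rho> b i)) y) x"
    using assms by (intro lin_cong rho_mult) (auto simp: monoid_algebra_simps)
  also have "\<dots> = lin (\<lambda>a. lin (\<rho> a) (alg_rep y i)) x"
    by (simp add: alg_rep_def lin_lin)
  also have "\<dots> = lin (alg_rep x) (alg_rep y i)"
    unfolding alg_rep_def[abs_def] by (rule lin_swap)
  finally show ?thesis .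
qed

lemma alg_rep_add: "alg_rep (x + y) i = alg_rep x i + alg_rep y i"
  by (simp add: alg_rep_def lin_add)

text \<open>
  The elements that act by zero form an ideal, which contains the relators.
\<close>
lemma alg_rep_I: assumes "x \<in> I" shows "alg_rep x i = 0"
proof -
  let ?J = "{x \<in> carrier alg. \<forall>i. alg_rep x i = 0}"
  have fun0: "alg_rep x = (\<lambda>_. 0)" if "x \<in> ?J" for x using that by (simp add: fun_eq_iff)
  have "ideal ?J (monoid_algebra G)"
  proof (rule idealI[OF A.ring_axioms])
    show "subgroup ?J (add_monoid (monoid_algebra G))"
    proof (rule A.add.subgroupI)
      show "?J \<subseteq> carrier alg" by auto
      have "\<zero>\<^bsub>alg\<^esub> \<in> ?J" using A.zero_closed by (simp add: monoid_algebra_simps alg_rep_def)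
      thus "?J \<noteq> {}" by blast
      show "\<ominus>\<^bsub>alg\<^esub> x \<in> ?J" if "x \<in> ?J" for x
        using that A.a_inv_closed[of x] by (simp add: alg_uminus) (simp add: alg_rep_def lin_uminus)
      show "x \<oplus>\<^bsub>alg\<^esub> y \<in> ?J" if "x \<in> ?J" "y \<in> ?J" for x y
        using that A.a_closed[of x y] by (auto simp: monoid_algebra_simps alg_rep_add)
    qed
    show "x \<otimes>\<^bsub>alg\<^esub> a \<in> ?J" if "a \<in> ?J" "x \<in> carrier alg" for a x
      using that A.m_closed[of x a] fun0[OF that(1)] by (simp add: alg_rep_mult)
    show "a \<otimes>\<^bsub>alg\<^esub> x \<in> ?J" if "a \<in> ?J" "x \<in> carrier alg" for a x
      using that A.m_closed[of a x] fun0[OF that(1)] by (simp add: alg_rep_mult)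
  qed
  moreover have "S \<subseteq> ?J" using S_carrier rho_S by (auto simp: alg_rep_def)
  ultimately have "I \<subseteq> ?J" by (rule A.genideal_minimal)
  thus ?thesis using assms by auto
qed

text \<open>
  Any representative of the coset will do, by \<open>alg_rep_I\<close>.
\<close>
definition rep where "rep X = alg_rep (SOME x. x \<in> carrier alg \<and> X = cs x)"

lemma rep_cs: assumes "x \<in> carrier alg" shows "rep (cs x) = alg_rep x"
proof -
  have "\<exists>y. y \<in> carrier alg \<and> cs x = cs y" using assms by blast
  from someI_ex[OF this] obtain y where y: "y \<in> carrier alg" "cs x = cs y"
    and rep_y: "rep (cs x) = alg_rep y"
    unfolding rep_def by blast
  have "x - y \<in> I" using cs_eq_iff[OF assms y(1)] y(2) by simp
  hence "alg_rep (x - y) i = 0" for i by (rule alg_rep_I)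
  hence "alg_rep x i = alg_rep y i" for i by (simp add: alg_rep_def lin_diff)
  thus ?thesis unfolding rep_y by (simp add: fun_eq_iff)
qed

lemma rep_single: "x \<in> carrier G \<Longrightarrow> rep (cs (single x c)) i = scal c (\<rho> x i)"
  by (simp add: rep_cs single_in_alg alg_rep_def)

lemma rep_one: "rep \<one>\<^bsub>Q\<^esub> i = single i 1"
  using cs_simps(4)[symmetric] by (simp add: monoid_algebra_simps rep_single rho_one scal_simps)

lemma rep_mult:
  assumes "X \<in> carrier Q" "Y \<in> carrier Q"
  shows "rep (X \<otimes>\<^bsub>Q\<^esub> Y) i = lin (rep X) (rep Y i)"
  using assms
  by (elim Q_carrierE) (simp add: cs_simps(3)[symmetric] rep_cs A.m_closed alg_rep_mult)

lemma rep_add: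
  assumes "X \<in> carrier Q" "Y \<in> carrier Q"
  shows "rep (X \<oplus>\<^bsub>Q\<^esub> Y) i = rep X i + rep Y i"
proof -
  obtain x y where xy: "x \<in> carrier alg" "X = cs x" "y \<in> carrier alg" "Y = cs y"
    using assms by (metis Q_carrierE)
  have "X \<oplus>\<^bsub>Q\<^esub> Y = cs (x \<oplus>\<^bsub>alg\<^esub> y)" using xy cs_simps(2) by metis
  thus ?thesis using xy A.a_closed[OF xy(1,3)]
    by (simp add: rep_cs) (simp add: monoid_algebra_simps alg_rep_add)
qed

end

section \<open>The algebra \<open>U\<^sub>q(sl\<^sub>2)\<close> as a type\<close>

lemma monoid_words: "Group.monoid words"
  by (rule monoidI) (auto simp: words_def)

lemma words_simps: "carrier words = UNIV" "u \<otimes>\<^bsub>words\<^esub> v = u @ v" "\<one>\<^bsub>words\<^esub> = []"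
  by (simp_all add: words_def)

interpretation Uq_quot: monoid_algebra_quotient words uq_relators
  by (rule monoid_algebra_quotient.intro[OF monoid_with_algebra.intro[OF monoid_words]], unfold_locales)
    (auto simp: monoid_algebra_simps words_def)

lemma Uq_eq: "Uq = Uq_quot.Q"
  by (simp add: Uq_def)

interpretation Uq: ring Uq
  unfolding Uq_eq by (rule Uq_quot.Q.ring_axioms)

lemma free_alg_carrier [simp]: "x \<in> carrier free_alg"
  by (simp add: monoid_algebra_simps words_def)

lemma Uq_cs_closed: "Uq_quot.cs x \<in> carrier Uq"
  unfolding Uq_eq by (rule Uq_quot.cs_simps) simp

lemma Uq_cs_mult: "Uq_quot.cs x \<otimes>\<^bsub>Uq\<^esub> Uq_quot.cs y = Uq_quot.cs (x \<otimes>\<^bsub>free_alg\<^esub> y)"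
  unfolding Uq_eq by (rule Uq_quot.cs_simps(3)[symmetric]) simp_all

lemma Uq_cs_add: "Uq_quot.cs x \<oplus>\<^bsub>Uq\<^esub> Uq_quot.cs y = Uq_quot.cs (x + y)"
  unfolding Uq_eq using Uq_quot.cs_simps(2)[of x y] by (simp add: monoid_algebra_simps words_simps)

lemma Uq_cs_one: "Uq_quot.cs (single [] 1) = \<one>\<^bsub>Uq\<^esub>"
  unfolding Uq_eq using Uq_quot.cs_simps(4) by (simp add: monoid_algebra_simps words_simps)

lemma Uq_cs_single_mult:
  "Uq_quot.cs (single u a) \<otimes>\<^bsub>Uq\<^esub> Uq_quot.cs (single v b) =
   Uq_quot.cs (single (u @ v) (a * b))"
  unfolding Uq_cs_mult by (simp add: Uq_quot.alg_mult_single words_simps)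

text \<open>
  On a type, ring identities can be handled without membership conditions. The classes stop short
  of \<open>ring_1\<close>, since \<open>0 \<noteq> 1\<close> is not clear before a representation has been constructed.
\<close>
typedef uqt = "carrier Uq" morphisms uq_of uq_abs
  using Uq.one_closed by blast

lemma uq_of_closed [simp]: "uq_of x \<in> carrier Uq"
  by (rule uq_of)

instantiation uqt :: "{ring, monoid_mult}"
begin
definition "0 = uq_abs \<zero>\<^bsub>Uq\<^esub>"
definition "1 = uq_abs \<one>\<^bsub>Uq\<^esub>"
definition "x + y = uq_abs (uq_of x \<oplus>\<^bsub>Uq\<^esub> uq_of y)"
definition "x * y = uq_abs (uq_of x \<otimes>\<^bsub>Uq\<^esub> uq_of y)"
definition "x - y = uq_abs (uq_of x \<ominus>\<^bsub>Uq\<^esub> uq_of y)"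
definition "- x = uq_abs (\<ominus>\<^bsub>Uq\<^esub> uq_of x)"

lemma uq_of_simps:
  "uq_of 0 = \<zero>\<^bsub>Uq\<^esub>" "uq_of 1 = \<one>\<^bsub>Uq\<^esub>"
  "uq_of (x + y) = uq_of x \<oplus>\<^bsub>Uq\<^esub> uq_of y"
  "uq_of (x * y) = uq_of x \<otimes>\<^bsub>Uq\<^esub> uq_of y"
  "uq_of (x - y) = uq_of x \<ominus>\<^bsub>Uq\<^esub> uq_of y"
  "uq_of (- x) = \<ominus>\<^bsub>Uq\<^esub> uq_of x"
  by (simp_all add: zero_uqt_def one_uqt_def plus_uqt_def times_uqt_def minus_uqt_def uminus_uqt_def uq_abs_inverse)

instance
proof
  fix a b c :: uqt
  note eq = uq_of_inject[symmetric]
  show "a + b + c = a + (b + c)" by (simp add: eq uq_of_simps Uq.a_assoc)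
  show "a + b = b + a" by (simp add: eq uq_of_simps Uq.a_comm)
  show "0 + a = a" by (simp add: eq uq_of_simps)
  show "- a + a = 0" by (simp add: eq uq_of_simps Uq.l_neg)
  show "a - b = a + - b" by (simp add: eq uq_of_simps a_minus_def)
  show "a * b * c = a * (b * c)" by (simp add: eq uq_of_simps Uq.m_assoc)
  show "1 * a = a" by (simp add: eq uq_of_simps)
  show "a * 1 = a" by (simp add: eq uq_of_simps)
  show "(a + b) * c = a * c + b * c" by (simp add: eq uq_of_simps Uq.l_distr)
  show "a * (b + c) = a * b + a * c" by (simp add: eq uq_of_simps Uq.r_distr)
qed
end

lemma uq_of_power: "uq_of (x ^ n) = uq_of x [^]\<^bsub>Uq\<^esub> n"
proof (induction n)
  case 0 show ?case by (simp add: uq_of_simps)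
next
  case (Suc n)
  have "x ^ Suc n = x ^ n * x" by (simp add: power_commutes)
  thus ?case by (simp add: uq_of_simps Suc)
qed

definition sc :: "ratfun \<Rightarrow> uqt"
  where "sc a = uq_abs (Uq_quot.cs (single [] a))"

definition gen :: "gen \<Rightarrow> uqt"
  where "gen x = uq_abs (uq_gen x)"

lemma uq_of_sc: "uq_of (sc a) = Uq_quot.cs (single [] a)"
  by (simp add: sc_def uq_abs_inverse Uq_cs_closed)

lemma uq_of_gen: "uq_of (gen x) = uq_gen x"
  by (simp add: gen_def uq_abs_inverse Uq_cs_closed uq_gen_def)

lemma uq_of_sc_mult: "uq_of (sc a * x) = uq_scale a (uq_of x)"
  by (simp add: uq_of_simps uq_of_sc uq_scale_def)

lemma sc_add: "sc (a + b) = sc a + sc b"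
  by (simp add: uq_of_inject[symmetric] uq_of_simps uq_of_sc Uq_cs_add single_add)

lemma sc_mult: "sc (a * b) = sc a * sc b"
  by (simp add: uq_of_inject[symmetric] uq_of_simps uq_of_sc Uq_cs_single_mult)

lemma sc_1 [simp]: "sc 1 = 1"
  by (simp add: uq_of_inject[symmetric] uq_of_simps uq_of_sc Uq_cs_one)

lemma sc_0 [simp]: "sc 0 = 0"
  using sc_add[of 0 0] by simp

lemma sc_uminus: "sc (- a) = - sc a"
  using sc_add[of a "- a"] by (simp add: eq_neg_iff_add_eq_0 add.commute)

lemma sc_diff: "sc (a - b) = sc a - sc b"
  using sc_add[of a "- b"] by (simp add: sc_uminus)

lemma sc_central: "x * sc a = sc a * x"
proof -
  have "X \<otimes>\<^bsub>Uq\<^esub> uq_of (sc a) = uq_of (sc a) \<otimes>\<^bsub>Uq\<^esub> X" if "X \<in> carrier Uq" for X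
    using that[unfolded Uq_eq]
  proof (induction rule: Uq_quot.Q_induct)
    case (single w c)
    show ?case by (simp add: uq_of_sc Uq_cs_single_mult mult.commute)
  next
    case zero
    show ?case using uq_of_closed[of "sc a"] by (simp add: Uq_eq[symmetric])
  next
    case (add X Y)
    thus ?case using uq_of_closed[of "sc a"] by (simp add: Uq_eq[symmetric] Uq.l_distr Uq.r_distr)
  qed
  thus ?thesis by (simp add: uq_of_inject[symmetric] uq_of_simps)
qed

lemma sc_left_commute: "NO_MATCH (sc b) x \<Longrightarrow> x * (sc a * y) = sc a * (x * y)"
  by (metis sc_central mult.assoc)

lemma sc_sc_mult: "sc a * (sc b * x) = sc (a * b) * x"
  by (simp add: sc_mult mult.assoc)

lemma sc_central': "NO_MATCH (sc b) x \<Longrightarrow> x * sc a = sc a * x"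
  by (rule sc_central)

text \<open>
  Moves scalars to the front of a product and collects them there; the guards keep a scalar from
  being moved past another one forever.
\<close>
lemmas sc_normal = sc_central' sc_left_commute sc_sc_mult sc_mult[symmetric] mult.assoc

lemma sc_cancel: assumes "a \<noteq> 0" shows "sc a * x = sc a * y \<longleftrightarrow> x = y"
proof
  assume "sc a * x = sc a * y"
  hence "sc (inverse a) * (sc a * x) = sc (inverse a) * (sc a * y)" by simp
  thus "x = y" using assms by (simp add: sc_sc_mult)
qed simp

abbreviation gE where "gE \<equiv> gen E"
abbreviation gF where "gF \<equiv> gen F"
abbreviation gK where "gK \<equiv> gen K"
abbreviation gK' where "gK' \<equiv> gen Kinv"

lemma uq_of_gen_word:
  "uq_of (gen x) = Uq_quot.cs (single [x] 1)"
  by (simp add: uq_of_gen uq_gen_def)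

lemma Uq_rel:
  assumes "x - y \<in> uq_relators" shows "Uq_quot.cs x = Uq_quot.cs y"
  by (rule Uq_quot.cs_relator[OF assms]) simp_all

lemma Uq_rels:
  "Uq_quot.cs (single [K, Kinv] 1) = Uq_quot.cs (single [] 1)"
  "Uq_quot.cs (single [Kinv, K] 1) = Uq_quot.cs (single [] 1)"
  "Uq_quot.cs (single [K, E, Kinv] 1) = Uq_quot.cs (single [E] (q ^ 2))"
  "Uq_quot.cs (single [K, F, Kinv] 1) = Uq_quot.cs (single [F] (inverse q ^ 2))"
  by (rule Uq_rel, simp add: uq_relators_def)+

lemma gK_gK': "gK * gK' = 1" "gK' * gK = 1"
  by (simp_all add: uq_of_inject[symmetric] uq_of_simps uq_of_gen_word Uq_cs_single_mult
      Uq_cs_one[symmetric] Uq_rels)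

lemma gK_gE: "gK * gE = sc (q ^ 2) * gE * gK"
proof -
  have "gK * gE * gK' = sc (q ^ 2) * gE"
    by (simp add: uq_of_inject[symmetric] uq_of_simps uq_of_gen_word uq_of_sc Uq_cs_single_mult
      Uq_rels)
  hence "gK * gE * (gK' * gK) = sc (q ^ 2) * gE * gK" by (simp only: mult.assoc[symmetric])
  thus ?thesis by (simp add: gK_gK')
qed

lemma gK_gF: "gK * gF = sc (inverse q ^ 2) * gF * gK"
proof -
  have "gK * gF * gK' = sc (inverse q ^ 2) * gF"
    by (simp add: uq_of_inject[symmetric] uq_of_simps uq_of_gen_word uq_of_sc Uq_cs_single_mult
      Uq_rels)
  hence "gK * gF * (gK' * gK) = sc (inverse q ^ 2) * gF * gK" by (simp only: mult.assoc[symmetric])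
  thus ?thesis by (simp add: gK_gK')
qed

text \<open>
  Conjugation by \<open>K\<inverse>\<close> is inverse to conjugation by \<open>K\<close>, so a commutation rule for \<open>K\<close> yields one
  for \<open>K\<inverse>\<close>.
\<close>
lemma gK'_commute: assumes "gK * x = sc (a :: ratfun) * x * gK" "a \<noteq> 0" shows "gK' * x = sc (inverse a) * x * gK'"
proof -
  have "gK' * (gK * x) * gK' = gK' * (sc a * x * gK) * gK'" using assms(1) by simp
  hence "(gK' * gK) * x * gK' = sc a * (gK' * x * (gK * gK'))" by (simp add: sc_normal)
  hence "x * gK' = sc a * (gK' * x)" by (simp add: gK_gK')
  hence "sc (inverse a) * (x * gK') = sc (inverse a * a) * (gK' * x)" by (simp only: sc_sc_mult)
  thus ?thesis using assms(2) by (simp add: mult.assoc)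
qed

lemmas gK'_gE = gK'_commute[OF gK_gE]
lemmas gK'_gF = gK'_commute[OF gK_gF]

lemma gE_gF: "gE * gF = gF * gE + (sc (1 / qdiff) * gK - sc (1 / qdiff) * gK')"
proof -
  let ?s = single
  have "Uq_quot.cs (?s [E, F] 1 - ?s [F, E] 1) = Uq_quot.cs (?s [K] (1 / qdiff) - ?s [Kinv] (1 / qdiff))"
    by (rule Uq_rel) (simp add: uq_relators_def qdiff_def)
  hence "Uq_quot.cs (?s [E, F] 1 - ?s [F, E] 1) \<oplus>\<^bsub>Uq\<^esub> Uq_quot.cs (?s [F, E] 1 + ?s [Kinv] (1 / qdiff))
     = Uq_quot.cs (?s [K] (1 / qdiff) - ?s [Kinv] (1 / qdiff)) \<oplus>\<^bsub>Uq\<^esub> Uq_quot.cs (?s [F, E] 1 + ?s [Kinv] (1 / qdiff))"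
    by simp
  hence "Uq_quot.cs (?s [E, F] 1) \<oplus>\<^bsub>Uq\<^esub> Uq_quot.cs (?s [Kinv] (1 / qdiff)) =
      Uq_quot.cs (?s [F, E] 1) \<oplus>\<^bsub>Uq\<^esub> Uq_quot.cs (?s [K] (1 / qdiff))"
    by (simp add: Uq_cs_add algebra_simps)
  hence "gE * gF + sc (1 / qdiff) * gK' = gF * gE + sc (1 / qdiff) * gK"
    by (simp add: uq_of_inject[symmetric] uq_of_simps uq_of_gen_word uq_of_sc Uq_cs_single_mult)
  thus ?thesis by (simp add: algebra_simps)
qed

section \<open>Kac's formula\<close>

text \<open>
  In the usual notation \<open>Kb c\<close> and \<open>KB c t\<close> are \<open>[K; c]\<close> and \<open>[K; c; t]\<close>. The shift \<open>c\<close> is needed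
  because it changes by \<open>2\<close> when the element moves past \<open>e\<close> or \<open>f\<close>.
\<close>
definition Kb :: "int \<Rightarrow> uqt"
  where "Kb c = sc (q powi c / qdiff) * gK - sc (q powi (- c) / qdiff) * gK'"

primrec KB :: "int \<Rightarrow> nat \<Rightarrow> uqt"
  where
    "KB c 0 = 1"
  | "KB c (Suc t) = KB c t * (sc (1 / qint (int (Suc t))) * Kb (c - int t))"

text \<open>
  With divided powers of negative degree equal to \<open>0\<close>, the summation range in Kac's formula does not
  depend on the smaller exponent.
\<close>
definition dp :: "gen \<Rightarrow> int \<Rightarrow> uqt"
  where "dp x n = (if n < 0 then 0 else sc (inverse (qfact (nat n))) * gen x ^ nat n)"

lemma sc_Kb_add: "sc a * Kb c + sc b * Kb d =
    sc ((a * q powi c + b * q powi d) / qdiff) * gK - sc ((a * q powi (- c) + b * q powi (- d)) / qdiff) * gK'"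
  by (simp add: Kb_def algebra_simps sc_sc_mult add_divide_distrib sc_add)

lemma sc_Kb: "sc a * Kb c = sc (a * q powi c / qdiff) * gK - sc (a * q powi (- c) / qdiff) * gK'"
  by (simp add: Kb_def algebra_simps sc_sc_mult)

lemma qint_powi_three_term:
  "qint (b - c) * q powi x + qint c * q powi (x + b) = qint b * q powi (x + c)"
proof -
  define X B C where "X = q powi x" and "B = q powi b" and "C = q powi c"
  have nz: "X \<noteq> 0" "B \<noteq> 0" "C \<noteq> 0" by (auto simp: X_def B_def C_def q_neq_0)
  show ?thesis
    unfolding qint_eq power_int_minus using nz qdiff_neq_0
    by (simp add: power_int_add power_int_diff q_neq_0 X_def[symmetric] B_def[symmetric] C_def[symmetric])
       (simp add: field_simps)
qed

text \<open>
  Both sides are linear combinations of \<open>K\<close> and \<open>K\<inverse>\<close>, so this is \<open>qint_powi_three_term\<close>,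
  once as it stands and once with all signs of exponents reversed.
\<close>
lemma Kb_three_term: "sc (qint (b - c)) * Kb x + sc (qint c) * Kb (x + b) = sc (qint b) * Kb (x + c)"
proof -
  have h: "qint (b - c) * q powi (- x) + qint c * q powi (- (x + b)) = qint b * q powi (- (x + c))"
    using qint_powi_three_term[of "- b" "- c" "- x"] by (simp add: qint_eq algebra_simps diff_divide_distrib)
  show ?thesis unfolding sc_Kb_add unfolding sc_Kb qint_powi_three_term h ..
qed

lemma Kb_commute: "Kb c * Kb d = Kb d * Kb c"
  by (simp add: Kb_def algebra_simps sc_normal gK_gK')

lemma KB_Kb_commute: "KB c t * Kb d = Kb d * KB c t"
proof (induction t)
  case 0 show ?case by simp
next
  case (Suc t)
  have "KB c (Suc t) * Kb d = sc (1 / qint (int (Suc t))) * (KB c t * (Kb (c - int t) * Kb d))"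
    by (simp add: sc_normal)
  also have "\<dots> = sc (1 / qint (int (Suc t))) * (Kb d * KB c t * Kb (c - int t))"
    by (simp add: Kb_commute[of "c - int t"] Suc.IH mult.assoc[symmetric])
  also have "\<dots> = Kb d * KB c (Suc t)" by (simp add: sc_normal)
  finally show ?case .
qed

lemma KB_front: "KB (c + 1) (Suc t) = sc (1 / qint (int (Suc t))) * (Kb (c + 1) * KB c t)"
proof (induction t)
  case 0 show ?case by simp
next
  case (Suc t)
  have "KB (c + 1) (Suc (Suc t)) = KB (c + 1) (Suc t) * (sc (1 / qint (int (Suc (Suc t)))) * Kb (c + 1 - int (Suc t)))"
    by (rule KB.simps)
  also have "\<dots> = sc (1 / qint (int (Suc t))) * (Kb (c + 1) * KB c t) * (sc (1 / qint (int (Suc (Suc t)))) * Kb (c - int t))"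
    unfolding Suc.IH by simp
  also have "\<dots> = sc (1 / qint (int (Suc (Suc t)))) * (Kb (c + 1) * KB c (Suc t))"
    by (simp add: sc_normal mult.commute)
  finally show ?case .
qed

lemma Kb_gE: "Kb c * gE = gE * Kb (c + 2)"
  by (simp add: Kb_def algebra_simps sc_normal gK_gE gK'_gE q_neq_0 power_int_add power_int_diff power_int_minus
      power2_eq_square field_simps)

lemma Kb_gF: "Kb c * gF = gF * Kb (c - 2)"
  by (simp add: Kb_def algebra_simps sc_normal gK_gF gK'_gF q_neq_0 power_int_add power_int_diff power_int_minus
      power2_eq_square field_simps)

lemma KB_gE: "KB c t * gE = gE * KB (c + 2) t"
proof (induction t)
  case 0 show ?case by simp
next
  case (Suc t)
  have IH: "KB c t * (gE * y) = gE * (KB (c + 2) t * y)" for y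
    by (simp only: mult.assoc[symmetric] Suc.IH)
  have i: "c - int t + 2 = c + 2 - int t" by simp
  have "KB c (Suc t) * gE = sc (1 / qint (int (Suc t))) * (KB c t * (Kb (c - int t) * gE))"
    by (simp add: sc_normal)
  also have "\<dots> = sc (1 / qint (int (Suc t))) * (gE * (KB (c + 2) t * Kb (c + 2 - int t)))"
    by (simp only: Kb_gE IH i)
  also have "\<dots> = gE * KB (c + 2) (Suc t)" by (simp add: sc_normal)
  finally show ?case .
qed

lemma KB_gF: "KB c t * gF = gF * KB (c - 2) t"
proof (induction t)
  case 0 show ?case by simp
next
  case (Suc t)
  have IH: "KB c t * (gF * y) = gF * (KB (c - 2) t * y)" for y
    by (simp only: mult.assoc[symmetric] Suc.IH)
  have i: "c - int t - 2 = c - 2 - int t" by simp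
  have "KB c (Suc t) * gF = sc (1 / qint (int (Suc t))) * (KB c t * (Kb (c - int t) * gF))"
    by (simp add: sc_normal)
  also have "\<dots> = sc (1 / qint (int (Suc t))) * (gF * (KB (c - 2) t * Kb (c - 2 - int t)))"
    by (simp only: Kb_gF IH i)
  also have "\<dots> = gF * KB (c - 2) (Suc t)" by (simp add: sc_normal)
  finally show ?case .
qed

lemma dp_neg [simp]: "n < 0 \<Longrightarrow> dp x n = 0"
  by (simp add: dp_def)

lemma dp_0 [simp]: "dp x 0 = 1"
  by (simp add: dp_def)

lemma dp_Suc: "sc (qint (n + 1)) * dp x (n + 1) = gen x * dp x n"
proof (cases "n \<ge> 0")
  case True
  then obtain m where n: "n = int m" by (metis nat_0_le)
  have "qint (int (Suc m)) \<noteq> 0" by (rule qint_neq_0) simp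
  hence c: "qint (int (Suc m)) * inverse (qfact (Suc m)) = inverse (qfact m)"
    by (simp add: qfact_Suc del: of_nat_Suc)
  have i: "int m + 1 = int (Suc m)" by simp
  show ?thesis unfolding n i by (simp add: dp_def sc_normal c del: of_nat_Suc)
next
  case False
  hence "n + 1 = 0 \<or> n + 1 < 0" by auto
  thus ?thesis using False by auto
qed

lemma dp_1: "dp x 1 = gen x"
  using dp_Suc[of 0 x] by simp

lemma dp_nat: "dp x (int r) = sc (inverse (qfact r)) * gen x ^ r"
  by (simp add: dp_def)

lemma KB_dpF: "KB c t * dp F (int r) = dp F (int r) * KB (c - 2 * int r) t"
proof -
  have "KB c t * gF ^ r = gF ^ r * KB (c - 2 * int r) t"
  proof (induction r)
    case 0 show ?case by simp
  next
    case (Suc r)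
    have "KB c t * gF ^ Suc r = KB c t * gF ^ r * gF" by (simp add: power_commutes mult.assoc)
    also have "\<dots> = gF ^ r * (KB (c - 2 * int r) t * gF)" by (simp add: Suc.IH mult.assoc)
    also have "\<dots> = gF ^ r * gF * KB (c - 2 * int r - 2) t" by (simp add: KB_gF mult.assoc)
    finally show ?case by (simp add: power_commutes algebra_simps)
  qed
  thus ?thesis by (simp add: dp_nat sc_normal)
qed

lemma gE_gF_power: "gE * gF ^ Suc n = gF ^ Suc n * gE + sc (qint (int (Suc n))) * (gF ^ n * Kb (- int n))"
proof (induction n)
  case 0
  show ?case using gE_gF by (simp add: Kb_def)
next
  case (Suc n)
  have c: "gF ^ Suc m = gF ^ m * gF" for m by (simp add: power_commutes)
  have K: "Kb 0 + sc (qint (int (Suc n))) * Kb (- int n - 2) = sc (qint (int (Suc (Suc n)))) * Kb (- int (Suc n))"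
    using Kb_three_term[of "int n + 2" 1 "- int n - 2"] by (simp add: algebra_simps)
  have "gE * gF ^ Suc (Suc n) = gE * gF ^ Suc n * gF" by (simp only: c[of "Suc n"] mult.assoc)
  also have "\<dots> = gF ^ Suc n * (gE * gF) + sc (qint (int (Suc n))) * (gF ^ n * (Kb (- int n) * gF))"
    by (simp only: Suc.IH distrib_right mult.assoc)
  also have "gE * gF = gF * gE + Kb 0" using gE_gF by (simp add: Kb_def)
  also have "Kb (- int n) * gF = gF * Kb (- int n - 2)" by (rule Kb_gF)
  also have "gF ^ Suc n * (gF * gE + Kb 0) + sc (qint (int (Suc n))) * (gF ^ n * (gF * Kb (- int n - 2)))
    = gF ^ Suc (Suc n) * gE + gF ^ Suc n * (Kb 0 + sc (qint (int (Suc n))) * Kb (- int n - 2))"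
    by (simp only: c[of "Suc n"] c[of n] distrib_left mult.assoc add.assoc sc_central[of _ "qint (int (Suc n))", symmetric]) 
  finally show ?case unfolding K by (simp add: sc_normal del: power_Suc)
qed

lemma gE_dpF: "gE * dp F n = dp F n * gE + dp F (n - 1) * Kb (1 - n)"
proof (cases "n \<ge> 1")
  case True
  then obtain m where n: "n = int (Suc m)" by (intro that[of "nat (n - 1)"]) simp
  have nz: "qint (int (Suc m)) \<noteq> 0" by (rule qint_neq_0) simp
  have e: "int (Suc m) - 1 = int m" "1 - int (Suc m) = - int m" by simp_all
  have "inverse (qfact (Suc m)) * qint (int (Suc m)) = inverse (qfact m)"
    using nz by (simp add: qfact_Suc del: of_nat_Suc)
  thus ?thesis unfolding n e dp_nat
    by (simp add: sc_normal gE_gF_power distrib_left del: power_Suc of_nat_Suc)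
next
  case False
  thus ?thesis by (cases "n = 0") simp_all
qed

text \<open>
  Induction on \<open>r\<close>: multiplying by \<open>e\<close> from the left and moving it past \<open>f\<^bsup>(s - t)\<^esup>\<close> and the Cartan
  factor turns each term into two, whose right ends are \<open>e\<^bsup>(r + 1 - t)\<^esup>\<close> and \<open>e\<^bsup>(r - t)\<^esup>\<close>. After a
  shift of the second sum, terms with equal ends add up by \<open>Kb_three_term\<close>.
\<close>
theorem Kac:
  "dp E (int r) * dp F s =
    (\<Sum>t\<le>r. dp F (s - int t) * KB (2 * int t - int r - s) t * dp E (int r - int t))"
proof (induction r)
  case 0 show ?case by simp
next
  case (Suc r)
  define c where "c t = 2 * int t - int r - s - 2" for t
  \<comment> \<open>The two summands that \<open>e\<close> produces from the \<open>t\<close>-th one, and the \<open>t\<close>-th summand of the claim.\<close>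
  define T where "T t = dp F (s - int t) * (sc (qint (int (Suc r) - int t)) * KB (c t) t) * dp E (int (Suc r) - int t)" for t
  define T' where "T' t = dp F (s - int t - 1) * (Kb (1 - s + int t) * KB (c t + 2) t) * dp E (int r - int t)" for t
  define R where "R t = dp F (s - int t) * KB (c t + 1) t * dp E (int (Suc r) - int t)" for t
  have "sc (qint (int (Suc r))) * (dp E (int (Suc r)) * dp F s) = gE * (dp E (int r) * dp F s)"
    using dp_Suc[of "int r" E] by (simp add: mult.assoc[symmetric] add.commute)
  also have "\<dots> = (\<Sum>t\<le>r. gE * (dp F (s - int t) * KB (c t + 2) t * dp E (int r - int t)))"
    by (simp add: Suc.IH sum_distrib_left c_def)
  also have "\<dots> = (\<Sum>t\<le>r. T t + T' t)"
  proof (rule sum.cong)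
    fix t assume "t \<in> {..r}"
    have "gE * (dp F (s - int t) * KB (c t + 2) t * dp E (int r - int t)) =
       (dp F (s - int t) * gE + dp F (s - int t - 1) * Kb (1 - (s - int t))) * KB (c t + 2) t * dp E (int r - int t)"
      by (simp only: gE_dpF[symmetric] mult.assoc)
    also have "\<dots> = dp F (s - int t) * (gE * KB (c t + 2) t) * dp E (int r - int t) + T' t"
      by (simp add: T'_def algebra_simps)
    also have "gE * KB (c t + 2) t = KB (c t) t * gE" by (simp add: KB_gE)
    also have "dp F (s - int t) * (KB (c t) t * gE) * dp E (int r - int t) =
        dp F (s - int t) * KB (c t) t * (gE * dp E (int r - int t))" by (simp add: mult.assoc)
    also have "gE * dp E (int r - int t) = sc (qint (int (Suc r) - int t)) * dp E (int (Suc r) - int t)"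
      using dp_Suc[of "int r - int t" E] by (simp add: algebra_simps)
    also have "dp F (s - int t) * KB (c t) t * (sc (qint (int (Suc r) - int t)) * dp E (int (Suc r) - int t)) = T t"
      by (simp add: T_def sc_normal)
    finally show "gE * (dp F (s - int t) * KB (c t + 2) t * dp E (int r - int t)) = T t + T' t" .
  qed simp
  also have "\<dots> = (\<Sum>t\<le>Suc r. T t) + (\<Sum>t\<le>r. T' t)"
    by (simp add: sum.distrib T_def)
  also have "\<dots> = T 0 + (\<Sum>t\<le>r. T (Suc t) + T' t)"
    by (simp only: sum.atMost_Suc_shift sum.distrib add.assoc)
  also have "T 0 = sc (qint (int (Suc r))) * R 0" by (simp add: T_def R_def sc_normal)
  also have "(\<Sum>t\<le>r. T (Suc t) + T' t) = (\<Sum>t\<le>r. sc (qint (int (Suc r))) * R (Suc t))"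
  proof (rule sum.cong)
    fix u assume "u \<in> {..r}"
    have nz: "qint (int (Suc u)) \<noteq> 0" by (rule qint_neq_0) simp
    let ?c = "c (Suc u)"
    have K: "sc (qint (int (Suc r) - int (Suc u))) * KB ?c (Suc u) + Kb (1 - s + int u) * KB ?c u
        = sc (qint (int (Suc r))) * KB (?c + 1) (Suc u)"
    proof -
      have "sc (qint (int (Suc r) - int (Suc u))) * Kb (?c - int u) + sc (qint (int (Suc u))) * Kb (1 - s + int u)
         = sc (qint (int (Suc r))) * Kb (?c + 1)"
        using Kb_three_term[of "int (Suc r)" "int (Suc u)" "?c - int u"]
        by (simp add: c_def algebra_simps)
      hence "sc (1 / qint (int (Suc u))) * (sc (qint (int (Suc r) - int (Suc u))) * Kb (?c - int u) + sc (qint (int (Suc u))) * Kb (1 - s + int u)) * KB ?c u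
         = sc (1 / qint (int (Suc u))) * (sc (qint (int (Suc r))) * Kb (?c + 1)) * KB ?c u" by simp
      thus ?thesis using nz unfolding KB_front
        by (simp add: KB_Kb_commute sc_normal distrib_left distrib_right mult.commute[of "qint _"] del: of_nat_Suc)
    qed
    have "T (Suc u) + T' u = dp F (s - int (Suc u)) * (sc (qint (int (Suc r) - int (Suc u))) * KB ?c (Suc u) + Kb (1 - s + int u) * KB ?c u) * dp E (int r - int u)"
      by (simp add: T_def T'_def c_def algebra_simps del: KB.simps)
    also have "\<dots> = sc (qint (int (Suc r))) * R (Suc u)"
      unfolding K by (simp add: R_def sc_normal del: KB.simps)
    finally show "T (Suc u) + T' u = sc (qint (int (Suc r))) * R (Suc u)" .
  qed simp
  also have "sc (qint (int (Suc r))) * R 0 + (\<Sum>t\<le>r. sc (qint (int (Suc r))) * R (Suc t)) = sc (qint (int (Suc r))) * (\<Sum>t\<le>Suc r. R t)"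
    by (simp only: sum.atMost_Suc_shift distrib_left sum_distrib_left)
  finally have "dp E (int (Suc r)) * dp F s = (\<Sum>t\<le>Suc r. R t)"
    using sc_cancel qint_neq_0[of "int (Suc r)"] by simp
  also have "c t + 1 = 2 * int t - int (Suc r) - s" for t by (simp add: c_def)
  ultimately show ?case unfolding R_def by simp
qed

lemma KB_mult: "KB c a * KB (c - int a) b = sc (qbinom (int (a + b)) (int a)) * KB c (a + b)"
proof (induction b)
  case 0
  have "qbinom (int a) (int a) = 1" using qbinom_nat[of a 0] by (simp add: qfact_neq_0)
  thus ?case by simp
next
  case (Suc b)
  have nz: "qint (int (Suc b)) \<noteq> 0" "qint (int (Suc (a + b))) \<noteq> 0" by (auto intro!: qint_neq_0)
  have "qbinom (int (a + b)) (int a) / qint (int (Suc b)) = qbinom (int (a + Suc b)) (int a) / qint (int (Suc (a + b)))"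
    using nz qbinom_nat[of a b] qbinom_nat[of a "Suc b"]
    by (simp add: qfact_Suc del: of_nat_Suc of_nat_add)
  hence s: "sc (qbinom (int (a + b)) (int a) * (1 / qint (int (Suc b)))) = sc (qbinom (int (a + Suc b)) (int a) * (1 / qint (int (Suc (a + b)))))"
    by simp
  have "KB c a * KB (c - int a) (Suc b) =
      KB c a * KB (c - int a) b * (sc (1 / qint (int (Suc b))) * Kb (c - int (a + b)))"
    by (simp add: mult.assoc diff_diff_eq)
  also have "\<dots> = sc (qbinom (int (a + b)) (int a) * (1 / qint (int (Suc b)))) * (KB c (a + b) * Kb (c - int (a + b)))"
    unfolding Suc.IH by (simp add: sc_normal del: of_nat_Suc of_nat_add)
  also have "\<dots> = sc (qbinom (int (a + Suc b)) (int a)) * KB c (Suc (a + b))"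
    unfolding s by (simp add: sc_normal)
  finally show ?case by simp
qed

lemma dp_mult: "dp x (int a) * dp x (int b) = sc (qbinom (int (a + b)) (int a)) * dp x (int (a + b))"
  unfolding dp_nat qbinom_nat
  by (simp add: sc_normal power_add[symmetric] qfact_neq_0 field_simps)

text \<open>
  As for \<open>qbinom_Pascal\<close>: the shift \<open>c\<close> can be changed with unit coefficients in the restricted form.
\<close>
lemma KB_Pascal:
  "KB (c + 1) (Suc t) = sc (q powi (int (Suc t))) * KB c (Suc t) + sc (q powi (int t - c)) * (gK' * KB c t)"
proof -
  have nz: "qint (int (Suc t)) \<noteq> 0" by (rule qint_neq_0) simp
  have "Kb (c + 1) = sc (q powi (int (Suc t))) * Kb (c - int t) + sc (q powi (int t - c) * qint (int (Suc t))) * gK'"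
  proof -
    have e: "q powi (c + 1) = q powi (int (Suc t)) * q powi (c - int t)"
      by (subst power_int_add[symmetric]) (simp_all add: q_neq_0 add.commute)
    have f: "q powi (- (c + 1)) = q powi (int (Suc t)) * q powi (- (c - int t)) - q powi (int t - c) * (q powi (int (Suc t)) - q powi (- int (Suc t)))"
    proof -
      have "q powi (int t - c) * q powi (- int (Suc t)) = q powi (- (c + 1))"
        by (subst power_int_add[symmetric]) (simp_all add: q_neq_0)
      thus ?thesis by (simp add: algebra_simps del: of_nat_Suc)
    qed
    show ?thesis unfolding sc_Kb unfolding Kb_def e f qint_eq
      by (simp add: diff_divide_distrib sc_diff algebra_simps del: of_nat_Suc)
  qed
  hence "KB (c + 1) (Suc t) = sc (1 / qint (int (Suc t))) * ((sc (q powi (int (Suc t))) * Kb (c - int t) + sc (q powi (int t - c) * qint (int (Suc t))) * gK') * KB c t)"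
    by (simp only: KB_front)
  thus ?thesis using nz
    by (simp add: sc_normal distrib_left distrib_right KB_Kb_commute del: of_nat_Suc) (simp add: mult.commute)?
qed

lemma uq_of_KB: "uq_of (KB 0 r) = uq_Kbinom r"
proof (induction r)
  case 0 show ?case by (simp add: uq_of_simps)
next
  case (Suc r)
  have d: "sc (1 / qint (int (Suc r))) * Kb (0 - int r) =
     sc (1 / (q powi int (Suc r) - q powi (- int (Suc r)))) *
       (sc (q powi (1 - int (Suc r))) * gK - sc (q powi (int (Suc r) - 1)) * gK')"
    using qdiff_neq_0
    by (simp add: Kb_def qint_eq right_diff_distrib sc_sc_mult divide_simps mult.commute)
  have "uq_of (KB 0 (Suc r)) = uq_Kbinom r \<otimes>\<^bsub>Uq\<^esub> uq_of (sc (1 / qint (int (Suc r))) * Kb (0 - int r))"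
    by (simp only: KB.simps uq_of_simps(4) Suc.IH)
  thus ?case unfolding d by (simp only: uq_of_sc_mult uq_of_simps(5) uq_of_gen uq_Kbinom.simps)
qed

lemma uq_of_dp: "uq_of (dp x (int r)) = uq_dpow x r"
  by (simp only: dp_nat uq_of_sc_mult uq_of_power uq_of_gen uq_dpow_def)

section \<open>The restricted form\<close>

definition res :: "uqt set" where "res = {x. uq_of x \<in> carrier Ures}"

lemma uq_scale_one: "uq_scale a \<one>\<^bsub>Uq\<^esub> = uq_of (sc a)"
  using uq_of_sc_mult[of a 1] by (simp add: uq_of_simps(2))

lemma Ures_gens_subset: "(\<lambda>a. uq_scale a \<one>\<^bsub>Uq\<^esub>) ` laurent \<union> {uq_gen K, uq_gen Kinv}
      \<union> {uq_dpow E r | r. 1 \<le> r} \<union> {uq_dpow F r | r. 1 \<le> r} \<subseteq> carrier Uq"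
proof -
  have "uq_scale a \<one>\<^bsub>Uq\<^esub> \<in> carrier Uq" for a
    by (simp add: uq_scale_one)
  moreover have "uq_dpow x r \<in> carrier Uq" for x r using uq_of_closed by (simp only: uq_of_dp[symmetric])
  moreover have "uq_gen x \<in> carrier Uq" for x using uq_of_closed by (simp only: uq_of_gen[symmetric])
  ultimately show ?thesis by auto
qed

lemma Ures_ring: "ring Ures"
  unfolding Ures_def by (rule Uq.generate_ring_is_ring[OF Ures_gens_subset])

lemma carrier_Ures_subset: "carrier Ures \<subseteq> carrier Uq"
  unfolding Ures_def using Uq.generate_ring_incl[OF Ures_gens_subset] by simp

lemma carrier_Ures: "carrier Ures = uq_of ` res"
proof
  show "carrier Ures \<subseteq> uq_of ` res"
  proof
    fix x assume x: "x \<in> carrier Ures"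
    hence "x = uq_of (uq_abs x)" using carrier_Ures_subset by (auto simp: uq_abs_inverse)
    thus "x \<in> uq_of ` res" using x by (auto simp: res_def intro!: image_eqI[of _ _ "uq_abs x"])
  qed
qed (auto simp: res_def)

lemma Ures_ops: "x \<otimes>\<^bsub>Ures\<^esub> y = x \<otimes>\<^bsub>Uq\<^esub> y" "x \<oplus>\<^bsub>Ures\<^esub> y = x \<oplus>\<^bsub>Uq\<^esub> y" "\<one>\<^bsub>Ures\<^esub> = \<one>\<^bsub>Uq\<^esub>" "\<zero>\<^bsub>Ures\<^esub> = \<zero>\<^bsub>Uq\<^esub>"
  by (simp_all add: Ures_def)

lemma res_add: "x \<in> res \<Longrightarrow> y \<in> res \<Longrightarrow> x + y \<in> res"
  by (auto simp: res_def uq_of_simps Ures_def intro: generate_ring.intros)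

lemma res_mult: "x \<in> res \<Longrightarrow> y \<in> res \<Longrightarrow> x * y \<in> res"
  by (auto simp: res_def uq_of_simps Ures_def intro: generate_ring.intros)

lemma res_uminus: "x \<in> res \<Longrightarrow> - x \<in> res"
  by (auto simp: res_def uq_of_simps Ures_def intro: generate_ring.intros)

lemma res_diff: "x \<in> res \<Longrightarrow> y \<in> res \<Longrightarrow> x - y \<in> res"
  using res_add[of x "- y"] res_uminus[of y] by simp

lemma res_1: "1 \<in> res"
  by (auto simp: res_def uq_of_simps Ures_def intro: generate_ring.intros)

lemma res_0: "0 \<in> res"
  using res_diff[OF res_1 res_1] by simp

lemma res_sc: assumes "a \<in> laurent" shows "sc a \<in> res"
  using assms by (auto simp: res_def Ures_def uq_scale_one intro: generate_ring.incl)

lemma res_gK: "gK \<in> res" "gK' \<in> res"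
  by (auto simp: res_def Ures_def uq_of_gen intro: generate_ring.incl)

lemma res_dp: assumes "x \<in> {E, F}" shows "dp x n \<in> res"
proof -
  have "dp x (int r) \<in> res" if "r \<ge> 1" for r
    using that assms by (auto simp: res_def Ures_def uq_of_dp intro!: generate_ring.incl)
  moreover have "n < 0 \<or> n = 0 \<or> (n = int (nat n) \<and> nat n \<ge> 1)" by auto
  ultimately show ?thesis by (metis dp_neg dp_0 res_0 res_1)
qed

lemma res_sum: "(\<And>i. i \<in> A \<Longrightarrow> f i \<in> res) \<Longrightarrow> sum f A \<in> res"
  by (induction A rule: infinite_finite_induct) (simp_all add: res_0 res_add)

text \<open>
  In Kac's formula for \<open>e\<^bsup>(t)\<^esup> f\<^bsup>(t)\<^esup>\<close> the last term is \<open>[K; 0; t]\<close>, while the others contain only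
  \<open>[K; c; i]\<close> with \<open>i < t\<close>. This settles \<open>c = 0\<close>, and Pascal's rule leads to all other \<open>c\<close>.
\<close>
lemma res_KB: "KB c t \<in> res"
proof (induction t arbitrary: c rule: less_induct)
  case (less t)
  show ?case
  proof (cases t)
    case 0 thus ?thesis by (simp add: res_1)
  next
    case (Suc u)
    have "dp E (int t) * dp F (int t) = KB 0 t + (\<Sum>i<t. dp F (int t - int i) * KB (2 * int i - int t - int t) i * dp E (int t - int i))"
      by (simp add: Kac lessThan_Suc_atMost[symmetric])
    hence "KB 0 t = dp E (int t) * dp F (int t) - (\<Sum>i<t. dp F (int t - int i) * KB (2 * int i - int t - int t) i * dp E (int t - int i))"
      by simp
    moreover have "(\<Sum>i<t. dp F (int t - int i) * KB (2 * int i - int t - int t) i * dp E (int t - int i)) \<in> res"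
      using less.IH by (intro res_sum res_mult res_dp) auto
    ultimately have base: "KB 0 t \<in> res" by (simp add: res_diff res_mult res_dp)
    show ?thesis
    proof (induction c rule: int_induct[where k = 0])
      case base show ?case by (rule \<open>KB 0 t \<in> res\<close>)
    next
      case (step1 c)
      thus ?case using less.IH[of u] unfolding Suc KB_Pascal
        by (intro res_add res_mult res_sc laurent_q_powi res_gK) auto
    next
      case (step2 c)
      \<comment> \<open>Pascal's rule is solved for the summand with the smaller shift.\<close>
      have inv: "q powi (- int (Suc u)) * q powi (int (Suc u)) = 1"
        by (subst power_int_add[symmetric]) (simp_all add: q_neq_0)
      have "sc (q powi (- int (Suc u))) * KB (c - 1 + 1) (Suc u) = KB (c - 1) (Suc u) + sc (q powi (- int (Suc u))) * (sc (q powi (int u - (c - 1))) * (gK' * KB (c - 1) u))"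
        unfolding KB_Pascal distrib_left by (simp only: sc_sc_mult inv sc_1 mult_1_left)
      hence "KB (c - 1) (Suc u) = sc (q powi (- int (Suc u))) * (KB c (Suc u) - sc (q powi (int u - (c - 1))) * (gK' * KB (c - 1) u))"
        by (simp add: right_diff_distrib del: of_nat_Suc KB.simps)
      thus ?case using step2 less.IH[of u] unfolding Suc
        by (simp only: res_diff res_mult res_sc laurent_q_powi res_gK lessI)
    qed
  qed
qed

lemma carrier_Ures_generate: "carrier Ures = generate_ring Uq
    ((\<lambda>a. uq_scale a \<one>\<^bsub>Uq\<^esub>) ` laurent \<union> {uq_gen K, uq_gen Kinv}
      \<union> {uq_dpow E r | r. 1 \<le> r} \<union> {uq_dpow F r | r. 1 \<le> r})"
  by (simp add: Ures_def)

lemma carrier_UresE: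
  assumes "X \<in> carrier Ures" obtains x where "X = uq_of x" "x \<in> res"
  using assms unfolding carrier_Ures by blast

lemma res_induct [consumes 1, case_names sc K Kinv E F add mult]:
  assumes "x \<in> res"
    and sc: "\<And>a. a \<in> laurent \<Longrightarrow> P (sc a)"
    and "P gK" "P gK'" "\<And>r. r \<ge> 1 \<Longrightarrow> P (dp E (int r))" "\<And>r. r \<ge> 1 \<Longrightarrow> P (dp F (int r))"
    and add: "\<And>x y. x \<in> res \<Longrightarrow> y \<in> res \<Longrightarrow> P x \<Longrightarrow> P y \<Longrightarrow> P (x + y)"
    and mult: "\<And>x y. x \<in> res \<Longrightarrow> y \<in> res \<Longrightarrow> P x \<Longrightarrow> P y \<Longrightarrow> P (x * y)"
  shows "P x"
proof -
  have "\<forall>x. X = uq_of x \<longrightarrow> P x" if "X \<in> carrier Ures" for X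
    using that[unfolded carrier_Ures_generate]
  proof (induction rule: generate_ring.induct)
    case one
    show ?case using sc[OF laurent_1] by (simp add: uq_of_inject flip: uq_of_simps)
  next
    case (incl h)
    then consider (sc) a where "a \<in> laurent" "h = uq_of (sc a)" | (K) "h = uq_of gK" | (Kinv) "h = uq_of gK'"
      | (E) r where "r \<ge> 1" "h = uq_of (dp E (int r))" | (F) r where "r \<ge> 1" "h = uq_of (dp F (int r))"
      unfolding uq_scale_one uq_of_gen uq_of_dp by blast
    thus ?case by cases (simp_all add: assms uq_of_inject)
  next
    case (a_inv h)
    obtain x where x: "h = uq_of x" "x \<in> res"
      by (rule carrier_UresE[OF a_inv(1)[folded carrier_Ures_generate]])
    have "P (sc (- 1) * x)" using a_inv x by (intro mult res_sc sc laurent_m1) auto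
    thus ?case using x by (auto simp: uq_of_inject sc_uminus simp flip: uq_of_simps)
  next
    case (eng_add h1 h2)
    obtain x where x: "h1 = uq_of x" "x \<in> res"
      by (rule carrier_UresE[OF eng_add(1)[folded carrier_Ures_generate]])
    obtain y where y: "h2 = uq_of y" "y \<in> res"
      by (rule carrier_UresE[OF eng_add(2)[folded carrier_Ures_generate]])
    have "P (x + y)" using eng_add(3,4) x y by (intro add) auto
    thus ?case using x y by (auto simp: uq_of_inject simp flip: uq_of_simps)
  next
    case (eng_mult h1 h2)
    obtain x where x: "h1 = uq_of x" "x \<in> res"
      by (rule carrier_UresE[OF eng_mult(1)[folded carrier_Ures_generate]])
    obtain y where y: "h2 = uq_of y" "y \<in> res"
      by (rule carrier_UresE[OF eng_mult(2)[folded carrier_Ures_generate]])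
    have "P (x * y)" using eng_mult(3,4) x y by (intro mult) auto
    thus ?case using x y by (auto simp: uq_of_inject simp flip: uq_of_simps)
  qed
  thus ?thesis using assms(1) by (simp add: res_def)
qed

section \<open>Specialization at a root of unity\<close>

lemma Ures_monoid: "Group.monoid Ures"
  using Ures_ring by (simp add: ring_def)

lemma uq_of_res: "uq_of x \<in> carrier Ures \<longleftrightarrow> x \<in> res"
  by (simp add: res_def)

lemma tensor_relators_I:
  "x \<in> carrier Ures \<Longrightarrow> y \<in> carrier Ures \<Longrightarrow> single (x \<oplus>\<^bsub>Ures\<^esub> y) 1
    - single x 1 - single y 1 \<in> tensor_relators \<epsilon>"
  "a \<in> laurent \<Longrightarrow> x \<in> carrier Ures \<Longrightarrow>
    single (uq_scale a x) 1 - single x (value_at \<epsilon> a) \<in> tensor_relators \<epsilon>"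
  unfolding tensor_relators_def by blast+

lemma tensor_relators_carrier: "tensor_relators \<epsilon> \<subseteq> carrier (monoid_algebra Ures)"
proof -
  interpret monoid_with_algebra Ures by (rule monoid_with_algebra.intro[OF Ures_monoid])
  interpret A: ring "alg :: (uq \<Rightarrow>\<^sub>0 complex) ring" by (rule alg_ring)
  have d: "x - y \<in> carrier alg" if "x \<in> carrier alg" "y \<in> carrier alg" for x y :: "uq \<Rightarrow>\<^sub>0 complex"
    using A.minus_closed[OF that] alg_minus[OF that] by simp
  have "uq_scale a x \<in> carrier Ures" if "a \<in> laurent" "x \<in> carrier Ures" for a x
  proof -
    obtain y where y: "x = uq_of y" "y \<in> res" using \<open>x \<in> carrier Ures\<close> unfolding carrier_Ures by blast
    have "sc a * y \<in> res" using that y by (simp add: res_mult res_sc)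
    thus ?thesis by (simp add: y uq_of_sc_mult[symmetric] uq_of_res)
  qed
  moreover have "x \<oplus>\<^bsub>Ures\<^esub> y \<in> carrier Ures" if "x \<in> carrier Ures" "y \<in> carrier Ures" for x y
    using Ures_ring that by (simp add: ring.ring_simprules)
  ultimately show ?thesis
    by (auto simp: tensor_relators_def intro!: d single_in_alg)
qed

context odd_root_of_unity
begin

sublocale T: monoid_algebra_quotient Ures "tensor_relators \<epsilon>"
  by (rule monoid_algebra_quotient.intro[OF monoid_with_algebra.intro[OF Ures_monoid]], unfold_locales) (rule tensor_relators_carrier)

abbreviation U where "U \<equiv> Ueps \<epsilon>"
abbreviation sp where "sp x \<equiv> spec \<epsilon> (uq_of x)"
abbreviation k where "k c \<equiv> ueps_const \<epsilon> c"

lemma U_eq: "U = T.Q"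
  by (simp add: Ueps_def)

sublocale U: ring U
  unfolding U_eq by (rule T.Q.ring_axioms)

lemma tensor_eq: "tensor \<epsilon> x c = T.cs (single x c)"
  by (simp add: tensor_def)

lemma tensor_closed: "x \<in> carrier Ures \<Longrightarrow> tensor \<epsilon> x c \<in> carrier U"
  unfolding tensor_eq U_eq by (intro T.cs_simps T.single_in_alg)

lemma tensor_mult:
  assumes "x \<in> carrier Ures" "y \<in> carrier Ures"
  shows "tensor \<epsilon> (x \<otimes>\<^bsub>Ures\<^esub> y) (c * d) = tensor \<epsilon> x c \<otimes>\<^bsub>U\<^esub> tensor \<epsilon> y d"
  unfolding tensor_eq U_eq T.alg_mult_single[symmetric]
  by (intro T.cs_simps T.single_in_alg assms)

lemma tensor_add_r:
  assumes "x \<in> carrier Ures"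
  shows "tensor \<epsilon> x (c + d) = tensor \<epsilon> x c \<oplus>\<^bsub>U\<^esub> tensor \<epsilon> x d"
  unfolding tensor_eq U_eq single_add
  using T.cs_simps(2)[OF T.single_in_alg[OF assms] T.single_in_alg[OF assms], of c d]
  by (simp add: monoid_algebra_simps)

lemma one_Ures: "\<one>\<^bsub>Ures\<^esub> \<in> carrier Ures"
  using uq_of_res[of 1] res_1 by (simp add: uq_of_simps Ures_ops)

lemma tensor_k: assumes "x \<in> carrier Ures" shows "tensor \<epsilon> x c = k c \<otimes>\<^bsub>U\<^esub> spec \<epsilon> x"
  using tensor_mult[OF one_Ures assms, of c 1] assms Ures_ring
  by (simp add: ring.ring_simprules)

lemma k_closed [simp]: "k c \<in> carrier U"
  by (rule tensor_closed[OF one_Ures])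

lemma k_mult: "k (c * d) = k c \<otimes>\<^bsub>U\<^esub> k d"
  using tensor_mult[OF one_Ures one_Ures, of c d] Ures_ring
  by (simp add: ring.ring_simprules one_Ures)

lemma k_add: "k (c + d) = k c \<oplus>\<^bsub>U\<^esub> k d"
  by (rule tensor_add_r[OF one_Ures])

lemma k_1: "k 1 = \<one>\<^bsub>U\<^esub>"
  using T.cs_simps(4) by (simp add: tensor_eq U_eq monoid_algebra_simps)

lemma k_0: "k 0 = \<zero>\<^bsub>U\<^esub>"
  using k_add[of 0 0] U.add.l_cancel_one' k_closed[of 0] by simp

lemma sp_closed [simp]: "x \<in> res \<Longrightarrow> sp x \<in> carrier U"
  by (rule tensor_closed) (simp add: uq_of_res)

lemma sp_mult: "x \<in> res \<Longrightarrow> y \<in> res \<Longrightarrow> sp (x * y) = sp x \<otimes>\<^bsub>U\<^esub> sp y"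
  using tensor_mult[of "uq_of x" "uq_of y" 1 1] by (simp add: uq_of_res uq_of_simps Ures_ops)

lemma sp_1: "sp 1 = \<one>\<^bsub>U\<^esub>"
  using k_1 by (simp add: uq_of_simps Ures_ops)

lemma sp_add: assumes "x \<in> res" "y \<in> res" shows "sp (x + y) = sp x \<oplus>\<^bsub>U\<^esub> sp y"
proof -
  let ?s = "\<lambda>x. single (uq_of x) (1::complex)"
  have c: "?s x \<in> carrier T.alg" "?s y \<in> carrier T.alg" "?s (x + y) \<in> carrier T.alg"
    using assms by (auto intro!: T.single_in_alg simp: uq_of_res res_add)
  have "sp (x + y) = T.cs (?s x + ?s y)"
    unfolding tensor_eq
  proof (rule T.cs_relator)
    have "single (uq_of x \<oplus>\<^bsub>Ures\<^esub> uq_of y) 1 - ?s x - ?s y \<in> tensor_relators \<epsilon>"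
      using assms by (intro tensor_relators_I) (auto simp: uq_of_res)
    thus "?s (x + y) - (?s x + ?s y) \<in> tensor_relators \<epsilon>" by (simp add: uq_of_simps Ures_ops algebra_simps)
    show "?s x + ?s y \<in> carrier T.alg" using T.A.a_closed[OF c(1,2)] by (simp add: monoid_algebra_simps)
  qed (rule c)
  also have "\<dots> = sp x \<oplus>\<^bsub>U\<^esub> sp y"
    using T.cs_simps(2)[OF c(1,2)] by (simp add: tensor_eq U_eq monoid_algebra_simps)
  finally show ?thesis .
qed

lemma sp_sc_mult: assumes "a \<in> laurent" "x \<in> res" shows "sp (sc a * x) = k (val a) \<otimes>\<^bsub>U\<^esub> sp x"
proof -
  have "sp (sc a * x) = tensor \<epsilon> (uq_of x) (val a)"
    unfolding tensor_eq
  proof (rule T.cs_relator)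
    show "single (uq_of (sc a * x)) 1 - single (uq_of x) (val a) \<in> tensor_relators \<epsilon>"
      using assms unfolding uq_of_sc_mult by (intro tensor_relators_I) (auto simp: uq_of_res)
  qed (auto intro!: T.single_in_alg simp: uq_of_res assms res_mult res_sc)
  also have "\<dots> = k (val a) \<otimes>\<^bsub>U\<^esub> sp x"
    by (rule tensor_k) (simp add: uq_of_res assms)
  finally show ?thesis .
qed

lemma sp_sc: "a \<in> laurent \<Longrightarrow> sp (sc a) = k (val a)"
  using sp_sc_mult[of a 1] by (simp add: res_1 sp_1)

lemma k_sp_commute: assumes "x \<in> res" shows "sp x \<otimes>\<^bsub>U\<^esub> k c = k c \<otimes>\<^bsub>U\<^esub> sp x"
proof -
  have x: "uq_of x \<in> carrier Ures" using assms by (simp add: uq_of_res)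
  have "sp x \<otimes>\<^bsub>U\<^esub> k c = tensor \<epsilon> (uq_of x) c"
    using tensor_mult[OF x one_Ures, of 1 c] x Ures_ring by (simp add: ring.ring_simprules)
  also have "\<dots> = k c \<otimes>\<^bsub>U\<^esub> sp x" by (rule tensor_k[OF x])
  finally show ?thesis .
qed

lemma sp_0: "sp 0 = \<zero>\<^bsub>U\<^esub>"
  using sp_sc[of 0] by (simp add: laurent_0 k_0 val_simps)

lemma Ueps_induct [consumes 1, case_names const K Kinv E F add mult]:
  assumes "u \<in> carrier U"
    and const: "\<And>c. P (k c)"
    and K: "P (sp gK)" and Kinv: "P (sp gK')"
    and E: "\<And>r. r \<ge> 1 \<Longrightarrow> P (sp (dp E (int r)))"
    and F: "\<And>r. r \<ge> 1 \<Longrightarrow> P (sp (dp F (int r)))"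
    and add: "\<And>u v. u \<in> carrier U \<Longrightarrow> v \<in> carrier U \<Longrightarrow> P u \<Longrightarrow> P v \<Longrightarrow> P (u \<oplus>\<^bsub>U\<^esub> v)"
    and mult: "\<And>u v. u \<in> carrier U \<Longrightarrow> v \<in> carrier U \<Longrightarrow> P u \<Longrightarrow> P v \<Longrightarrow> P (u \<otimes>\<^bsub>U\<^esub> v)"
  shows "P u"
proof -
  have "P (sp x)" if "x \<in> res" for x
    using that
  proof (induction rule: res_induct)
    case (sc a)
    show ?case using const[of "val a"] sp_sc[OF sc] by simp
  next
    case (add x y)
    show ?case unfolding sp_add[OF add(1,2)] by (rule assms(7)) (simp_all add: add)
  next
    case (mult x y)
    show ?case unfolding sp_mult[OF mult(1,2)] by (rule assms(8)) (simp_all add: mult)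
  qed (simp_all add: assms)
  hence sp: "P (spec \<epsilon> X)" if "X \<in> carrier Ures" for X
    using that by (metis carrier_UresE)
  show ?thesis using assms(1)[unfolded U_eq]
  proof (induction rule: T.Q_induct)
    case (single X c)
    have "P (k c \<otimes>\<^bsub>U\<^esub> spec \<epsilon> X)"
      by (rule mult[OF k_closed tensor_closed[OF single] const sp[OF single]])
    thus ?case by (simp only: tensor_k[OF single, of c, symmetric]) (simp only: tensor_eq)
  next
    case zero show ?case using const[of 0] by (simp add: k_0 U_eq[symmetric])
  next
    case (add X Y) thus ?case using assms(7)[of X Y] by (simp add: U_eq[symmetric])
  qed
qed

end

section \<open>The generic Fock space and its integrality\<close>

text \<open>
  The action on \<open>g(r\<^sub>1, r\<^sub>2)\<close> for generic \<open>q\<close>. The truncated \<open>r2 - 1\<close> is harmless at \<open>r2 = 0\<close>, where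
  the coefficient \<open>[0]\<close> vanishes; for \<open>r1 = 0\<close> it need not vanish, and the case is separate.
\<close>
fun gact :: "gen \<Rightarrow> nat \<times> nat \<Rightarrow> (nat \<times> nat \<Rightarrow>\<^sub>0 ratfun)"
  where
    "gact E (r1, r2) = (if r1 = 0 then 0 else single (r1 - 1, r2 - 1) (qint (int r2)))"
  | "gact F (r1, r2) = single (r1 + 1, r2 + 1) (- qint (int r1 + 1))"
  | "gact K (r1, r2) = single (r1, r2) (q powi (- (int r1 + int r2 + 1)))"
  | "gact Kinv (r1, r2) = single (r1, r2) (q powi (int r1 + int r2 + 1))"

primrec wact :: "gen list \<Rightarrow> nat \<times> nat \<Rightarrow> (nat \<times> nat \<Rightarrow>\<^sub>0 ratfun)"
  where
    "wact [] i = single i 1"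
  | "wact (x # w) i = lin (gact x) (wact w i)"

lemma wact_append: "wact (u @ v) i = lin (wact u) (wact v i)"
proof (induction u)
  case Nil show ?case by (simp add: lin_single_id[unfolded fun_eq_iff] wact.simps(1)[abs_def])
next
  case (Cons x u)
  have "wact (x # u) = (\<lambda>i. lin (gact x) (wact u i))" by (simp add: fun_eq_iff)
  thus ?case using Cons by (simp add: lin_lin)
qed

lemma wact_relators:
  assumes "x \<in> uq_relators" shows "lin (\<lambda>w. wact w i) x = 0"
proof -
  obtain r1 r2 where i: "i = (r1, r2)" by (cases i)
  have q: "q \<noteq> 0" by (rule q_neq_0)
  have KK: "q powi (int r1 + int r2 + 1) * q powi (- (int r1 + int r2 + 1)) = 1"
    by (subst power_int_add[symmetric]) (simp_all add: q)
  consider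
    "x = single [K, Kinv] 1 - single [] 1"
    | "x = single [Kinv, K] 1 - single [] 1"
    | "x = single [K, E, Kinv] 1 - single [E] (q ^ 2)"
    | "x = single [K, F, Kinv] 1 - single [F] (inverse q ^ 2)"
    | "x = single [E, F] 1 - single [F, E] 1
      - (single [K] (1 / (q - inverse q)) - single [Kinv] (1 / (q - inverse q)))"
    using assms by (auto simp: uq_relators_def)
  thus ?thesis
  proof cases
    case 1
    thus ?thesis using KK by (simp add: i lin_diff scal_simps mult.commute)
  next
    case 2
    thus ?thesis using KK by (simp add: i lin_diff scal_simps mult.commute)
  next
    case 3
    show ?thesis
    proof (cases "r1 = 0 \<or> r2 = 0")
      case True thus ?thesis using 3 by (auto simp: i lin_diff scal_simps)
    next
      case False
      have "q powi (1 - (int r1 + int r2)) * q powi (int r1 + int r2 + 1) = q ^ 2"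
        by (subst power_int_add[symmetric]) (simp_all add: q)
      thus ?thesis using 3 False
        by (simp add: i lin_diff scal_simps mult.commute mult.left_commute)
    qed
  next
    case 4
    have "q powi (int r1 + int r2 + 1) * q powi (- int r1 - int r2 - 3) = q powi (- 2)"
      by (subst power_int_add[symmetric]) (simp_all add: q)
    also have "q powi (- 2) = inverse q ^ 2" by (simp add: power_int_minus power_inverse)
    finally have "q powi (int r1 + int r2 + 1) * q powi (- int r1 - int r2 - 3) = inverse q ^ 2" .
    thus ?thesis using 4
      by (simp add: i lin_diff scal_simps mult.commute mult.left_commute)
  next
    case 5
    have c: "qint (int r1 + 1) * qint (int r2 + 1) = qint (int r1) * qint (int r2) + qint (int r1 + int r2 + 1)"
      using qint_three_term[of "int r1" "int r2 + 1" 1] 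
      by (simp add: add_ac mult.commute)
    have d: "q powi (int r1 + int r2 + 1) / qdiff - q powi (- (int r1 + int r2 + 1)) / qdiff = qint (int r1 + int r2 + 1)"
      by (simp add: qint_eq diff_divide_distrib)
    have ef: "wact [E, F] i = single (r1, r2) (- (qint (int r1 + 1) * qint (int r2 + 1)))"
      by (simp add: i scal_simps lin_uminus single_uminus add.commute mult.commute)
    have fe: "wact [F, E] i = single (r1, r2) (- (qint (int r1) * qint (int r2)))"
      by (cases r1; cases r2) (simp_all add: i scal_simps single_uminus[symmetric] add.commute mult.commute del: single_uminus)
    have kk: "wact [K] i = single (r1, r2) (q powi (- (int r1 + int r2 + 1)))"
      "wact [Kinv] i = single (r1, r2) (q powi (int r1 + int r2 + 1))"
      by (simp_all add: i scal_simps)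
    have "lin (\<lambda>w. wact w i) x = single (r1, r2)
      (- (qint (int r1 + 1) * qint (int r2 + 1)) + qint (int r1) * qint (int r2)
        + (q powi (int r1 + int r2 + 1) / qdiff - q powi (- (int r1 + int r2 + 1)) / qdiff))"
      unfolding 5 lin_diff lin_single ef fe kk scal_simps single_diff[symmetric] qdiff_def[symmetric]
      by (rule arg_cong[of _ _ "single (r1, r2)"]) simp
    also have "\<dots> = 0" unfolding d c by simp
    finally show ?thesis .
  qed
qed

interpretation Uq_rep: monoid_algebra_quotient_rep words uq_relators wact
  by unfold_locales (auto simp: words_simps wact_append wact_relators)

definition urep :: "uqt \<Rightarrow> nat \<times> nat \<Rightarrow> (nat \<times> nat \<Rightarrow>\<^sub>0 ratfun)"
  where "urep x = Uq_rep.rep (uq_of x)"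

lemma urep_1: "urep 1 i = single i 1"
  using Uq_rep.rep_one[of i] by (simp add: urep_def uq_of_simps Uq_eq)

lemma urep_mult: "urep (x * y) i = lin (urep x) (urep y i)"
  using Uq_rep.rep_mult[of "uq_of x" "uq_of y" i] uq_of_closed[of x] uq_of_closed[of y]
  by (simp add: urep_def uq_of_simps Uq_eq)

lemma urep_add: "urep (x + y) i = urep x i + urep y i"
  using Uq_rep.rep_add[of "uq_of x" "uq_of y" i] uq_of_closed[of x] uq_of_closed[of y]
  by (simp add: urep_def uq_of_simps Uq_eq)

lemma urep_sc: "urep (sc a) i = single i a"
  using Uq_rep.rep_single[of "[]" a i] by (simp add: urep_def uq_of_sc words_simps scal_simps)

lemma urep_sc_mult: "urep (sc a * x) i = scal a (urep x i)"
proof -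
  have "urep (sc a) = (\<lambda>i. scal a (single i 1))" by (simp add: fun_eq_iff urep_sc scal_simps)
  thus ?thesis by (simp add: urep_mult lin_fun_scal lin_single_id)
qed

lemma urep_gen: "urep (gen x) i = gact x i"
  using Uq_rep.rep_single[of "[x]" 1 i] by (simp add: urep_def uq_of_gen_word words_simps scal_simps)

lemma urep_gE_power:
  "urep (gE ^ n) (r1, r2) =
    (if n \<le> r1 then single (r1 - n, r2 - n) (\<Prod>i<n. qint (int r2 - int i)) else 0)"
proof (induction n)
  case 0 show ?case by (simp add: urep_1)
next
  case (Suc n)
  have "urep (gE ^ Suc n) (r1, r2) = lin (urep gE) (urep (gE ^ n) (r1, r2))" by (simp add: urep_mult)
  also have "\<dots> = (if Suc n \<le> r1 then single (r1 - Suc n, r2 - Suc n)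
      ((\<Prod>i<n. qint (int r2 - int i)) * qint (int (r2 - n))) else 0)"
    by (auto simp: Suc.IH urep_gen scal_simps)
  also have "(\<Prod>i<n. qint (int r2 - int i)) * qint (int (r2 - n)) = (\<Prod>i<Suc n. qint (int r2 - int i))"
  proof (cases "n \<le> r2")
    case True thus ?thesis by (simp add: of_nat_diff)
  next
    case False
    hence "(\<Prod>i<n. qint (int r2 - int i)) = 0" by (auto intro!: bexI[of _ r2])
    thus ?thesis by simp
  qed
  finally show ?case .
qed

lemma urep_dpE:
  "urep (dp E (int n)) (r1, r2) =
    (if n \<le> r1 then single (r1 - n, r2 - n) (qbinom (int r2) (int n)) else 0)"
  by (simp add: dp_nat urep_sc_mult urep_gE_power scal_simps qbinom_def field_simps)

lemma urep_gF_power: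
  "urep (gF ^ n) (r1, r2) = single (r1 + n, r2 + n) ((- 1) ^ n * (qfact (n + r1) / qfact r1))"
proof (induction n)
  case 0 show ?case by (simp add: urep_1 qfact_neq_0)
next
  case (Suc n)
  have "urep (gF ^ Suc n) (r1, r2) = lin (urep gF) (urep (gF ^ n) (r1, r2))" by (simp add: urep_mult)
  thus ?case by (simp add: Suc.IH urep_gen scal_simps qfact_Suc add.commute mult.assoc)
qed

lemma urep_dpF:
  "urep (dp F (int n)) (r1, r2) =
    single (r1 + n, r2 + n) ((- 1) ^ n * qbinom (int (n + r1)) (int n))"
  by (simp add: dp_nat urep_sc_mult urep_gF_power scal_simps qbinom_nat[of n r1, unfolded of_nat_add] field_simps)

lemma lookup_lin: "lookup (lin \<phi> x) j =
    (\<Sum>a\<in>keys x. lookup x a * lookup (\<phi> a) j)"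
  by (simp add: lin_def lookup_sum)

text \<open>
  The matrix entries of the generators are q-binomials and powers of \<open>q\<close> up to sign. This is what
  allows to set \<open>q = \<epsilon>\<close>.
\<close>
lemma urep_integral: "x \<in> res \<Longrightarrow> lookup (urep x i) j \<in> laurent"
proof (induction x arbitrary: i j rule: res_induct)
  case (E r)
  thus ?case by (cases i) (auto simp: urep_dpE lookup_single when_def laurent_qbinom laurent_0)
next
  case (F r)
  thus ?case by (cases i)
    (auto simp: urep_dpF lookup_single when_def laurent_0 simp del: of_nat_add intro!: laurent_mult laurent_power laurent_m1 laurent_qbinom)
next
  case K show ?case by (cases i) (auto simp: urep_gen lookup_single when_def laurent_0 laurent_q_powi)
next
  case Kinv show ?case by (cases i) (auto simp: urep_gen lookup_single when_def laurent_0 laurent_q_powi)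
next
  case (mult x y) thus ?case by (simp add: urep_mult lookup_lin laurent_sum laurent_mult)
qed (auto simp: urep_sc urep_add lookup_add lookup_single when_def laurent_0 laurent_add)

section \<open>Existence of the specialized Fock module\<close>

context odd_root_of_unity
begin

definition vmap :: "('b \<Rightarrow>\<^sub>0 ratfun) \<Rightarrow> ('b \<Rightarrow>\<^sub>0 complex)"
  where "vmap x = Poly_Mapping.map val x"

lemma lookup_vmap [simp]: "lookup (vmap x) j = val (lookup x j)"
  by (simp add: vmap_def Poly_Mapping.map.rep_eq when_def val_simps)

lemma vmap_single: "vmap (single j a) = single j (val a)"
  by (rule poly_mapping_eqI) (simp add: lookup_single when_def val_simps)

text \<open>
  Evaluation is a ring homomorphism on Laurent polynomials only, whence the assumptions.
\<close>
lemma vmap_lin: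
  assumes "\<And>i j. lookup (\<phi> i) j \<in> laurent" "\<And>j. lookup x j \<in> laurent"
  shows "vmap (lin \<phi> x) = lin (\<lambda>i. vmap (\<phi> i)) (vmap x)"
proof (rule poly_mapping_eqI)
  fix j
  have "keys (vmap x) \<subseteq> keys x" by (auto simp: in_keys_iff val_simps)
  hence "lookup (lin (\<lambda>i. vmap (\<phi> i)) (vmap x)) j =
      (\<Sum>a\<in>keys x. val (lookup x a) * val (lookup (\<phi> a) j))"
    by (subst lin_superset[of "keys x"]) (simp_all add: lookup_sum)
  also have "\<dots> = lookup (vmap (lin \<phi> x)) j"
    by (simp add: lookup_lin value_at_sum[OF eps_neq_0] value_at_mult[OF eps_neq_0] laurent_mult assms)
  finally show "lookup (vmap (lin \<phi> x)) j = lookup (lin (\<lambda>i. vmap (\<phi> i)) (vmap x)) j" ..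
qed

definition srep :: "uq \<Rightarrow> nat \<times> nat \<Rightarrow> fock"
  where "srep X i = vmap (Uq_rep.rep X i)"

lemma srep_uq_of: "srep (uq_of x) i = vmap (urep x i)"
  by (simp add: srep_def urep_def)

lemma srep_relators:
  assumes "z \<in> tensor_relators \<epsilon>" shows "lin (\<lambda>X. srep X i) z = 0"
proof -
  from assms consider (add) X Y where "X \<in> carrier Ures" "Y \<in> carrier Ures"
      "z = single (X \<oplus>\<^bsub>Ures\<^esub> Y) 1 - single X 1 - single Y 1"
    | (scale) a X where "a \<in> laurent" "X \<in> carrier Ures"
      "z = single (uq_scale a X) 1 - single X (val a)"
    unfolding tensor_relators_def by blast
  thus ?thesis
  proof cases
    case add
    obtain x y where xy: "X = uq_of x" "x \<in> res" "Y = uq_of y" "y \<in> res"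
      using add(1,2) by (metis carrier_UresE)
    have "srep (uq_of (x + y)) i = srep (uq_of x) i + srep (uq_of y) i"
      unfolding srep_uq_of urep_add
      by (rule poly_mapping_eqI) (simp add: lookup_add value_at_add[OF eps_neq_0] urep_integral xy)
    thus ?thesis using add(3) xy by (simp add: lin_diff scal_simps uq_of_simps Ures_ops)
  next
    case scale
    obtain x where x: "X = uq_of x" "x \<in> res" using scale(2) by (metis carrier_UresE)
    have "srep (uq_of (sc a * x)) i = scal (val a) (srep (uq_of x) i)"
      unfolding srep_uq_of urep_sc_mult
      by (rule poly_mapping_eqI) (simp add: value_at_mult[OF eps_neq_0] urep_integral x scale)
    thus ?thesis using scale(3) x by (simp add: lin_diff scal_simps uq_of_sc_mult)
  qed
qed

interpretation R: monoid_algebra_quotient_rep Ures "tensor_relators \<epsilon>" srep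
proof unfold_locales
  fix i
  show "srep \<one>\<^bsub>Ures\<^esub> i = single i 1"
    using srep_uq_of[of 1 i] by (simp add: urep_1 vmap_single uq_of_simps Ures_ops val_simps)
next
  fix X Y i assume "X \<in> carrier Ures" "Y \<in> carrier Ures"
  then obtain x y where xy: "X = uq_of x" "x \<in> res" "Y = uq_of y" "y \<in> res"
    by (metis carrier_UresE)
  have "srep (uq_of (x * y)) i = lin (srep (uq_of x)) (srep (uq_of y) i)"
    unfolding srep_uq_of urep_mult by (simp add: vmap_lin urep_integral xy srep_uq_of[abs_def])
  thus "srep (X \<otimes>\<^bsub>Ures\<^esub> Y) i = lin (srep X) (srep Y i)" using xy by (simp add: uq_of_simps Ures_ops)
qed (rule srep_relators)

definition fock_module :: "(ueps, fock) module"
  where "fock_module = \<lparr>carrier = UNIV, monoid.mult = (\<lambda>x y. x), one = 0, zero = 0, add = (+),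
    smult = (\<lambda>u v. lin (R.rep u) v)\<rparr>"

lemma fscale_eq: "fscale = scal"
  by (simp add: fun_eq_iff fscale_def scal_def)

lemma left_module_fock: "left_module U fock_module"
proof (intro left_module.intro left_module_axioms.intro)
  show "ring U" by (rule U.ring_axioms)
  show "abelian_group fock_module"
  proof (rule abelian_groupI)
    fix x :: fock
    show "\<exists>y\<in>carrier fock_module. y \<oplus>\<^bsub>fock_module\<^esub> x = \<zero>\<^bsub>fock_module\<^esub>"
      by (intro bexI[of _ "- x"]) (simp_all add: fock_module_def)
  qed (auto simp: fock_module_def ac_simps)
next
  fix a b x assume ab: "a \<in> carrier U" "b \<in> carrier U"
  have "R.rep (a \<oplus>\<^bsub>U\<^esub> b) = (\<lambda>i. R.rep a i + R.rep b i)"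
    using R.rep_add[of a b] ab by (simp add: fun_eq_iff U_eq)
  thus "(a \<oplus>\<^bsub>U\<^esub> b) \<odot>\<^bsub>fock_module\<^esub> x = a \<odot>\<^bsub>fock_module\<^esub> x \<oplus>\<^bsub>fock_module\<^esub> b \<odot>\<^bsub>fock_module\<^esub> x"
    by (simp add: fock_module_def lin_fun_add)
  have "R.rep (a \<otimes>\<^bsub>U\<^esub> b) = (\<lambda>i. lin (R.rep a) (R.rep b i))"
    using R.rep_mult[of a b] ab by (simp add: fun_eq_iff U_eq)
  thus "(a \<otimes>\<^bsub>U\<^esub> b) \<odot>\<^bsub>fock_module\<^esub> x = a \<odot>\<^bsub>fock_module\<^esub> (b \<odot>\<^bsub>fock_module\<^esub> x)"
    by (simp add: fock_module_def lin_lin)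
next
  fix x
  have "R.rep \<one>\<^bsub>U\<^esub> = (\<lambda>i. single i 1)" using R.rep_one by (simp add: fun_eq_iff U_eq)
  thus "\<one>\<^bsub>U\<^esub> \<odot>\<^bsub>fock_module\<^esub> x = x" by (simp add: fock_module_def lin_single_id)
qed (simp_all add: fock_module_def lin_add)

lemma smult_sp: "x \<in> res \<Longrightarrow> sp x \<odot>\<^bsub>fock_module\<^esub> single i 1 = vmap (urep x i)"
  by (simp add: fock_module_def tensor_eq R.rep_single uq_of_res scal_simps srep_uq_of)

lemma g_nat: "g (int m) (int n) = single (m, n) 1"
  by (simp add: g_def)

lemma vmap_0 [simp]: "vmap 0 = 0"
  by (rule poly_mapping_eqI) (simp add: val_simps)

theorem fock_module_exists: "is_fock_module \<epsilon> fock_module"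
  unfolding is_fock_module_def
proof (intro conjI allI impI)
  show "left_module U fock_module" by (rule left_module_fock)
  show "k c \<odot>\<^bsub>fock_module\<^esub> x = fscale c x" for c x
  proof -
    have "R.rep (k c) = (\<lambda>i. scal c (single i 1))"
      using R.rho_one by (simp add: fun_eq_iff tensor_eq R.rep_single one_Ures)
    thus ?thesis by (simp add: fock_module_def fscale_eq lin_fun_scal lin_single_id)
  qed
next
  fix r1 r2 :: int assume "r1 \<ge> 0" "r2 \<ge> 0"
  then obtain m n where mn: "r1 = int m" "r2 = int n" using that[of "nat r1" "nat r2"] by simp
  note simps = fscale_eq g_nat mn scal_simps vmap_single val_simps
  show "spec \<epsilon> (uq_gen K) \<odot>\<^bsub>fock_module\<^esub> g r1 r2 = fscale (\<epsilon> powi (- (r1 + r2 + 1))) (g r1 r2)"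
    using smult_sp[OF res_gK(1), of "(m, n)"] by (simp add: simps uq_of_gen urep_gen)
  show "spec \<epsilon> (uq_gen Kinv) \<odot>\<^bsub>fock_module\<^esub> g r1 r2 = fscale (\<epsilon> powi (r1 + r2 + 1)) (g r1 r2)"
    using smult_sp[OF res_gK(2), of "(m, n)"] by (simp add: simps uq_of_gen urep_gen)
  fix r :: nat assume "r \<ge> 1"
  have "spec \<epsilon> (uq_dpow E r) \<odot>\<^bsub>fock_module\<^esub> g r1 r2 = vmap (urep (dp E (int r)) (m, n))"
    using smult_sp[of "dp E (int r)" "(m, n)"] by (simp add: res_dp simps uq_of_dp)
  also have "\<dots> = fscale (qbinom_at \<epsilon> r2 (r2 - int r)) (g (r1 - int r) (r2 - int r))"
  proof (cases "r \<le> m \<and> r \<le> n")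
    case True
    hence d: "int m - int r = int (m - r)" "int n - int r = int (n - r)" by auto
    have "qbinom (int n) (int (n - r)) = qbinom (int n) (int r)"
      using qbinom_nat[of r "n - r"] qbinom_nat[of "n - r" r] True by (simp add: mult.commute)
    thus ?thesis using True unfolding mn d g_nat urep_dpE
      by (simp add: vmap_single fscale_eq scal_simps qbinom_at_def del: of_nat_diff)
  next
    case False
    have "qbinom (int n) (int r) = 0" if "n < r"
      using that by (auto simp: qbinom_def intro!: bexI[of _ n])
    hence "vmap (urep (dp E (int r)) (m, n)) = 0" using False by (auto simp: urep_dpE vmap_single val_simps)
    moreover have "g (r1 - int r) (r2 - int r) = 0" using False mn by (auto simp: g_def)
    ultimately show ?thesis by (simp add: fscale_eq scal_simps)
  qed
  finally show "spec \<epsilon> (uq_dpow E r) \<odot>\<^bsub>fock_module\<^esub> g r1 r2 =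
    fscale (qbinom_at \<epsilon> r2 (r2 - int r)) (g (r1 - int r) (r2 - int r))" .
  have "spec \<epsilon> (uq_dpow F r) \<odot>\<^bsub>fock_module\<^esub> g r1 r2 = vmap (urep (dp F (int r)) (m, n))"
    using smult_sp[of "dp F (int r)" "(m, n)"] by (simp add: res_dp simps uq_of_dp)
  also have "\<dots> = fscale ((- 1) ^ r * qbinom_at \<epsilon> (int r + r1) (int r)) (g (r1 + int r) (r2 + int r))"
  proof -
    have d: "int m + int r = int (m + r)" "int n + int r = int (n + r)" "int r + int m = int (r + m)" by auto
    have "val ((- 1) ^ r * qbinom (int (r + m)) (int r)) = (- 1) ^ r * val (qbinom (int (r + m)) (int r))"
      by (simp add: val_simps laurent_power laurent_m1 laurent_qbinom value_at_power[OF eps_neq_0] value_at_uminus[OF eps_neq_0] laurent_1)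
    thus ?thesis unfolding mn d g_nat urep_dpF vmap_single by (simp add: fscale_eq scal_simps qbinom_at_def)
  qed
  finally show "spec \<epsilon> (uq_dpow F r) \<odot>\<^bsub>fock_module\<^esub> g r1 r2 =
    fscale ((- 1) ^ r * qbinom_at \<epsilon> (int r + r1) (int r)) (g (r1 + int r) (r2 + int r))" .
qed (simp_all add: fock_module_def)

end

section \<open>Modules over the specialized algebra\<close>

locale ueps_module = odd_root_of_unity p \<epsilon> + left_module "Ueps \<epsilon>" M
  for p :: nat and \<epsilon> :: complex and M :: "(ueps, 'v) module"
begin

abbreviation app (infixr "\<bullet>" 75) where "u \<bullet> v \<equiv> u \<odot>\<^bsub>M\<^esub> v"
abbreviation mzero ("\<zero>m") where "\<zero>m \<equiv> \<zero>\<^bsub>M\<^esub>"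
abbreviation madd (infixl "+m" 65) where "x +m y \<equiv> x \<oplus>\<^bsub>M\<^esub> y"

lemma smult_mzero [simp]: assumes "u \<in> carrier U" shows "u \<bullet> \<zero>m = \<zero>m"
proof -
  have "u \<bullet> \<zero>m +m u \<bullet> \<zero>m = u \<bullet> \<zero>m"
    using smult_r_distr[OF assms M.zero_closed M.zero_closed] by simp
  thus ?thesis using M.add.l_cancel_one'[of "u \<bullet> \<zero>m" "u \<bullet> \<zero>m"] smult_closed[OF assms M.zero_closed]
    by (metis M.add.l_cancel_one)
qed

lemma zero_smult [simp]: assumes "v \<in> carrier M" shows "\<zero>\<^bsub>U\<^esub> \<bullet> v = \<zero>m"
proof -
  have "\<zero>\<^bsub>U\<^esub> \<bullet> v +m \<zero>\<^bsub>U\<^esub> \<bullet> v = \<zero>\<^bsub>U\<^esub> \<bullet> v"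
    using smult_l_distr[OF U.zero_closed U.zero_closed assms] by simp
  thus ?thesis using smult_closed[OF U.zero_closed assms] by (metis M.add.l_cancel_one)
qed

lemma sp_smult_closed [simp]: "x \<in> res \<Longrightarrow> v \<in> carrier M \<Longrightarrow> sp x \<bullet> v \<in> carrier M"
  by (simp add: smult_closed)

lemma k_smult_closed [simp]: "v \<in> carrier M \<Longrightarrow> k c \<bullet> v \<in> carrier M"
  by (simp add: smult_closed)

lemma k_k [simp]: "v \<in> carrier M \<Longrightarrow> k c \<bullet> k d \<bullet> v = k (c * d) \<bullet> v"
  by (simp add: k_mult smult_assoc)

lemma k_one [simp]: "v \<in> carrier M \<Longrightarrow> k 1 \<bullet> v = v"
  by (simp add: k_1 smult_one)

lemma k_zero [simp]: "v \<in> carrier M \<Longrightarrow> k 0 \<bullet> v = \<zero>m"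
  by (simp add: k_0)

lemma k_plus: "v \<in> carrier M \<Longrightarrow> k (c + d) \<bullet> v = k c \<bullet> v +m k d \<bullet> v"
  by (simp add: k_add smult_l_distr)

lemma sp_k: assumes "x \<in> res" "v \<in> carrier M" shows "sp x \<bullet> k c \<bullet> v = k c \<bullet> sp x \<bullet> v"
  using assms k_sp_commute[of x c] by (simp flip: smult_assoc)

lemma sp_times: "x \<in> res \<Longrightarrow> y \<in> res \<Longrightarrow> v \<in> carrier M \<Longrightarrow> sp (x * y) \<bullet> v = sp x \<bullet> sp y \<bullet> v"
  by (simp add: sp_mult smult_assoc)

lemma sp_plus: "x \<in> res \<Longrightarrow> y \<in> res \<Longrightarrow> v \<in> carrier M \<Longrightarrow> sp (x + y) \<bullet> v = sp x \<bullet> v +m sp y \<bullet> v"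
  by (simp add: sp_add smult_l_distr)

lemma sp_scale: "a \<in> laurent \<Longrightarrow> x \<in> res \<Longrightarrow> v \<in> carrier M \<Longrightarrow> sp (sc a * x) \<bullet> v = k (val a) \<bullet> sp x \<bullet> v"
  by (simp add: sp_sc_mult smult_assoc)

lemma sp_one [simp]: "v \<in> carrier M \<Longrightarrow> sp 1 \<bullet> v = v"
  by (simp add: sp_1 smult_one)

lemma sp_zero [simp]: "v \<in> carrier M \<Longrightarrow> sp 0 \<bullet> v = \<zero>m"
  by (simp add: sp_0)

lemma k_cancel: assumes "c \<noteq> 0" "v \<in> carrier M" "w \<in> carrier M" "k c \<bullet> v = k c \<bullet> w" shows "v = w"
proof -
  have "v = k (inverse c) \<bullet> k c \<bullet> v" using assms(1,2) by simp
  also have "\<dots> = k (inverse c) \<bullet> k c \<bullet> w" by (simp only: assms(4))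
  also have "\<dots> = w" using assms(1,3) by simp
  finally show ?thesis .
qed

lemma k_eq_zero: assumes "k c \<bullet> v = \<zero>m" "v \<in> carrier M" "v \<noteq> \<zero>m" shows "c = 0"
  using k_cancel[of c v "\<zero>m"] assms by auto

lemma uminus_k: assumes "v \<in> carrier M" shows "\<ominus>\<^bsub>M\<^esub> v = k (- 1) \<bullet> v"
proof -
  have "k (- 1) \<bullet> v +m v = \<zero>m" using k_plus[of v "-1" 1] assms by simp
  thus ?thesis using assms by (simp add: M.minus_equality)
qed

lemma res_dpE [simp]: "dp E n \<in> res" and res_dpF [simp]: "dp F n \<in> res"
  by (simp_all add: res_dp)

lemmas res_gens [simp] = res_gK res_KB

text \<open>
  For \<open>d\<close> as in \<open>exists_invertible_split\<close> this reduces divided powers to those of degree \<open>1\<close> and \<open>p\<close>.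
\<close>
lemma sp_dp_split:
  assumes "x \<in> {E, F}" "d \<le> r" "B (int r) d \<noteq> 0" "v \<in> carrier M"
  shows "sp (dp x (int r)) \<bullet> v = k (1 / B (int r) d) \<bullet> sp (dp x (int (r - d))) \<bullet> sp (dp x (int d)) \<bullet> v"
proof -
  have x: "dp x n \<in> res" for n using assms(1) by (rule res_dp)
  have "dp x (int (r - d)) * dp x (int d) = dp x (int d) * dp x (int (r - d))"
    by (simp add: dp_nat sc_normal power_add[symmetric] add.commute mult.commute)
  also have "\<dots> = sc (qbinom (int r) (int d)) * dp x (int r)"
    using dp_mult[of x d "r - d"] assms(2) by simp
  finally have "sp (dp x (int (r - d)) * dp x (int d)) \<bullet> v = sp (sc (qbinom (int r) (int d)) * dp x (int r)) \<bullet> v"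
    by simp
  hence "sp (dp x (int (r - d))) \<bullet> sp (dp x (int d)) \<bullet> v = k (B (int r) d) \<bullet> sp (dp x (int r)) \<bullet> v"
    by (simp add: sp_times sp_scale x assms(4) laurent_qbinom qbinom_at_def)
  thus ?thesis using assms x by simp
qed

lemma submoduleI_gens:
  assumes "N \<subseteq> carrier M" "\<zero>m \<in> N"
    and add: "\<And>x y. x \<in> N \<Longrightarrow> y \<in> N \<Longrightarrow> x +m y \<in> N"
    and const: "\<And>c x. x \<in> N \<Longrightarrow> k c \<bullet> x \<in> N"
    and K: "\<And>x. x \<in> N \<Longrightarrow> sp gK \<bullet> x \<in> N" and Kinv: "\<And>x. x \<in> N \<Longrightarrow> sp gK' \<bullet> x \<in> N"
    and E: "\<And>x. x \<in> N \<Longrightarrow> sp (dp E 1) \<bullet> x \<in> N" "\<And>x. x \<in> N \<Longrightarrow> sp (dp E (int p)) \<bullet> x \<in> N"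
    and F: "\<And>x. x \<in> N \<Longrightarrow> sp (dp F 1) \<bullet> x \<in> N" "\<And>x. x \<in> N \<Longrightarrow> sp (dp F (int p)) \<bullet> x \<in> N"
  shows "submodule N U M"
proof -
  have dp: "sp (dp y (int r)) \<bullet> x \<in> N" if "y \<in> {E, F}" "x \<in> N" for y r x
    using that
  proof (induction r arbitrary: x rule: less_induct)
    case (less r)
    show ?case
    proof (cases "r = 0")
      case True thus ?thesis using less.prems assms(1) by auto
    next
      case False
      then obtain d where d: "d \<in> {1, p}" "d \<le> r" "B (int r) d \<noteq> 0"
        using exists_invertible_split[of r] by auto
      have dx: "sp (dp y (int d)) \<bullet> x \<in> N" using d(1) less.prems E F by auto
      have "r - d < r" using d p_gt_1 False by auto
      hence "sp (dp y (int (r - d))) \<bullet> sp (dp y (int d)) \<bullet> x \<in> N"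
        by (rule less.IH[OF _ less.prems(1) dx])
      thus ?thesis using sp_dp_split[OF less.prems(1) d(2,3)] const less.prems(2) assms(1) by auto
    qed
  qed
  have closed: "u \<bullet> x \<in> N" if "u \<in> carrier U" "x \<in> N" for u x
    using that
  proof (induction u arbitrary: x rule: Ueps_induct)
    case (add u v)
    have "u \<bullet> x \<in> N" "v \<bullet> x \<in> N" by (rule add.IH[OF add.prems])+
    hence "u \<bullet> x +m v \<bullet> x \<in> N" by (rule assms(3))
    thus ?case using add.hyps smult_l_distr add.prems assms(1) by (simp only: subsetD)
  next
    case (mult u v)
    have "u \<bullet> v \<bullet> x \<in> N" by (rule mult.IH(1)[OF mult.IH(2)[OF mult.prems]])
    thus ?case using mult.hyps smult_assoc mult.prems assms(1) by (simp only: subsetD)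
  next
    case const thus ?case by (rule assms(4))
  next
    case K thus ?case by (rule assms(5))
  next
    case Kinv thus ?case by (rule assms(6))
  qed (simp_all add: dp)
  have inv: "\<ominus>\<^bsub>M\<^esub> x \<in> N" if "x \<in> N" for x
    using that uminus_k[of x] const assms(1) by auto
  show ?thesis
  proof (intro submodule.intro submodule_axioms.intro)
    show "subgroup N (add_monoid M)"
      by (rule M.add.subgroupI) (use assms(1,2) add inv in auto)
  qed (rule closed)
qed

section \<open>Weight vectors\<close>

definition weight_vector :: "int \<Rightarrow> 'v \<Rightarrow> bool"
  where "weight_vector n w \<longleftrightarrow> w \<in> carrier M \<and> sp gK \<bullet> w = k (\<epsilon> powi n) \<bullet> w \<and>
    sp (KB 0 p) \<bullet> w = k (B n p) \<bullet> w"

lemma weight_space_iff: "w \<in> weight_space p \<epsilon> M n \<longleftrightarrow> weight_vector n w"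
  by (auto simp: weight_space_def weight_vector_def uq_of_gen uq_of_KB)

lemma weight_vector_closed: "weight_vector n w \<Longrightarrow> w \<in> carrier M"
  by (simp add: weight_vector_def)

lemma weight_vector_Kinv: assumes "weight_vector n w" shows "sp gK' \<bullet> w = k (\<epsilon> powi (- n)) \<bullet> w"
proof -
  have w: "w \<in> carrier M" "sp gK \<bullet> w = k (\<epsilon> powi n) \<bullet> w" using assms by (auto simp: weight_vector_def)
  have "k (\<epsilon> powi n) \<bullet> sp gK' \<bullet> w = sp gK' \<bullet> sp gK \<bullet> w" using w by (simp add: sp_k)
  also have "\<dots> = sp (gK' * gK) \<bullet> w" using w(1) by (simp add: sp_times)
  also have "\<dots> = w" using w(1) by (simp add: gK_gK')
  finally have "k (\<epsilon> powi (- n)) \<bullet> k (\<epsilon> powi n) \<bullet> sp gK' \<bullet> w = k (\<epsilon> powi (- n)) \<bullet> w" by simp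
  thus ?thesis using w eps_neq_0 by (simp add: power_int_minus)
qed

lemma KB_1: "KB c 1 = Kb c"
  by simp

text \<open>
  The coefficients of \<open>K\<close> and \<open>K\<inverse>\<close> in \<open>[K; c]\<close> are not Laurent polynomials. They become so after
  multiplication by \<open>q - q\<inverse>\<close>, whose value at \<open>\<epsilon>\<close> is nonzero and can be cancelled.
\<close>
lemma weight_vector_Kb: assumes "weight_vector n w" shows "sp (KB c 1) \<bullet> w = k (B (n + c) 1) \<bullet> w"
proof -
  have w: "w \<in> carrier M" "sp gK \<bullet> w = k (\<epsilon> powi n) \<bullet> w" using assms by (auto simp: weight_vector_def)
  have l: "qdiff \<in> laurent" by (simp add: qdiff_def laurent_diff laurent_q laurent_q_inverse)
  have v: "val qdiff = \<epsilon> - inverse \<epsilon>"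
    by (simp add: qdiff_def val_simps laurent_q laurent_q_inverse value_at_q[OF eps_neq_0] value_at_q_inverse[OF eps_neq_0])
  have "sc qdiff * KB c 1 = sc (q powi c) * gK + sc (- (q powi (- c))) * gK'"
    unfolding KB_1 using qdiff_neq_0
    by (simp add: Kb_def right_diff_distrib sc_sc_mult sc_uminus)
  hence "sp (sc qdiff * KB c 1) \<bullet> w = sp (sc (q powi c) * gK + sc (- (q powi (- c))) * gK') \<bullet> w" by simp
  hence "k (val qdiff) \<bullet> sp (KB c 1) \<bullet> w = k (\<epsilon> powi c * \<epsilon> powi n) \<bullet> w +m k (- (\<epsilon> powi (- c)) * \<epsilon> powi (- n)) \<bullet> w"
    using w weight_vector_Kinv[OF assms]
    by (simp add: sp_plus sp_scale res_mult res_sc laurent_q_powi laurent_uminus l val_simps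
        value_at_uminus[OF eps_neq_0] del: KB.simps One_nat_def)
  also have "\<dots> = k (\<epsilon> powi (n + c) - \<epsilon> powi (- (n + c))) \<bullet> w"
  proof -
    have "\<epsilon> powi c * \<epsilon> powi n = \<epsilon> powi (n + c)" "\<epsilon> powi (- c) * \<epsilon> powi (- n) = \<epsilon> powi (- (n + c))"
      using eps_neq_0 by (simp_all add: power_int_add[symmetric] add.commute)
    thus ?thesis using w by (simp add: k_plus[symmetric])
  qed
  also have "\<epsilon> powi (n + c) - \<epsilon> powi (- (n + c)) = val qdiff * B (n + c) 1"
    using eps_diff_neq_0 unfolding v qbinom_at_def by (simp add: qbinom_1 val_qint)
  also have "k (val qdiff * B (n + c) 1) \<bullet> w = k (val qdiff) \<bullet> k (B (n + c) 1) \<bullet> w" using w by simp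
  finally have e: "k (val qdiff) \<bullet> sp (KB c 1) \<bullet> w = k (val qdiff) \<bullet> k (B (n + c) 1) \<bullet> w" .
  show ?thesis
    by (rule k_cancel[OF _ _ _ e]) (use w eps_diff_neq_0 in \<open>simp_all add: v del: KB.simps\<close>)
qed

lemma weight_vector_KB_add:
  assumes w: "w \<in> carrier M" and a: "\<And>c. sp (KB c a) \<bullet> w = k (B (n + c) a) \<bullet> w"
    and b: "\<And>c. sp (KB c b) \<bullet> w = k (B (n + c) b) \<bullet> w" and nz: "B (int (a + b)) a \<noteq> 0"
  shows "sp (KB c (a + b)) \<bullet> w = k (B (n + c) (a + b)) \<bullet> w"
proof -
  have "k (B (int (a + b)) a) \<bullet> sp (KB c (a + b)) \<bullet> w = sp (KB c a * KB (c - int a) b) \<bullet> w"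
    unfolding KB_mult using w by (simp add: sp_scale laurent_qbinom qbinom_at_def)
  also have "\<dots> = k (B (n + (c - int a)) b) \<bullet> k (B (n + c) a) \<bullet> w"
    using w by (simp add: sp_times a b sp_k)
  also have "\<dots> = k (B (n + c) a * B ((n + c) - int a) b) \<bullet> w"
    using w by (simp add: algebra_simps)
  also have "\<dots> = k (B (int (a + b)) a) \<bullet> k (B (n + c) (a + b)) \<bullet> w"
    unfolding B_mult using w by simp
  finally show ?thesis by (rule k_cancel[OF nz, rotated 2]) (simp_all add: w)
qed

text \<open>
  Below degree \<open>p\<close> the element \<open>[K; c; t]\<close> is a multiple of a product of elements \<open>[K; c']\<close> also at
  \<open>q = \<epsilon>\<close>, and hence determined by \<open>K\<close>.
\<close>
lemma weight_vector_KB_small: assumes "weight_vector n w" "t < p"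
  shows "sp (KB c t) \<bullet> w = k (B (n + c) t) \<bullet> w"
  using assms(2)
proof (induction t arbitrary: c)
  case 0 thus ?case using weight_vector_closed[OF assms(1)] by simp
next
  case (Suc t)
  have "B (int (t + 1)) t \<noteq> 0"
    using B_eq_0_iff[of t "t + 1"] Suc.prems by simp
  hence "sp (KB c (t + 1)) \<bullet> w = k (B (n + c) (t + 1)) \<bullet> w"
    using weight_vector_KB_add[of w t n 1] Suc.IH Suc.prems weight_vector_Kb[OF assms(1)] weight_vector_closed[OF assms(1)]
    by (simp del: KB.simps)
  thus ?case by simp
qed

lemma B_Pascal: "B (n + 1) (Suc t) = \<epsilon> powi (int (Suc t)) * B n (Suc t) + \<epsilon> powi (int t - n) * B n t"
  unfolding qbinom_at_def qbinom_Pascal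
  by (simp only: val_simps laurent_mult laurent_q_powi laurent_qbinom)

text \<open>
  Both sides satisfy the same Pascal recursion in \<open>c\<close>, and for \<open>c = 0\<close> they agree by the definition
  of a weight vector.
\<close>
lemma weight_vector_KB_p: assumes "weight_vector n w"
  shows "sp (KB c p) \<bullet> w = k (B (n + c) p) \<bullet> w"
proof -
  have w: "w \<in> carrier M" using assms by (rule weight_vector_closed)
  obtain t where t: "p = Suc t" using p_gt_1 by (cases p) auto
  have step: "sp (KB (c + 1) p) \<bullet> w = sp (KB c p) \<bullet> w +m k (\<epsilon> powi (int t - (n + c)) * B (n + c) t) \<bullet> w"
    "k (B (n + (c + 1)) p) \<bullet> w = k (B (n + c) p) \<bullet> w +m k (\<epsilon> powi (int t - (n + c)) * B (n + c) t) \<bullet> w" for c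
  proof -
    \<comment> \<open>The coefficient \<open>q\<^sup>p\<close> in Pascal's rule becomes \<open>1\<close>.\<close>
    have e: "\<epsilon> powi (int (Suc t)) = 1" using eps_p t by (simp only: power_int_of_nat)
    have "sp (KB (c + 1) p) \<bullet> w = k (\<epsilon> powi (int (Suc t))) \<bullet> sp (KB c p) \<bullet> w +m k (\<epsilon> powi (int t - c)) \<bullet> sp gK' \<bullet> sp (KB c t) \<bullet> w"
      unfolding t KB_Pascal using w
      by (simp add: sp_plus sp_sc sp_times res_mult res_sc laurent_q_powi val_simps del: KB.simps of_nat_Suc power_int_of_nat)
    also have "sp gK' \<bullet> sp (KB c t) \<bullet> w = k (B (n + c) t * \<epsilon> powi (- n)) \<bullet> w"
      using w weight_vector_KB_small[OF assms, of t c] weight_vector_Kinv[OF assms] t by (simp add: sp_k)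
    also have "k (\<epsilon> powi (int t - c)) \<bullet> k (B (n + c) t * \<epsilon> powi (- n)) \<bullet> w = k (\<epsilon> powi (int t - (n + c)) * B (n + c) t) \<bullet> w"
    proof -
      have "\<epsilon> powi (int t - c) * \<epsilon> powi (- n) = \<epsilon> powi (int t - (n + c))"
        using eps_neq_0 by (simp add: power_int_add[symmetric] algebra_simps)
      hence e': "\<epsilon> powi (int t - c) * (B (n + c) t * \<epsilon> powi (- n)) = \<epsilon> powi (int t - (n + c)) * B (n + c) t"
        by (metis mult.assoc mult.commute)
      show ?thesis unfolding k_k[OF w] e' ..
    qed
    finally show "sp (KB (c + 1) p) \<bullet> w = sp (KB c p) \<bullet> w +m k (\<epsilon> powi (int t - (n + c)) * B (n + c) t) \<bullet> w"
      using w by (simp only: e k_one sp_smult_closed res_gens)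
    have "B (n + (c + 1)) p = B (n + c) p + \<epsilon> powi (int t - (n + c)) * B (n + c) t"
      using B_Pascal[of "n + c" t] by (simp only: t e mult_1_left add.assoc)
    thus "k (B (n + (c + 1)) p) \<bullet> w = k (B (n + c) p) \<bullet> w +m k (\<epsilon> powi (int t - (n + c)) * B (n + c) t) \<bullet> w"
      using w by (simp only: k_plus)
  qed
  show ?thesis
  proof (induction c rule: int_induct[where k = 0])
    case base show ?case using assms by (simp add: weight_vector_def)
  next
    case (step1 c) thus ?case by (simp only: step)
  next
    case (step2 c)
    have "sp (KB (c - 1) p) \<bullet> w +m k (\<epsilon> powi (int t - (n + (c - 1))) * B (n + (c - 1)) t) \<bullet> w
      = k (B (n + (c - 1)) p) \<bullet> w +m k (\<epsilon> powi (int t - (n + (c - 1))) * B (n + (c - 1)) t) \<bullet> w"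
      using step[of "c - 1"] step2 by simp
    thus ?case using w by (subst (asm) M.add.right_cancel) simp_all
  qed
qed

lemma gK_dpF: "gK * dp F (int r) = sc (q powi (- 2 * int r)) * dp F (int r) * gK"
proof -
  have "gK * gF ^ r = sc ((inverse q ^ 2) ^ r) * gF ^ r * gK"
  proof (induction r)
    case 0 show ?case by simp
  next
    case (Suc r)
    have c: "gF ^ Suc r = gF ^ r * gF" by (simp add: power_commutes)
    have "gK * gF ^ Suc r = sc ((inverse q ^ 2) ^ r) * gF ^ r * (gK * gF)"
      unfolding c mult.assoc[symmetric] Suc.IH ..
    also have "\<dots> = sc ((inverse q ^ 2) ^ r * inverse q ^ 2) * (gF ^ r * gF * gK)"
      unfolding gK_gF by (simp add: sc_normal)
    finally show ?case by (simp only: c mult.assoc power_Suc2)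
  qed
  moreover have "(inverse q ^ 2) ^ r = q powi (- 2 * int r)"
    by (simp add: power_mult[symmetric] power_int_def nat_mult_distrib)
  ultimately show ?thesis by (simp add: dp_nat sc_normal mult.commute)
qed

lemma weight_vector_dpF: assumes "weight_vector n w" shows "weight_vector (n - 2 * int r) (sp (dp F (int r)) \<bullet> w)"
proof -
  have w: "w \<in> carrier M" "sp gK \<bullet> w = k (\<epsilon> powi n) \<bullet> w" using assms by (auto simp: weight_vector_def)
  have "sp gK \<bullet> sp (dp F (int r)) \<bullet> w = sp (sc (q powi (- 2 * int r)) * (dp F (int r) * gK)) \<bullet> w"
    using w gK_dpF[of r] by (simp add: sp_times[symmetric] mult.assoc)
  also have "\<dots> = k (\<epsilon> powi (- 2 * int r) * \<epsilon> powi n) \<bullet> sp (dp F (int r)) \<bullet> w"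
    using w by (simp add: sp_scale laurent_q_powi res_mult val_simps sp_times sp_k)
  also have "\<epsilon> powi (- 2 * int r) * \<epsilon> powi n = \<epsilon> powi (n - 2 * int r)"
    using eps_neq_0 by (simp add: power_int_add[symmetric])
  finally have 1: "sp gK \<bullet> sp (dp F (int r)) \<bullet> w = k (\<epsilon> powi (n - 2 * int r)) \<bullet> sp (dp F (int r)) \<bullet> w" .
  have "sp (KB 0 p) \<bullet> sp (dp F (int r)) \<bullet> w = sp (dp F (int r)) \<bullet> sp (KB (0 - 2 * int r) p) \<bullet> w"
    using w KB_dpF[of 0 p r] by (simp add: sp_times[symmetric])
  also have "\<dots> = k (B (n - 2 * int r) p) \<bullet> sp (dp F (int r)) \<bullet> w"
    using w weight_vector_KB_p[OF assms] by (simp add: sp_k)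
  finally show ?thesis using 1 w by (simp add: weight_vector_def)
qed

end

section \<open>Highest weight vectors\<close>

context ueps_module
begin

definition hw_vector :: "int \<Rightarrow> 'v \<Rightarrow> bool"
  where "hw_vector n w \<longleftrightarrow> weight_vector n w \<and>
    sp (dp E 1) \<bullet> w = \<zero>m \<and> sp (dp E (int p)) \<bullet> w = \<zero>m"

lemma hw_vector_closed: "hw_vector n w \<Longrightarrow> w \<in> carrier M"
  unfolding hw_vector_def using weight_vector_closed by blast

lemma hw_vector_E: assumes "hw_vector n w" "r \<ge> 1" shows "sp (dp E (int r)) \<bullet> w = \<zero>m"
proof -
  have w: "w \<in> carrier M" using assms(1) by (rule hw_vector_closed)
  obtain d where d: "d \<in> {1, p}" "d \<le> r" "B (int r) d \<noteq> 0" using exists_invertible_split[OF assms(2)] .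
  have "sp (dp E (int d)) \<bullet> w = \<zero>m" using d(1) assms(1) by (auto simp: hw_vector_def)
  thus ?thesis using sp_dp_split[of E d r w] d w by simp
qed

lemma sp_sum_zero:
  fixes x :: "nat \<Rightarrow> uqt"
  assumes "v \<in> carrier M" "\<And>i. i < n \<Longrightarrow> x i \<in> res \<and> sp (x i) \<bullet> v = \<zero>m"
  shows "(\<Sum>i<n. x i) \<in> res \<and> sp (\<Sum>i<n. x i) \<bullet> v = \<zero>m"
  using assms(2)
proof (induction n)
  case 0 show ?case using assms(1) by (simp add: res_0)
next
  case (Suc n)
  have "(\<Sum>i<n. x i) \<in> res \<and> sp (\<Sum>i<n. x i) \<bullet> v = \<zero>m" using Suc by simp
  moreover have "x n \<in> res \<and> sp (x n) \<bullet> v = \<zero>m" using Suc.prems[of n] by simp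
  ultimately show ?case using assms(1) by (simp add: res_add sp_plus)
qed

text \<open>
  Every term of Kac's formula except the last one ends with some \<open>e\<^bsup>(i)\<^esup>\<close>, \<open>i \<ge> 1\<close>, which is
  applied to \<open>w\<close> first.
\<close>
lemma E_F_on_killed:
  assumes w: "w \<in> carrier M" and E: "\<And>i. 1 \<le> i \<Longrightarrow> i \<le> r \<Longrightarrow> sp (dp E (int i)) \<bullet> w = \<zero>m"
  shows "sp (dp E (int r)) \<bullet> sp (dp F n) \<bullet> w = sp (dp F (n - int r)) \<bullet> sp (KB (int r - n) r) \<bullet> w"
proof -
  let ?T = "\<lambda>t. dp F (n - int t) * KB (2 * int t - int r - n) t * dp E (int r - int t)"
  have "sp (?T t) \<bullet> w = \<zero>m" if "t < r" for t
  proof -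
    have i: "int r - int t = int (r - t)" using that by simp
    have "sp (dp E (int r - int t)) \<bullet> w = \<zero>m" unfolding i by (rule E) (use that in auto)
    thus ?thesis using w by (simp add: sp_times res_mult)
  qed
  hence z: "(\<Sum>t<r. ?T t) \<in> res \<and> sp (\<Sum>t<r. ?T t) \<bullet> w = \<zero>m"
    by (intro sp_sum_zero w) (simp add: res_mult)
  have "sp (dp E (int r)) \<bullet> sp (dp F n) \<bullet> w = sp (dp E (int r) * dp F n) \<bullet> w" using w by (simp add: sp_times)
  also have "dp E (int r) * dp F n = (\<Sum>t<r. ?T t) + ?T r" by (simp add: Kac lessThan_Suc_atMost[symmetric])
  also have "sp ((\<Sum>t<r. ?T t) + ?T r) \<bullet> w = sp (?T r) \<bullet> w"
    using z w by (simp add: sp_plus res_mult)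
  also have "\<dots> = sp (dp F (n - int r)) \<bullet> sp (KB (int r - n) r) \<bullet> w"
    using w by (simp add: sp_times res_mult)
  finally show ?thesis .
qed

text \<open>
  The linear span of the vectors \<open>f\<^bsup>(a)\<^esup> w\<close>.
\<close>
inductive_set lspan :: "'v \<Rightarrow> 'v set" for w
  where
    zero: "\<zero>m \<in> lspan w"
  | step: "x \<in> lspan w \<Longrightarrow> x +m k c \<bullet> sp (dp F (int a)) \<bullet> w \<in> lspan w"

lemma lspan_closed: assumes "w \<in> carrier M" "x \<in> lspan w" shows "x \<in> carrier M"
  using assms(2) by induction (simp_all add: assms(1))

lemma lspan_add: assumes "w \<in> carrier M" "x \<in> lspan w" "y \<in> lspan w" shows "x +m y \<in> lspan w"
  using assms(3)
proof induction
  case zero thus ?case using assms(2) lspan_closed[OF assms(1)] by simp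
next
  case (step y c a)
  have "x +m (y +m k c \<bullet> sp (dp F (int a)) \<bullet> w) = x +m y +m k c \<bullet> sp (dp F (int a)) \<bullet> w"
    using assms(1,2) step lspan_closed[OF assms(1)] by (simp add: M.a_assoc)
  thus ?case using lspan.step[OF step.IH] by simp
qed

lemma lspan_single: assumes "w \<in> carrier M" shows "k c \<bullet> sp (dp F (int a)) \<bullet> w \<in> lspan w"
  using lspan.step[OF lspan.zero, where w = w and c = c and a = a] assms by simp

lemma lspan_op:
  assumes "w \<in> carrier M" "u \<in> carrier U"
    and "\<And>c a. u \<bullet> k c \<bullet> sp (dp F (int a)) \<bullet> w \<in> lspan w" and "x \<in> lspan w"
  shows "u \<bullet> x \<in> lspan w"
  using assms(4)
proof induction
  case zero show ?case using assms(2) by (simp add: lspan.zero)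
next
  case (step x c a)
  have "u \<bullet> (x +m k c \<bullet> sp (dp F (int a)) \<bullet> w) = u \<bullet> x +m u \<bullet> k c \<bullet> sp (dp F (int a)) \<bullet> w"
    using assms(1,2) step lspan_closed[OF assms(1)] by (simp add: smult_r_distr)
  thus ?case using lspan_add[OF assms(1) step.IH assms(3)] by simp
qed

text \<open>
  Only \<open>e\<close> and \<open>e\<^bsup>(p)\<^esup>\<close> need an argument: by \<open>E_F_on_killed\<close> they send \<open>f\<^bsup>(a)\<^esup> w\<close> to a multiple of
  \<open>f\<^bsup>(a - 1)\<^esup> w\<close> and \<open>f\<^bsup>(a - p)\<^esup> w\<close>, because Cartan elements act on \<open>w\<close> by scalars.
\<close>
lemma lspan_submodule: assumes hw: "hw_vector n w" shows "submodule (lspan w) U M"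
proof -
  have w: "w \<in> carrier M" "weight_vector n w" using hw by (auto simp: hw_vector_def weight_vector_closed)
  have K: "sp gK \<bullet> k c \<bullet> sp (dp F (int a)) \<bullet> w \<in> lspan w" for c a
    using weight_vector_dpF[OF w(2), of a] w(1) lspan_single by (simp add: weight_vector_def sp_k)
  have Kinv: "sp gK' \<bullet> k c \<bullet> sp (dp F (int a)) \<bullet> w \<in> lspan w" for c a
    using weight_vector_Kinv[OF weight_vector_dpF[OF w(2), of a]] w(1) lspan_single by (simp add: sp_k)
  have F: "sp (dp F (int r)) \<bullet> k c \<bullet> sp (dp F (int a)) \<bullet> w \<in> lspan w" for c a r
  proof -
    have "sp (dp F (int r)) \<bullet> sp (dp F (int a)) \<bullet> w = k (B (int (r + a)) r) \<bullet> sp (dp F (int (r + a))) \<bullet> w"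
      using w(1) by (simp add: sp_times[symmetric] dp_mult del: of_nat_add) (simp add: sp_scale laurent_qbinom qbinom_at_def del: of_nat_add)
    thus ?thesis using w(1) lspan_single by (simp add: sp_k del: of_nat_add)
  qed
  have E: "sp (dp E (int r)) \<bullet> k c \<bullet> sp (dp F (int a)) \<bullet> w \<in> lspan w" if r: "r \<in> {1, p}" for c a r
  proof -
    have "sp (KB (int r - int a) r) \<bullet> w = k (B (n + (int r - int a)) r) \<bullet> w"
      using r weight_vector_Kb[OF w(2)] weight_vector_KB_p[OF w(2)] by auto
    hence e: "sp (dp E (int r)) \<bullet> k c \<bullet> sp (dp F (int a)) \<bullet> w =
        k (c * B (n + (int r - int a)) r) \<bullet> sp (dp F (int a - int r)) \<bullet> w"
      using E_F_on_killed[OF w(1), of r "int a"] hw_vector_E[OF hw] w(1) by (simp add: sp_k)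
    show ?thesis
    proof (cases "r \<le> a")
      case True
      hence i: "int a - int r = int (a - r)" by simp
      show ?thesis unfolding e i using lspan_single[OF w(1)] .
    next
      case False
      \<comment> \<open>The divided power of \<open>f\<close> has negative degree.\<close>
      thus ?thesis unfolding e using w(1) by (simp add: lspan.zero)
    qed
  qed
  show ?thesis
  proof (rule submoduleI_gens)
    show "lspan w \<subseteq> carrier M" using lspan_closed[OF w(1)] by blast
    show "\<zero>m \<in> lspan w" by (rule lspan.zero)
    show "x +m y \<in> lspan w" if "x \<in> lspan w" "y \<in> lspan w" for x y using lspan_add[OF w(1)] that .
    show "k c \<bullet> x \<in> lspan w" if "x \<in> lspan w" for c x
      by (rule lspan_op[OF w(1) k_closed _ that]) (use w(1) lspan_single in simp)
    show "sp gK \<bullet> x \<in> lspan w" if "x \<in> lspan w" for x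
      by (rule lspan_op[OF w(1) _ K that]) simp
    show "sp gK' \<bullet> x \<in> lspan w" if "x \<in> lspan w" for x
      by (rule lspan_op[OF w(1) _ Kinv that]) simp
    show "sp (dp E 1) \<bullet> x \<in> lspan w" if "x \<in> lspan w" for x
      by (rule lspan_op[OF w(1) _ E[of 1, simplified] that]) simp
    show "sp (dp E (int p)) \<bullet> x \<in> lspan w" if "x \<in> lspan w" for x
      by (rule lspan_op[OF w(1) _ E[of p, simplified] that]) simp
    show "sp (dp F 1) \<bullet> x \<in> lspan w" if "x \<in> lspan w" for x
      by (rule lspan_op[OF w(1) _ F[of 1, simplified] that]) simp
    show "sp (dp F (int p)) \<bullet> x \<in> lspan w" if "x \<in> lspan w" for x
      by (rule lspan_op[OF w(1) _ F that]) simp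
  qed
qed

lemma submodule_smult: "submodule N U M \<Longrightarrow> u \<in> carrier U \<Longrightarrow> x \<in> N \<Longrightarrow> u \<bullet> x \<in> N"
  by (simp add: submodule.smult_closed)

lemma generated_in_lspan: assumes hw: "hw_vector n w" and "u \<in> carrier U" shows "u \<bullet> w \<in> lspan w"
proof -
  have w: "w \<in> carrier M" using hw by (rule hw_vector_closed)
  have "w \<in> lspan w" using lspan_single[OF w, of 1 0] w by simp
  thus ?thesis using submodule_smult[OF lspan_submodule[OF hw] assms(2)] by blast
qed

text \<open>
  The operator \<open>kill_weight n a\<close> annihilates vectors of weight \<open>n - 2 a\<close>, and multiplies vectors of
  weight \<open>m\<close> by \<open>kill_factor n a m\<close>. It is built from \<open>K\<close> unless \<open>p\<close> divides \<open>a\<close>, where \<open>K\<close> has the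
  same eigenvalue for the weights \<open>n\<close> and \<open>n - 2 a\<close>, and \<open>[K; 0; p]\<close> must be used.
\<close>
definition kill_factor :: "int \<Rightarrow> nat \<Rightarrow> int \<Rightarrow> complex"
  where "kill_factor n a m = (if p dvd a then B m p - B (n - 2 * int a) p else \<epsilon> powi m - \<epsilon> powi (n - 2 * int a))"

definition kill_weight :: "int \<Rightarrow> nat \<Rightarrow> 'v \<Rightarrow> 'v"
  where "kill_weight n a x = (if p dvd a then sp (KB 0 p) \<bullet> x +m k (- B (n - 2 * int a) p) \<bullet> x
    else sp gK \<bullet> x +m k (- (\<epsilon> powi (n - 2 * int a))) \<bullet> x)"

lemma kill_weight_closed: "x \<in> carrier M \<Longrightarrow> kill_weight n a x \<in> carrier M"
  by (simp add: kill_weight_def)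

lemma kill_weight_add: "x \<in> carrier M \<Longrightarrow> y \<in> carrier M \<Longrightarrow> kill_weight n a (x +m y) = kill_weight n a x +m kill_weight n a y"
  by (simp add: kill_weight_def smult_r_distr M.a_ac)

lemma kill_weight_k: "x \<in> carrier M \<Longrightarrow> kill_weight n a (k c \<bullet> x) = k c \<bullet> kill_weight n a x"
  by (simp add: kill_weight_def smult_r_distr sp_k mult.commute)

lemma kill_weight_weight: assumes "weight_vector m x" shows "kill_weight n a x = k (kill_factor n a m) \<bullet> x"
  using assms k_plus[of x "B m p" "- B (n - 2 * int a) p"] k_plus[of x "\<epsilon> powi m" "- (\<epsilon> powi (n - 2 * int a))"]
  by (auto simp: weight_vector_def kill_weight_def kill_factor_def)

lemma kill_factor_same: "kill_factor n a (n - 2 * int a) = 0"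
  by (simp add: kill_factor_def)

lemma kill_factor_neq_0: assumes "a \<ge> 1" shows "kill_factor n a n \<noteq> 0"
proof (cases "p dvd a")
  case True
  then obtain b where b: "a = p * b" by blast
  have "(n - 2 * int a) div int p = n div int p - 2 * int b"
  proof -
    have "n - 2 * int a = n + int p * (- 2 * int b)" by (simp add: b)
    thus ?thesis using p_gt_1 by (simp only: div_mult_self2)
  qed
  thus ?thesis using True assms b by (simp add: kill_factor_def B_p)
next
  case False
  have "\<not> int p dvd n - (n - 2 * int a)"
    using False p_dvd_2_mult[of "int a"] by simp
  thus ?thesis using False by (simp add: kill_factor_def eps_powi_eq_iff)
qed

text \<open>
  Annihilates the weights \<open>n - 2, \<dots>, n - 2 N\<close>. On weight \<open>n\<close> it is a nonzero scalar rather than the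
  identity, so it is a projection only up to normalization.
\<close>
primrec weight_proj :: "int \<Rightarrow> nat \<Rightarrow> 'v \<Rightarrow> 'v"
  where "weight_proj n 0 x = x"
  | "weight_proj n (Suc N) x = kill_weight n (Suc N) (weight_proj n N x)"

lemma weight_proj_closed: "x \<in> carrier M \<Longrightarrow> weight_proj n N x \<in> carrier M"
  by (induction N) (simp_all add: kill_weight_closed)

lemma weight_proj_add: "x \<in> carrier M \<Longrightarrow> y \<in> carrier M \<Longrightarrow> weight_proj n N (x +m y) = weight_proj n N x +m weight_proj n N y"
  by (induction N) (simp_all add: kill_weight_add weight_proj_closed)

lemma weight_proj_k: "x \<in> carrier M \<Longrightarrow> weight_proj n N (k c \<bullet> x) = k c \<bullet> weight_proj n N x"
  by (induction N) (simp_all add: kill_weight_k weight_proj_closed)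

lemma weight_proj_weight: assumes "weight_vector m x"
  shows "weight_proj n N x = k (\<Prod>a=1..N. kill_factor n a m) \<bullet> x"
proof (induction N)
  case 0 show ?case using weight_vector_closed[OF assms] by simp
next
  case (Suc N)
  thus ?case using weight_vector_closed[OF assms] kill_weight_weight[OF assms]
    by (simp add: kill_weight_k mult.commute)
qed

lemma weight_proj_lspan:
  assumes w: "weight_vector n w" and "x \<in> lspan w"
  shows "\<exists>c N0. \<forall>N\<ge>N0. weight_proj n N x = k c \<bullet> weight_proj n N w"
  using assms(2)
proof induction
  case zero
  have "weight_proj n N \<zero>m = \<zero>m" for N
    using weight_proj_k[of w n N 0] weight_vector_closed[OF w] weight_proj_closed[of w n N] by simp
  thus ?case using weight_vector_closed[OF w] by (intro exI[of _ 0]) (simp add: weight_proj_closed)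
next
  case (step x c a)
  have wc: "w \<in> carrier M" using w by (rule weight_vector_closed)
  have xc: "x \<in> carrier M" by (rule lspan_closed[OF wc step.hyps])
  obtain c0 N0 where IH: "\<forall>N\<ge>N0. weight_proj n N x = k c0 \<bullet> weight_proj n N w" using step.IH by blast
  show ?case
  proof (cases "a = 0")
    case True
    have "weight_proj n N (x +m k c \<bullet> sp (dp F (int a)) \<bullet> w) = k (c0 + c) \<bullet> weight_proj n N w" if "N \<ge> N0" for N
      using True IH that wc xc by (simp add: weight_proj_add weight_proj_k k_plus weight_proj_closed)
    thus ?thesis by blast
  next
    case False
    have "weight_proj n N (x +m k c \<bullet> sp (dp F (int a)) \<bullet> w) = k c0 \<bullet> weight_proj n N w" if "N \<ge> max N0 a" for N
    proof -
      have "(\<Prod>b=1..N. kill_factor n b (n - 2 * int a)) = 0"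
        using False that kill_factor_same[of n a] by (intro prod_zero bexI[of _ a]) auto
      hence "weight_proj n N (sp (dp F (int a)) \<bullet> w) = k 0 \<bullet> sp (dp F (int a)) \<bullet> w"
        by (simp only: weight_proj_weight[OF weight_vector_dpF[OF w]])
      hence "weight_proj n N (sp (dp F (int a)) \<bullet> w) = \<zero>m" using wc by simp
      thus ?thesis using IH that wc xc by (simp add: weight_proj_add weight_proj_k weight_proj_closed)
    qed
    thus ?thesis by blast
  qed
qed

text \<open>
  For large \<open>N\<close> the operator \<open>weight_proj n N\<close> leaves of an element of \<open>lspan w\<close> only its term in \<open>w\<close>,
  while it multiplies an element of weight \<open>n\<close> by a nonzero number.
\<close>
theorem hw_weight_space:
  assumes hw: "hw_vector n w" and u: "u \<in> carrier U" and y: "weight_vector n (u \<bullet> w)"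
  shows "\<exists>c. u \<bullet> w = k c \<bullet> w"
proof -
  have w: "weight_vector n w" "w \<in> carrier M" using hw by (auto simp: hw_vector_def weight_vector_closed)
  obtain c N where "weight_proj n N (u \<bullet> w) = k c \<bullet> weight_proj n N w"
    using weight_proj_lspan[OF w(1) generated_in_lspan[OF hw u]] by blast
  hence e: "k (\<Prod>a=1..N. kill_factor n a n) \<bullet> u \<bullet> w = k (\<Prod>a=1..N. kill_factor n a n) \<bullet> k c \<bullet> w"
    using w(2) by (simp add: weight_proj_weight[OF y] weight_proj_weight[OF w(1)] mult.commute)
  have nz: "(\<Prod>a=1..N. kill_factor n a n) \<noteq> 0" using kill_factor_neq_0 by auto
  have "u \<bullet> w = k c \<bullet> w"
    by (rule k_cancel[OF nz _ _ e]) (simp_all add: w(2) u smult_closed)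
  thus ?thesis by blast
qed

lemma left_module_submodule: assumes "submodule N U M" shows "left_module U (M\<lparr>carrier := N\<rparr>)"
proof -
  interpret N: submodule N U M by (rule assms)
  have sub: "x \<in> carrier M" if "x \<in> N" for x using N.subset that by auto
  have add: "x +m y \<in> N" if "x \<in> N" "y \<in> N" for x y using N.m_closed[OF that] by simp
  have zero: "\<zero>m \<in> N" using N.one_closed by simp
  show ?thesis
  proof (intro left_module.intro left_module_axioms.intro)
    show "ring U" by (rule U.ring_axioms)
    show "abelian_group (M\<lparr>carrier := N\<rparr>)"
    proof (rule abelian_groupI)
      fix x assume "x \<in> carrier (M\<lparr>carrier := N\<rparr>)"
      hence x: "x \<in> N" "x \<in> carrier M" using sub by simp_all
      have "k (- 1) \<bullet> x \<in> N" using x by simp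
      moreover have "k (- 1) \<bullet> x +m x = \<zero>m" using k_plus[of x "-1" 1] x by simp
      ultimately show "\<exists>y\<in>carrier (M\<lparr>carrier := N\<rparr>). y \<oplus>\<^bsub>M\<lparr>carrier := N\<rparr>\<^esub> x = \<zero>\<^bsub>M\<lparr>carrier := N\<rparr>\<^esub>"
        by auto
    qed (simp_all add: sub add zero M.a_assoc, simp add: sub M.a_comm)
  qed (simp_all add: sub smult_l_distr smult_r_distr smult_assoc smult_one)
qed

lemma cyclic_submodule: assumes v: "v \<in> carrier M" shows "submodule {u \<bullet> v | u. u \<in> carrier U} U M"
proof (intro submodule.intro submodule_axioms.intro)
  show "subgroup {u \<bullet> v | u. u \<in> carrier U} (add_monoid M)"
  proof (rule M.add.subgroupI)
    show "{u \<bullet> v | u. u \<in> carrier U} \<subseteq> carrier M" using v smult_closed by auto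
    show "{u \<bullet> v | u. u \<in> carrier U} \<noteq> {}" using U.zero_closed by blast
  next
    fix x assume "x \<in> {u \<bullet> v | u. u \<in> carrier U}"
    then obtain u where u: "u \<in> carrier U" "x = u \<bullet> v" by blast
    have "\<ominus>\<^bsub>M\<^esub> x = (k (- 1) \<otimes>\<^bsub>U\<^esub> u) \<bullet> v" using u v by (simp add: uminus_k smult_assoc smult_closed)
    thus "\<ominus>\<^bsub>M\<^esub> x \<in> {u \<bullet> v | u. u \<in> carrier U}" using U.m_closed[OF k_closed u(1), of "- 1"] by blast
  next
    fix x y assume "x \<in> {u \<bullet> v | u. u \<in> carrier U}" "y \<in> {u \<bullet> v | u. u \<in> carrier U}"
    then obtain a b where ab: "a \<in> carrier U" "x = a \<bullet> v" "b \<in> carrier U" "y = b \<bullet> v" by blast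
    hence "x +m y = (a \<oplus>\<^bsub>U\<^esub> b) \<bullet> v" using v by (simp add: smult_l_distr)
    thus "x +m y \<in> {u \<bullet> v | u. u \<in> carrier U}" using U.a_closed[OF ab(1,3)] by blast
  qed
next
  fix a x assume "a \<in> carrier U" "x \<in> {u \<bullet> v | u. u \<in> carrier U}"
  then obtain u where u: "a \<in> carrier U" "u \<in> carrier U" "x = u \<bullet> v" by blast
  hence "a \<bullet> x = (a \<otimes>\<^bsub>U\<^esub> u) \<bullet> v" using v by (simp add: smult_assoc)
  thus "a \<bullet> x \<in> {u \<bullet> v | u. u \<in> carrier U}" using U.m_closed[OF u(1,2)] by blast
qed

lemma diff_eq_zero_iff: assumes "x \<in> carrier M" "y \<in> carrier M"
  shows "x +m k (- 1) \<bullet> y = \<zero>m \<longleftrightarrow> x = y"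
proof -
  have e: "k (- 1) \<bullet> y +m y = \<zero>m" "y +m k (- 1) \<bullet> y = \<zero>m"
    using k_plus[of y "-1" 1] k_plus[of y 1 "-1"] assms by simp_all
  have "x = y" if "x +m k (- 1) \<bullet> y = \<zero>m"
  proof -
    have "x = x +m (k (- 1) \<bullet> y +m y)" using e assms by simp
    also have "\<dots> = (x +m k (- 1) \<bullet> y) +m y" using assms by (simp only: M.a_assoc k_smult_closed)
    also have "\<dots> = y" using that assms by simp
    finally show ?thesis .
  qed
  thus ?thesis using e by blast
qed

lemma hw_vectorI:
  assumes "v \<in> weight_space p \<epsilon> M n" "spec \<epsilon> (uq_gen E) \<bullet> v = \<zero>m" "spec \<epsilon> (uq_dpow E p) \<bullet> v = \<zero>m"
  shows "hw_vector n v"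
proof -
  show ?thesis using assms by (simp add: hw_vector_def weight_space_iff dp_1 uq_of_gen uq_of_dp)
qed

end

section \<open>Uniqueness of irreducible highest weight modules\<close>

definition prod_module :: "(ueps, 'v) module \<Rightarrow> (ueps, 'w) module \<Rightarrow> (ueps, 'v \<times> 'w) module"
  where "prod_module M N = \<lparr>carrier = carrier M \<times> carrier N, monoid.mult = (\<lambda>x y. x), one = (\<zero>\<^bsub>M\<^esub>, \<zero>\<^bsub>N\<^esub>),
    zero = (\<zero>\<^bsub>M\<^esub>, \<zero>\<^bsub>N\<^esub>), add = (\<lambda>x y. (fst x \<oplus>\<^bsub>M\<^esub> fst y, snd x \<oplus>\<^bsub>N\<^esub> snd y)),
    smult = (\<lambda>u x. (u \<odot>\<^bsub>M\<^esub> fst x, u \<odot>\<^bsub>N\<^esub> snd x))\<rparr>"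

lemma prod_module_simps:
  "carrier (prod_module M N) = carrier M \<times> carrier N"
  "\<zero>\<^bsub>prod_module M N\<^esub> = (\<zero>\<^bsub>M\<^esub>, \<zero>\<^bsub>N\<^esub>)"
  "x \<oplus>\<^bsub>prod_module M N\<^esub> y = (fst x \<oplus>\<^bsub>M\<^esub> fst y, snd x \<oplus>\<^bsub>N\<^esub> snd y)"
  "u \<odot>\<^bsub>prod_module M N\<^esub> x = (u \<odot>\<^bsub>M\<^esub> fst x, u \<odot>\<^bsub>N\<^esub> snd x)"
  by (simp_all add: prod_module_def)

context odd_root_of_unity
begin

lemma ueps_moduleI: "left_module U M \<Longrightarrow> ueps_module p \<epsilon> M"
  by (intro ueps_module.intro odd_root_of_unity_axioms)

lemma left_module_prod:
  assumes "left_module U M" "left_module U N" shows "left_module U (prod_module M N)"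
proof -
  interpret M: ueps_module p \<epsilon> M by (rule ueps_moduleI[OF assms(1)])
  interpret N: ueps_module p \<epsilon> N by (rule ueps_moduleI[OF assms(2)])
  show ?thesis
  proof (intro left_module.intro left_module_axioms.intro)
    show "ring U" by (rule U.ring_axioms)
    show "abelian_group (prod_module M N)"
    proof (rule abelian_groupI)
      fix x assume x: "x \<in> carrier (prod_module M N)"
      show "\<exists>y\<in>carrier (prod_module M N). y \<oplus>\<^bsub>prod_module M N\<^esub> x = \<zero>\<^bsub>prod_module M N\<^esub>"
        by (rule bexI[of _ "(\<ominus>\<^bsub>M\<^esub> fst x, \<ominus>\<^bsub>N\<^esub> snd x)"])
          (use x in \<open>auto simp: prod_module_simps M.M.l_neg N.M.l_neg\<close>)
    qed (auto simp: prod_module_simps M.M.a_assoc N.M.a_assoc M.M.a_ac N.M.a_ac)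
  qed (auto simp: prod_module_simps M.smult_closed N.smult_closed M.smult_l_distr N.smult_l_distr
      M.smult_r_distr N.smult_r_distr M.smult_assoc N.smult_assoc M.smult_one N.smult_one)
qed

lemma is_VresE:
  assumes "is_Vres p \<epsilon> n M"
  obtains v where "ueps_module p \<epsilon> M" "ueps_module.hw_vector p \<epsilon> M n v" "v \<noteq> \<zero>\<^bsub>M\<^esub>"
    "carrier M = {u \<odot>\<^bsub>M\<^esub> v | u. u \<in> carrier U}"
    "\<And>N. submodule N U M \<Longrightarrow> N = {\<zero>\<^bsub>M\<^esub>} \<or> N = carrier M"
proof -
  have M: "ueps_module p \<epsilon> M" using assms by (auto simp: is_Vres_def irreducible_module_def intro: ueps_moduleI)
  obtain v where v: "v \<in> weight_space p \<epsilon> M n" "v \<noteq> \<zero>\<^bsub>M\<^esub>" "spec \<epsilon> (uq_gen E) \<odot>\<^bsub>M\<^esub> v = \<zero>\<^bsub>M\<^esub>"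
      "spec \<epsilon> (uq_dpow E p) \<odot>\<^bsub>M\<^esub> v = \<zero>\<^bsub>M\<^esub>" "carrier M = {u \<odot>\<^bsub>M\<^esub> v | u. u \<in> carrier U}"
    using assms unfolding is_Vres_def highest_weight_module_def by blast
  have "\<And>N. submodule N U M \<Longrightarrow> N = {\<zero>\<^bsub>M\<^esub>} \<or> N = carrier M"
    using assms unfolding is_Vres_def irreducible_module_def by blast
  thus thesis using that[OF M ueps_module.hw_vectorI[OF M v(1,3,4)] v(2,5)] by blast
qed

text \<open>
  If \<open>u\<close> annihilated \<open>w\<close> but not \<open>v\<close>, then by irreducibility some multiple \<open>b\<close> of \<open>u\<close> would
  fix \<open>v\<close> and annihilate \<open>w\<close>. In the product module \<open>(v, w)\<close> is a highest weight vector, and \<open>b\<close> would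
  send it to \<open>(v, 0)\<close>, which has the same weight without being a multiple of \<open>(v, w)\<close>.
\<close>
lemma annihilator_subset:
  assumes "is_Vres p \<epsilon> n M" and v: "ueps_module.hw_vector p \<epsilon> M n v" "v \<noteq> \<zero>\<^bsub>M\<^esub>"
    and N: "ueps_module p \<epsilon> N" and w: "ueps_module.hw_vector p \<epsilon> N n w" "w \<noteq> \<zero>\<^bsub>N\<^esub>"
    and u: "u \<in> carrier U" "u \<odot>\<^bsub>N\<^esub> w = \<zero>\<^bsub>N\<^esub>"
  shows "u \<odot>\<^bsub>M\<^esub> v = \<zero>\<^bsub>M\<^esub>"
proof (rule ccontr)
  assume nz: "u \<odot>\<^bsub>M\<^esub> v \<noteq> \<zero>\<^bsub>M\<^esub>"
  have M: "ueps_module p \<epsilon> M" by (rule is_VresE[OF assms(1)])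
  have irr: "L = {\<zero>\<^bsub>M\<^esub>} \<or> L = carrier M" if "submodule L U M" for L
    using assms(1) that unfolding is_Vres_def irreducible_module_def by blast
  interpret M: ueps_module p \<epsilon> M by (rule M)
  interpret N: ueps_module p \<epsilon> N by (rule N)
  have vc: "v \<in> carrier M" and wc: "w \<in> carrier N"
    by (rule M.hw_vector_closed[OF v(1)], rule N.hw_vector_closed[OF w(1)])
  have uv: "u \<odot>\<^bsub>M\<^esub> v \<in> carrier M" using u vc by (simp add: M.smult_closed)
  have "u \<odot>\<^bsub>M\<^esub> v \<in> {a \<odot>\<^bsub>M\<^esub> (u \<odot>\<^bsub>M\<^esub> v) | a. a \<in> carrier U}"
    using M.smult_one[OF uv, symmetric] U.one_closed by blast
  hence "{a \<odot>\<^bsub>M\<^esub> (u \<odot>\<^bsub>M\<^esub> v) | a. a \<in> carrier U} = carrier M"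
    using irr[OF M.cyclic_submodule[OF uv]] nz by blast
  hence "v \<in> {a \<odot>\<^bsub>M\<^esub> (u \<odot>\<^bsub>M\<^esub> v) | a. a \<in> carrier U}" by (simp only: vc)
  then obtain a where a: "a \<in> carrier U" "a \<odot>\<^bsub>M\<^esub> (u \<odot>\<^bsub>M\<^esub> v) = v" by force
  define b where "b = a \<otimes>\<^bsub>U\<^esub> u"
  have b: "b \<in> carrier U" "b \<odot>\<^bsub>M\<^esub> v = v" "b \<odot>\<^bsub>N\<^esub> w = \<zero>\<^bsub>N\<^esub>"
    unfolding b_def using a u vc wc by (simp_all add: M.smult_assoc N.smult_assoc)
  interpret P: ueps_module p \<epsilon> "prod_module M N"
    by (rule ueps_moduleI[OF left_module_prod[OF M.left_module_axioms N.left_module_axioms]])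
  have hw: "P.hw_vector n (v, w)" "P.weight_vector n (v, \<zero>\<^bsub>N\<^esub>)"
    using v(1) w(1) vc wc
    by (simp_all add: P.hw_vector_def P.weight_vector_def M.hw_vector_def M.weight_vector_def
      N.hw_vector_def N.weight_vector_def prod_module_simps)
  have bvw: "b \<odot>\<^bsub>prod_module M N\<^esub> (v, w) = (v, \<zero>\<^bsub>N\<^esub>)"
    using b by (simp add: prod_module_simps)
  obtain c where "b \<odot>\<^bsub>prod_module M N\<^esub> (v, w) = k c \<odot>\<^bsub>prod_module M N\<^esub> (v, w)"
    using P.hw_weight_space[OF hw(1) b(1)] hw(2) unfolding bvw by blast
  hence c: "v = k c \<odot>\<^bsub>M\<^esub> v" "\<zero>\<^bsub>N\<^esub> = k c \<odot>\<^bsub>N\<^esub> w"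
    unfolding bvw by (simp_all add: prod_module_simps)
  have "c = 0" by (rule N.k_eq_zero[OF c(2)[symmetric] wc w(2)])
  hence "k c \<odot>\<^bsub>M\<^esub> v = \<zero>\<^bsub>M\<^esub>" using vc by simp
  with c(1) have "v = \<zero>\<^bsub>M\<^esub>" by (rule trans)
  thus False using v(2) by simp
qed

text \<open>
  By \<open>annihilator_subset\<close> in both directions, \<open>u v \<mapsto> u w\<close> is well defined and injective.
\<close>
theorem Vres_unique:
  assumes "is_Vres p \<epsilon> n M" "is_Vres p \<epsilon> n N" shows "isomorphic_modules U M N"
proof -
  obtain v where M: "ueps_module p \<epsilon> M" "ueps_module.hw_vector p \<epsilon> M n v" "v \<noteq> \<zero>\<^bsub>M\<^esub>"
    "carrier M = {u \<odot>\<^bsub>M\<^esub> v | u. u \<in> carrier U}" by (rule is_VresE[OF assms(1)]) (rule that, assumption+)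
  obtain w where N: "ueps_module p \<epsilon> N" "ueps_module.hw_vector p \<epsilon> N n w" "w \<noteq> \<zero>\<^bsub>N\<^esub>"
    "carrier N = {u \<odot>\<^bsub>N\<^esub> w | u. u \<in> carrier U}" by (rule is_VresE[OF assms(2)]) (rule that, assumption+)
  interpret M: ueps_module p \<epsilon> M by (rule M)
  interpret N: ueps_module p \<epsilon> N by (rule N)
  have vc: "v \<in> carrier M" and wc: "w \<in> carrier N"
    by (rule M.hw_vector_closed[OF M(2)], rule N.hw_vector_closed[OF N(2)])
  have ann: "u \<odot>\<^bsub>M\<^esub> v = \<zero>\<^bsub>M\<^esub> \<longleftrightarrow> u \<odot>\<^bsub>N\<^esub> w = \<zero>\<^bsub>N\<^esub>" if "u \<in> carrier U" for u
    using annihilator_subset[OF assms(1) M(2,3) N(1-3) that] annihilator_subset[OF assms(2) N(2,3) M(1-3) that] by blast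
  have eq: "a \<odot>\<^bsub>M\<^esub> v = b \<odot>\<^bsub>M\<^esub> v \<longleftrightarrow> a \<odot>\<^bsub>N\<^esub> w = b \<odot>\<^bsub>N\<^esub> w"
    if ab: "a \<in> carrier U" "b \<in> carrier U" for a b
  proof -
    let ?d = "a \<oplus>\<^bsub>U\<^esub> (k (- 1) \<otimes>\<^bsub>U\<^esub> b)"
    have d: "?d \<in> carrier U" using ab by simp
    have "?d \<odot>\<^bsub>M\<^esub> v = \<zero>\<^bsub>M\<^esub> \<longleftrightarrow> a \<odot>\<^bsub>M\<^esub> v = b \<odot>\<^bsub>M\<^esub> v"
      using ab vc by (simp add: M.smult_l_distr M.smult_assoc M.smult_closed M.diff_eq_zero_iff)
    moreover have "?d \<odot>\<^bsub>N\<^esub> w = \<zero>\<^bsub>N\<^esub> \<longleftrightarrow> a \<odot>\<^bsub>N\<^esub> w = b \<odot>\<^bsub>N\<^esub> w"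
      using ab wc by (simp add: N.smult_l_distr N.smult_assoc N.smult_closed N.diff_eq_zero_iff)
    ultimately show ?thesis using ann[OF d] by simp
  qed
  define h where "h x = (SOME u. u \<in> carrier U \<and> x = u \<odot>\<^bsub>M\<^esub> v) \<odot>\<^bsub>N\<^esub> w" for x
  have h: "h (u \<odot>\<^bsub>M\<^esub> v) = u \<odot>\<^bsub>N\<^esub> w" if u: "u \<in> carrier U" for u
  proof -
    have "\<exists>a. a \<in> carrier U \<and> u \<odot>\<^bsub>M\<^esub> v = a \<odot>\<^bsub>M\<^esub> v" using u by blast
    from someI_ex[OF this] obtain a where a: "a \<in> carrier U" "u \<odot>\<^bsub>M\<^esub> v = a \<odot>\<^bsub>M\<^esub> v"
      "h (u \<odot>\<^bsub>M\<^esub> v) = a \<odot>\<^bsub>N\<^esub> w" unfolding h_def by blast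
    thus ?thesis using eq[OF u a(1)] by simp
  qed
  have "module_iso U M N h"
    unfolding module_iso_def
  proof (intro conjI ballI)
    show "bij_betw h (carrier M) (carrier N)"
      unfolding bij_betw_def
    proof
      show "inj_on h (carrier M)"
      proof (rule inj_onI)
        fix x y assume xy: "x \<in> carrier M" "y \<in> carrier M" "h x = h y"
        then obtain a b where ab: "a \<in> carrier U" "x = a \<odot>\<^bsub>M\<^esub> v" "b \<in> carrier U" "y = b \<odot>\<^bsub>M\<^esub> v"
          unfolding M(4) by blast
        show "x = y" using xy(3) unfolding ab(2,4) h[OF ab(1)] h[OF ab(3)] eq[OF ab(1,3)] .
      qed
      have "h ` carrier M = (\<lambda>u. h (u \<odot>\<^bsub>M\<^esub> v)) ` carrier U" unfolding M(4) by blast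
      also have "\<dots> = (\<lambda>u. u \<odot>\<^bsub>N\<^esub> w) ` carrier U" by (rule image_cong[OF refl h])
      also have "\<dots> = carrier N" unfolding N(4) by blast
      finally show "h ` carrier M = carrier N" .
    qed
  next
    fix x y assume "x \<in> carrier M" "y \<in> carrier M"
    then obtain a b where ab: "a \<in> carrier U" "x = a \<odot>\<^bsub>M\<^esub> v" "b \<in> carrier U" "y = b \<odot>\<^bsub>M\<^esub> v"
      unfolding M(4) by blast
    have "h ((a \<oplus>\<^bsub>U\<^esub> b) \<odot>\<^bsub>M\<^esub> v) = (a \<oplus>\<^bsub>U\<^esub> b) \<odot>\<^bsub>N\<^esub> w" using ab by (intro h) simp
    thus "h (x \<oplus>\<^bsub>M\<^esub> y) = h x \<oplus>\<^bsub>N\<^esub> h y"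
      using ab vc wc h by (simp add: M.smult_l_distr N.smult_l_distr)
  next
    fix a x assume "a \<in> carrier U" "x \<in> carrier M"
    then obtain b where ab: "a \<in> carrier U" "b \<in> carrier U" "x = b \<odot>\<^bsub>M\<^esub> v"
      unfolding M(4) by blast
    have "h ((a \<otimes>\<^bsub>U\<^esub> b) \<odot>\<^bsub>M\<^esub> v) = (a \<otimes>\<^bsub>U\<^esub> b) \<odot>\<^bsub>N\<^esub> w" using ab by (intro h) simp
    thus "h (a \<odot>\<^bsub>M\<^esub> x) = a \<odot>\<^bsub>N\<^esub> h x"
      using ab vc wc h by (simp add: M.smult_assoc N.smult_assoc)
  qed
  thus ?thesis unfolding isomorphic_modules_def by blast
qed
end

section \<open>The submodule \<open>V'\<close> of the Fock space\<close>

locale fock_setting = ueps_module p \<epsilon> M for p :: nat and \<epsilon> :: complex and M :: "(ueps, fock) module" +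
  fixes s s0 s1 :: nat
  assumes fock_M: "is_fock_module \<epsilon> M" and s_eq: "s = s0 + p * s1" and s0_less: "s0 < p" and s0_pos: "s0 \<noteq> 0"
begin

lemma M_simps: "carrier M = UNIV" "\<zero>m = 0" "x +m y = x + y" "k c \<bullet> x = fscale c x"
  using fock_M by (simp_all add: is_fock_module_def)

text \<open>
  As the weight of \<open>vm m\<close> is \<open>- (2 m + s + 1)\<close>, the admissible index that is \<open>lowest\<close> belongs to
  the highest weight, which is \<open>lam\<close>.
\<close>
definition vm :: "nat \<Rightarrow> fock" where "vm m = g (int m) (int (m + s))"
definition admissible :: "nat \<Rightarrow> bool" where "admissible m \<longleftrightarrow> p - s0 \<le> m mod p"
definition lowest :: nat where "lowest = p - s0"
definition lam :: int where "lam = - (int p - int s0 + (int s1 + 1) * int p + 1)"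

abbreviation N where "N \<equiv> V' p s s0"

lemma vm_single: "vm m = single (m, m + s) 1"
  unfolding vm_def by (rule g_nat)

lemma N_eq: "N = fock.span {vm m | m. admissible m}"
proof -
  have "{g (int m) (int (m + s)) | m a b. m = a + p * b \<and> a < p \<and> p - s0 \<le> a} = {vm m | m. admissible m}"
  proof (intro equalityI subsetI)
    fix x assume "x \<in> {g (int m) (int (m + s)) | m a b. m = a + p * b \<and> a < p \<and> p - s0 \<le> a}"
    then obtain m a b where m: "x = g (int m) (int (m + s))" "m = a + p * b" "a < p" "p - s0 \<le> a" by blast
    hence "x = vm m" "admissible m" by (simp_all add: vm_def admissible_def)
    thus "x \<in> {vm m | m. admissible m}" by blast
  next
    fix x assume "x \<in> {vm m | m. admissible m}"
    then obtain m where m: "x = vm m" "admissible m" by blast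
    have "m = m mod p + p * (m div p)" "m mod p < p" using p_gt_1 by simp_all
    thus "x \<in> {g (int m) (int (m + s)) | m a b. m = a + p * b \<and> a < p \<and> p - s0 \<le> a}"
      using m unfolding vm_def admissible_def by blast
  qed
  thus ?thesis by (simp add: V'_def)
qed

lemma vm_N: "admissible m \<Longrightarrow> vm m \<in> N"
  unfolding N_eq by (rule fock.span_base) blast

lemma vm_K: "sp gK \<bullet> vm m = fscale (\<epsilon> powi (- (2 * int m + int s + 1))) (vm m)"
  and vm_Kinv: "sp gK' \<bullet> vm m = fscale (\<epsilon> powi (2 * int m + int s + 1)) (vm m)"
proof -
  have e: "int m + int (m + s) + 1 = 2 * int m + int s + 1" by simp
  have nn: "int m \<ge> 0" "int (m + s) \<ge> 0" by simp_all
  have "spec \<epsilon> (uq_gen K) \<bullet> g (int m) (int (m + s)) = fscale (\<epsilon> powi (- (int m + int (m + s) + 1))) (g (int m) (int (m + s)))"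
    "spec \<epsilon> (uq_gen Kinv) \<bullet> g (int m) (int (m + s)) = fscale (\<epsilon> powi (int m + int (m + s) + 1)) (g (int m) (int (m + s)))"
    using fock_M nn unfolding is_fock_module_def by blast+
  thus "sp gK \<bullet> vm m = fscale (\<epsilon> powi (- (2 * int m + int s + 1))) (vm m)"
    "sp gK' \<bullet> vm m = fscale (\<epsilon> powi (2 * int m + int s + 1)) (vm m)"
    unfolding vm_def uq_of_gen e by simp_all
qed

lemma vm_E:
  assumes "r \<ge> 1"
  shows "sp (dp E (int r)) \<bullet> vm m = (if r \<le> m then fscale (B (int (m + s)) (m - r + s)) (vm (m - r)) else 0)"
proof -
  have nn: "int m \<ge> 0" "int (m + s) \<ge> 0" by simp_all
  have "spec \<epsilon> (uq_dpow E r) \<bullet> g (int m) (int (m + s)) =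
      fscale (qbinom_at \<epsilon> (int (m + s)) (int (m + s) - int r)) (g (int m - int r) (int (m + s) - int r))"
    using fock_M nn assms unfolding is_fock_module_def by blast
  moreover have "int m - int r = int (m - r)" "int (m + s) - int r = int (m - r + s)" if "r \<le> m"
    using that by auto
  moreover have "g (int m - int r) x = 0" if "\<not> r \<le> m" for x using that by (simp add: g_def)
  ultimately show ?thesis unfolding vm_def uq_of_dp by (auto simp del: of_nat_diff of_nat_add)
qed

lemma vm_F:
  assumes "r \<ge> 1"
  shows "sp (dp F (int r)) \<bullet> vm m = fscale ((- 1) ^ r * B (int (r + m)) r) (vm (m + r))"
proof -
  have nn: "int m \<ge> 0" "int (m + s) \<ge> 0" by simp_all
  have "spec \<epsilon> (uq_dpow F r) \<bullet> g (int m) (int (m + s)) =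
      fscale ((- 1) ^ r * qbinom_at \<epsilon> (int r + int m) (int r)) (g (int m + int r) (int (m + s) + int r))"
    using fock_M nn assms unfolding is_fock_module_def by blast
  moreover have "int m + int r = int (m + r)" "int (m + s) + int r = int (m + r + s)" "int r + int m = int (r + m)"
    by auto
  ultimately show ?thesis unfolding vm_def uq_of_dp by (simp del: of_nat_add)
qed

lemma mod_p_cases:
  obtains "(a + b) mod p = a mod p + b mod p" "a mod p + b mod p < p"
  | "(a + b) mod p + p = a mod p + b mod p"
proof -
  have l: "a mod p < p" "b mod p < p" using p_gt_1 by simp_all
  have e: "(a + b) mod p = (a mod p + b mod p) mod p" by (simp add: mod_add_eq)
  show thesis
  proof (cases "a mod p + b mod p < p")
    case True thus ?thesis using that(1) e by simp
  next
    case False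
    hence "(a mod p + b mod p) mod p = (a mod p + b mod p - p) mod p" by (simp add: le_mod_geq)
    also have "\<dots> = a mod p + b mod p - p" using l by (intro mod_less) linarith
    finally show ?thesis using that(2) e False by linarith
  qed
qed

text \<open>
  Since \<open>m\<close> is admissible, adding \<open>s\<close> to \<open>m\<close> produces a carry, and the last digit of \<open>m + s\<close> is smaller
  than \<open>s\<^sub>0\<close>. Since \<open>m - r\<close> is not, there is no carry in \<open>m - r + s\<close>, and its last digit is at least
  \<open>s\<^sub>0\<close>.
\<close>
lemma E_leaves_zero:
  assumes "admissible m" "r \<le> m" "\<not> admissible (m - r)" shows "B (int (m + s)) (m - r + s) = 0"
proof -
  have s: "s mod p = s0" using s0_less by (simp add: s_eq)
  have m: "p - s0 \<le> m mod p" "(m - r) mod p < p - s0" "m mod p < p"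
    using assms p_gt_1 by (auto simp: admissible_def)
  have "(m + s) mod p + p = m mod p + s0"
    by (rule mod_p_cases[of m s]) (use m(1) s0_less s in linarith)+
  moreover have "(m - r + s) mod p = (m - r) mod p + s0"
    by (rule mod_p_cases[of "m - r" s]) (use m(2) s0_less s in linarith)+
  ultimately have "(m + s) mod p < (m - r + s) mod p" using m s0_pos by linarith
  thus ?thesis using B_eq_0_iff[of "m - r + s" "m + s"] by simp
qed

text \<open>
  Leaving the range of admissible last digits upwards, \<open>m + r\<close> must produce a carry.
\<close>
lemma F_leaves_zero:
  assumes "admissible m" "\<not> admissible (m + r)" shows "B (int (r + m)) r = 0"
proof -
  have m: "p - s0 \<le> m mod p" "(r + m) mod p < p - s0" "m mod p < p"
    using assms p_gt_1 by (auto simp: admissible_def add.commute)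
  have "(r + m) mod p < r mod p"
    by (rule mod_p_cases[of r m]) (use m in linarith)+
  thus ?thesis using B_eq_0_iff[of r "r + m"] by simp
qed

lemma fscale_N: "x \<in> N \<Longrightarrow> fscale c x \<in> N" and zero_N: "0 \<in> N" and add_N: "x \<in> N \<Longrightarrow> y \<in> N \<Longrightarrow> x + y \<in> N"
  unfolding N_eq by (simp_all add: fock.span_scale fock.span_zero fock.span_add)

lemma N_induct [consumes 1, case_names zero step]:
  assumes "x \<in> N" "P 0"
    and "\<And>c m y. admissible m \<Longrightarrow> y \<in> N \<Longrightarrow> P y \<Longrightarrow> P (fscale c (vm m) + y)"
  shows "P x"
proof -
  have "x \<in> N \<and> P x" using assms(1)[unfolded N_eq]
  proof (induction rule: fock.span_induct_alt)
    case base show ?case using zero_N assms(2) by blast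
  next
    case (step c v y)
    then obtain m where m: "v = vm m" "admissible m" by blast
    show ?case unfolding m(1)
      using assms(3)[OF m(2)] step.IH add_N fscale_N vm_N[OF m(2)] by blast
  qed
  thus ?thesis ..
qed

lemma smult_fscale: assumes "u \<in> carrier U" shows "u \<bullet> fscale c x = fscale c (u \<bullet> x)"
  using assms
proof (induction u arbitrary: x rule: Ueps_induct)
  case (add a b) thus ?case using smult_l_distr[of a b] by (simp add: M_simps fock.scale_right_distrib)
next
  case (mult a b) thus ?case using smult_assoc[of a b] by (simp add: M_simps)
next
  case (const d) show ?case by (simp add: M_simps mult.commute)
next
  case K show ?case using sp_k[of gK x c] by (simp add: M_simps)
next
  case Kinv show ?case using sp_k[of gK' x c] by (simp add: M_simps)
next
  case (E r) show ?case using sp_k[of "dp E (int r)" x c] by (simp add: M_simps)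
next
  case (F r) show ?case using sp_k[of "dp F (int r)" x c] by (simp add: M_simps)
qed

lemma smult_plus: "u \<in> carrier U \<Longrightarrow> u \<bullet> (x + y) = u \<bullet> x + u \<bullet> y"
  using smult_r_distr[of u x y] by (simp add: M_simps)

lemma smult_0: "u \<in> carrier U \<Longrightarrow> u \<bullet> 0 = 0"
  using smult_mzero[of u] by (simp add: M_simps)

lemma N_closed: assumes "x \<in> N" "u \<in> carrier U" "\<And>m. admissible m \<Longrightarrow> u \<bullet> vm m \<in> N" shows "u \<bullet> x \<in> N"
  using assms(1)
  by (induction rule: N_induct) (simp_all add: smult_0 smult_plus smult_fscale assms zero_N add_N fscale_N)

lemma dpE_N: assumes "x \<in> N" "r \<ge> 1" shows "sp (dp E (int r)) \<bullet> x \<in> N"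
proof (rule N_closed[OF assms(1)])
  fix m assume m: "admissible m"
  show "sp (dp E (int r)) \<bullet> vm m \<in> N"
  proof (cases "r \<le> m \<and> admissible (m - r)")
    case True thus ?thesis using vm_N by (simp add: vm_E[OF assms(2)] fscale_N)
  next
    case False
    hence "sp (dp E (int r)) \<bullet> vm m = 0"
      using E_leaves_zero[OF m, of r] by (auto simp: vm_E[OF assms(2)] simp del: of_nat_add)
    thus ?thesis by (simp add: zero_N)
  qed
qed simp

lemma dpF_N: assumes "x \<in> N" "r \<ge> 1" shows "sp (dp F (int r)) \<bullet> x \<in> N"
proof (rule N_closed[OF assms(1)])
  fix m assume m: "admissible m"
  show "sp (dp F (int r)) \<bullet> vm m \<in> N"
  proof (cases "admissible (m + r)")
    case True thus ?thesis using vm_N by (simp add: vm_F[OF assms(2)] fscale_N)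
  next
    case False
    thus ?thesis using F_leaves_zero[OF m, of r] by (simp add: vm_F[OF assms(2)] zero_N del: of_nat_add)
  qed
qed simp

lemma N_submodule: "submodule N U M"
proof (rule submoduleI_gens)
  show "N \<subseteq> carrier M" by (simp add: M_simps)
  show "\<zero>m \<in> N" by (simp add: M_simps zero_N)
  show "x +m y \<in> N" if "x \<in> N" "y \<in> N" for x y using that by (simp add: M_simps add_N)
  show "k c \<bullet> x \<in> N" if "x \<in> N" for c x using that by (simp add: M_simps fscale_N)
  show "sp gK \<bullet> x \<in> N" if "x \<in> N" for x
    by (rule N_closed[OF that]) (simp_all add: vm_K fscale_N vm_N)
  show "sp gK' \<bullet> x \<in> N" if "x \<in> N" for x
    by (rule N_closed[OF that]) (simp_all add: vm_Kinv fscale_N vm_N)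
  show "sp (dp E 1) \<bullet> x \<in> N" if "x \<in> N" for x using dpE_N[OF that, of 1] by simp
  show "sp (dp E (int p)) \<bullet> x \<in> N" if "x \<in> N" for x using dpE_N[OF that, of p] p_gt_1 by simp
  show "sp (dp F 1) \<bullet> x \<in> N" if "x \<in> N" for x using dpF_N[OF that, of 1] by simp
  show "sp (dp F (int p)) \<bullet> x \<in> N" if "x \<in> N" for x using dpF_N[OF that, of p] p_gt_1 by simp
qed

abbreviation MN :: "(ueps, fock) module" where "MN \<equiv> M\<lparr>carrier := N\<rparr>"

lemma MN_module: "left_module U MN"
  by (rule left_module_submodule[OF N_submodule])

lemma MN_simps: "carrier MN = N" "\<zero>\<^bsub>MN\<^esub> = 0" "x \<oplus>\<^bsub>MN\<^esub> y = x + y" "u \<odot>\<^bsub>MN\<^esub> x = u \<bullet> x"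
  by (simp_all add: M_simps)

lemma lowest: "admissible lowest" "admissible m \<Longrightarrow> lowest \<le> m" "lowest \<ge> 1" "lowest < p"
proof -
  show "lowest \<le> m" if "admissible m"
    using that mod_less_eq_dividend[of m p] unfolding lowest_def admissible_def by linarith
qed (use s0_less s0_pos p_gt_1 in \<open>auto simp: lowest_def admissible_def\<close>)

lemma vm_lowest_E: assumes "r \<ge> 1" shows "sp (dp E (int r)) \<bullet> vm lowest = 0"
proof (cases "r \<le> lowest")
  case True
  hence "\<not> admissible (lowest - r)" using lowest(2)[of "lowest - r"] assms lowest(3) by auto
  thus ?thesis using E_leaves_zero[OF lowest(1) True] True by (simp add: vm_E[OF assms] del: of_nat_add)
qed (simp add: vm_E[OF assms])

lemma lam_eq: "lam = - (2 * int lowest + int s + 1)"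
  using s0_less by (simp add: lam_def lowest_def s_eq algebra_simps of_nat_diff)

text \<open>
  By \<open>E_F_on_killed\<close> the eigenvalue is the product of the coefficients of \<open>f\<^bsup>(p)\<^esup>\<close> and \<open>e\<^bsup>(p)\<^esup>\<close>, which are
  \<open>(- 1)\<^sup>p = - 1\<close> and \<open>s\<^sub>1 + 2\<close>.
\<close>
lemma vm_lowest_Kbinom: "sp (KB 0 p) \<bullet> vm lowest = fscale (B lam p) (vm lowest)"
proof -
  have c: "vm lowest \<in> carrier M" by (simp add: M_simps)
  have p1: "p \<ge> 1" using p_gt_1 by simp
  have "sp (KB 0 p) \<bullet> vm lowest = sp (dp E (int p)) \<bullet> sp (dp F (int p)) \<bullet> vm lowest"
    using E_F_on_killed[OF c, of p "int p"] vm_lowest_E by (simp add: M_simps)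
  also have "\<dots> = sp (dp E (int p)) \<bullet> fscale ((- 1) ^ p * B (int (p + lowest)) p) (vm (lowest + p))"
    by (simp only: vm_F[OF p1])
  also have "\<dots> = fscale ((- 1) ^ p * B (int (p + lowest)) p) (sp (dp E (int p)) \<bullet> vm (lowest + p))"
    using sp_k[of "dp E (int p)" "vm (lowest + p)"] by (simp add: M_simps)
  also have "\<dots> = fscale ((- 1) ^ p * B (int (p + lowest)) p * B (int (lowest + p + s)) (lowest + s)) (vm lowest)"
    by (simp add: vm_E[OF p1] del: of_nat_add)
  also have "(- 1) ^ p = (- 1 :: complex)" using odd_p by simp
  also have "B (int (p + lowest)) p = 1" using lowest(4) p_gt_1 by (simp add: B_p flip: zdiv_int)
  also have "B (int (lowest + p + s)) (lowest + s) = of_nat (s1 + 2)"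
  proof -
    have "qbinom (int (lowest + s + p)) (int (lowest + s)) = qbinom (int (lowest + s + p)) (int p)"
      using qbinom_nat[of "lowest + s" p] qbinom_nat[of p "lowest + s"] by (simp add: add.commute mult.commute)
    hence "B (int (lowest + p + s)) (lowest + s) = B (int (lowest + p + s)) p"
      unfolding qbinom_at_def by (simp add: add.commute add.left_commute)
    also have "\<dots> = of_nat (s1 + 2)"
    proof -
      have t: "lowest + p + s = (s1 + 2) * p" using s0_less by (simp add: lowest_def s_eq algebra_simps)
      have "int ((s1 + 2) * p) div int p = int (s1 + 2)"
        unfolding of_nat_mult using p_gt_1 by (intro nonzero_mult_div_cancel_right) simp
      thus ?thesis by (simp only: B_p t of_int_of_nat_eq)
    qed
    finally show ?thesis .
  qed
  also have "- 1 * 1 * of_nat (s1 + 2) = B lam p"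
  proof -
    \<comment> \<open>This is division with remainder by \<open>p\<close>, because \<open>0 < s\<^sub>0 \<le> p\<close>.\<close>
    have h: "lam = (int s0 - 1) + int p * (- int (s1 + 2))"
      by (simp add: lam_def algebra_simps)
    have "lam div int p = - int (s1 + 2)"
      unfolding h using s0_less s0_pos p_gt_1 by (subst div_mult_self2) auto
    thus ?thesis by (simp add: B_p)
  qed
  finally show ?thesis .
qed

lemma vm_lowest_weight: "vm lowest \<in> weight_space p \<epsilon> MN lam"
  using vm_lowest_Kbinom vm_K[of lowest] vm_N[OF lowest(1)]
  by (simp add: weight_space_def MN_simps M_simps uq_of_gen uq_of_KB lam_eq)

lemma sp_sum_fock: assumes "u \<in> carrier U" shows "u \<bullet> (\<Sum>i\<in>A. f i) = (\<Sum>i\<in>A. u \<bullet> f i)"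
proof (induction A rule: infinite_finite_induct)
  case (insert a A)
  thus ?case using smult_r_distr[OF assms, of "f a" "\<Sum>i\<in>A. f i"] by (simp add: M_simps)
qed (simp_all add: smult_0 assms)

lemma N_keys: "x \<in> N \<Longrightarrow> keys x \<subseteq> {(m, m + s) | m. admissible m}"
proof (induction rule: N_induct)
  case zero show ?case by simp
next
  case (step c m y)
  have "keys (fscale c (vm m) + y) \<subseteq> {(m, m + s)} \<union> keys y"
    by (auto simp: in_keys_iff lookup_add fscale_eq vm_single lookup_single when_def split: if_splits)
  thus ?case using step by auto
qed

lemma N_expand: assumes "x \<in> N"
  shows "x = (\<Sum>m\<in>fst ` keys x. fscale (lookup x (m, m + s)) (vm m))"
proof -
  have k: "a = (fst a, fst a + s)" if "a \<in> keys x" for a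
    using N_keys[OF assms] that by auto
  have inj: "inj_on fst (keys x)" by (rule inj_onI) (metis k)
  have "x = (\<Sum>a\<in>keys x. fscale (lookup x a) (single a 1))"
    using lin_single_id[of x] by (simp add: lin_def fscale_eq)
  also have "\<dots> = (\<Sum>a\<in>keys x. fscale (lookup x (fst a, fst a + s)) (vm (fst a)))"
    by (rule sum.cong) (use k in \<open>auto simp: vm_single\<close>)
  also have "\<dots> = (\<Sum>m\<in>fst ` keys x. fscale (lookup x (m, m + s)) (vm m))"
    by (simp add: sum.reindex[OF inj])
  finally show ?thesis .
qed

lemma u_fscale: "x \<in> res \<Longrightarrow> sp x \<bullet> fscale c v = fscale c (sp x \<bullet> v)"
  by (simp add: smult_fscale)

lemma vm_neq_0: "vm m \<noteq> 0"
  unfolding vm_single by (metis lookup_single_eq lookup_zero zero_neq_one)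

text \<open>
  Let \<open>t\<close> be the top index that occurs in \<open>x\<close>. With \<open>r = t - lowest\<close>, the operator \<open>e\<^bsup>(r)\<^esup>\<close> moves all
  other indices below \<open>lowest\<close>, where nothing is admissible, and so annihilates their terms. The term
  of \<open>t\<close> survives, since the lower entry \<open>lowest + s = p (s\<^sub>1 + 1)\<close> of its coefficient has last digit \<open>0\<close>.
\<close>
lemma lowest_in_submodule:
  assumes x: "x \<in> N" "x \<noteq> 0" and L: "submodule L U MN" "x \<in> L"
  shows "vm lowest \<in> L"
proof -
  interpret L: submodule L U MN by (rule L(1))
  have cl: "u \<bullet> y \<in> L" if "u \<in> carrier U" "y \<in> L" for u y using L.smult_closed[OF that] by (simp add: MN_simps)
  define A where "A = fst ` keys x"
  have A: "finite A" "A \<noteq> {}" using x(2) by (auto simp: A_def)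
  define t where "t = Max A"
  have t: "t \<in> A" "\<And>m. m \<in> A \<Longrightarrow> m \<le> t" using A by (auto simp: t_def)
  have idxA: "admissible m" if "m \<in> A" for m using N_keys[OF x(1)] that by (auto simp: A_def)
  have lk: "lookup x (t, t + s) \<noteq> 0"
  proof -
    obtain a where a: "a \<in> keys x" "t = fst a" using t(1) by (auto simp: A_def)
    hence "a = (t, t + s)" using N_keys[OF x(1)] by auto
    with a(1) have "(t, t + s) \<in> keys x" by simp
    thus ?thesis by (simp add: in_keys_iff)
  qed
  have m0t: "lowest \<le> t" using lowest(2) idxA t(1) by blast
  show ?thesis
  proof (cases "t = lowest")
    case True
    have "m = lowest" if "m \<in> A" for m using that t(2)[OF that] lowest(2)[OF idxA[OF that]] True by linarith
    hence "A = {lowest}" using A(2) by blast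
    hence "(\<Sum>m\<in>A. fscale (lookup x (m, m + s)) (vm m)) = fscale (lookup x (lowest, lowest + s)) (vm lowest)"
      by (simp only:) simp
    with N_expand[OF x(1), folded A_def] have xe: "x = fscale (lookup x (lowest, lowest + s)) (vm lowest)"
      by (rule trans)
    have lk0: "lookup x (lowest, lowest + s) \<noteq> 0" using lk True by simp
    obtain c where c: "x = fscale c (vm lowest)" "c \<noteq> 0" by (rule that[OF xe lk0])
    have "fscale (inverse c) x = vm lowest"
      unfolding c(1) by (simp only: fock.scale_scale left_inverse[OF c(2)] fock.scale_one)
    moreover have "fscale (inverse c) x \<in> L" using cl[OF k_closed L(2), of "inverse c"] by (simp only: M_simps)
    ultimately show ?thesis by simp
  next
    case False
    define r where "r = t - lowest"
    have r: "r \<ge> 1" "t - r = lowest" "r \<le> t" using False m0t by (auto simp: r_def)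
    have "sp (dp E (int r)) \<bullet> x = (\<Sum>m\<in>A. fscale (lookup x (m, m + s)) (sp (dp E (int r)) \<bullet> vm m))"
      using arg_cong[OF N_expand[OF x(1)], of "\<lambda>y. sp (dp E (int r)) \<bullet> y"]
      unfolding A_def by (simp only: sp_sum_fock[OF sp_closed[OF res_dpE]] u_fscale[OF res_dpE])
    also have "\<dots> = (\<Sum>m\<in>{t}. fscale (lookup x (m, m + s)) (sp (dp E (int r)) \<bullet> vm m))"
    proof (rule sum.mono_neutral_right)
      show "\<forall>m\<in>A - {t}. fscale (lookup x (m, m + s)) (sp (dp E (int r)) \<bullet> vm m) = 0"
      proof
        fix m assume m: "m \<in> A - {t}"
        hence "m < t" using t(2)[of m] by auto
        hence "\<not> admissible (m - r)" if "r \<le> m" using lowest(2)[of "m - r"] that r by auto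
        hence "sp (dp E (int r)) \<bullet> vm m = 0"
          using E_leaves_zero[of m r] idxA[of m] m by (auto simp: vm_E[OF r(1)] simp del: of_nat_add)
        thus "fscale (lookup x (m, m + s)) (sp (dp E (int r)) \<bullet> vm m) = 0" by simp
      qed
    qed (use A t in auto)
    also have "\<dots> = fscale (lookup x (t, t + s) * B (int (t + s)) (lowest + s)) (vm lowest)"
      using r by (simp add: vm_E[OF r(1)] del: of_nat_add)
    finally have e: "sp (dp E (int r)) \<bullet> x = fscale (lookup x (t, t + s) * B (int (t + s)) (lowest + s)) (vm lowest)" .
    have "(lowest + s) mod p = 0"
    proof -
      have "lowest + s = p * (s1 + 1)" using s0_less by (simp add: lowest_def s_eq algebra_simps)
      thus ?thesis by simp
    qed
    hence "B (int (t + s)) (lowest + s) \<noteq> 0" using B_eq_0_iff[of "lowest + s" "t + s"] m0t by simp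
    hence nz: "lookup x (t, t + s) * B (int (t + s)) (lowest + s) \<noteq> 0" (is "?c \<noteq> 0") using lk by simp
    have "fscale (inverse ?c) (sp (dp E (int r)) \<bullet> x) = vm lowest"
      by (simp only: e fock.scale_scale left_inverse[OF nz] fock.scale_one)
    moreover have "fscale (inverse ?c) (sp (dp E (int r)) \<bullet> x) \<in> L"
      using cl[OF k_closed cl[OF sp_closed L(2)], of "dp E (int r)" "inverse ?c"] by (simp add: M_simps)
    ultimately show ?thesis by simp
  qed
qed

text \<open>
  An admissible \<open>m\<close> is reached from \<open>lowest\<close>, which is the smallest admissible last digit, without
  a carry, so the coefficient is nonzero.
\<close>
lemma all_from_lowest:
  assumes L: "submodule L U MN" "vm lowest \<in> L" and m: "admissible m" shows "vm m \<in> L"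
proof (cases "m = lowest")
  case False
  interpret L: submodule L U MN by (rule L(1))
  have cl: "u \<bullet> y \<in> L" if "u \<in> carrier U" "y \<in> L" for u y using L.smult_closed[OF that] by (simp add: MN_simps)
  define r where "r = m - lowest"
  have r: "r \<ge> 1" "lowest + r = m" "r + lowest = m" using lowest(2)[OF m] False by (auto simp: r_def)
  have "r mod p \<le> m mod p"
  proof -
    have "m = (m mod p - lowest) + lowest + p * (m div p)" using m by (simp add: admissible_def lowest_def)
    hence "r = (m mod p - lowest) + p * (m div p)" unfolding r_def by linarith
    hence "r mod p = (m mod p - lowest) mod p" by (metis mod_mult_self2)
    also have "\<dots> \<le> m mod p - lowest" by (rule mod_less_eq_dividend)
    finally show ?thesis by simp
  qed
  hence "B (int m) r \<noteq> 0" using B_eq_0_iff[of r m] r by simp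
  hence nz: "(- 1) ^ r * B (int m) r \<noteq> 0" (is "?c \<noteq> 0") by simp
  have "sp (dp F (int r)) \<bullet> vm lowest = fscale ?c (vm m)" using vm_F[OF r(1), of lowest] by (simp only: r)
  hence "fscale (inverse ?c) (sp (dp F (int r)) \<bullet> vm lowest) = vm m"
    by (simp only: fock.scale_scale left_inverse[OF nz] fock.scale_one)
  moreover have "fscale (inverse ?c) (sp (dp F (int r)) \<bullet> vm lowest) \<in> L"
    using cl[OF k_closed cl[OF sp_closed L(2)], of "dp F (int r)" "inverse ?c"] by (simp add: M_simps)
  ultimately show ?thesis by simp
qed (use L in simp)

lemma submodule_of_N: assumes L: "submodule L U MN" shows "L = {0} \<or> L = N"
proof (cases "L = {0}")
  case False
  interpret L: submodule L U MN by (rule L)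
  have sub: "L \<subseteq> N" using L.subset by simp
  have z: "0 \<in> L" using L.one_closed by (simp add: M_simps)
  then obtain x where x: "x \<in> L" "x \<noteq> 0" using False by blast
  have "vm lowest \<in> L" by (rule lowest_in_submodule[OF _ x(2) L x(1)]) (use x sub in blast)
  hence vm: "vm m \<in> L" if "admissible m" for m using all_from_lowest[OF L _ that] by blast
  have "N \<subseteq> L"
  proof
    fix y assume "y \<in> N"
    thus "y \<in> L"
    proof (induction rule: N_induct)
      case zero show ?case by (rule z)
    next
      case (step c m y)
      have "k c \<odot>\<^bsub>MN\<^esub> vm m \<in> L" by (rule L.smult_closed[OF k_closed vm[OF step(1)]])
      thus ?case using L.m_closed[of "fscale c (vm m)" y] step(3) by (simp add: M_simps)
    qed
  qed
  thus ?thesis using sub by blast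
qed simp

lemma MN_irreducible: "irreducible_module U MN"
  unfolding irreducible_module_def
  using MN_module submodule_of_N vm_N[OF lowest(1)] vm_neq_0 by (auto simp: M_simps)

lemma power_vm:
  assumes u: "u \<in> carrier U" and e: "\<And>m. admissible m \<Longrightarrow> u \<bullet> vm m = fscale (\<epsilon> powi (z m)) (vm m)" and x: "x \<in> N"
  shows "(u [^]\<^bsub>U\<^esub> p) \<bullet> x = x"
proof -
  have up: "u [^]\<^bsub>U\<^esub> n \<in> carrier U" for n :: nat using u by simp
  have pw: "(u [^]\<^bsub>U\<^esub> n) \<bullet> vm m = fscale ((\<epsilon> powi (z m)) ^ n) (vm m)" if "admissible m" for m n
  proof (induction n)
    case 0 show ?case using smult_one[of "vm m"] by (simp add: M_simps)
  next
    case (Suc n)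
    show ?case using smult_assoc[OF up u, of "vm m" n] Suc
      by (simp add: M_simps e[OF that] smult_fscale[OF up] mult.commute)
  qed
  have one: "(\<epsilon> powi (z m)) ^ p = 1" for m
  proof -
    have "(\<epsilon> powi (z m)) ^ p = \<epsilon> powi (z m * int p)" by (simp add: power_int_mult)
    also have "\<dots> = 1" by (simp add: eps_powi_eq_1_iff)
    finally show ?thesis .
  qed
  show ?thesis using x
    by (induction rule: N_induct) (simp_all add: smult_0 smult_plus smult_fscale up pw one)
qed

lemma eigen_decomposition:
  assumes "x \<in> N"
  shows "\<exists>(n::nat) w c. (\<forall>i<n. w i \<in> carrier MN \<and> sp gK \<odot>\<^bsub>MN\<^esub> w i = k (c i) \<odot>\<^bsub>MN\<^esub> w i) \<and>
      x = (\<Oplus>\<^bsub>MN\<^esub>i\<in>{..<n}. w i)"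
proof -
  interpret L: left_module U MN by (rule MN_module)
  show ?thesis using assms
  proof (induction rule: N_induct)
    case zero
    show ?case by (intro exI[of _ 0]) (simp add: MN_simps)
  next
    case (step a m y)
    obtain n :: nat and w c where IH: "\<forall>i<n. w i \<in> carrier MN \<and> sp gK \<odot>\<^bsub>MN\<^esub> w i = k (c i) \<odot>\<^bsub>MN\<^esub> w i"
      "y = (\<Oplus>\<^bsub>MN\<^esub>i\<in>{..<n}. w i)" using step.IH by blast
    define w' where "w' = w(n := fscale a (vm m))"
    define c' where "c' = c(n := \<epsilon> powi (- (2 * int m + int s + 1)))"
    have v: "fscale a (vm m) \<in> N" using step by (simp add: fscale_N vm_N)
    have wc: "w' i \<in> carrier MN" if "i < Suc n" for i
      using that IH(1) v by (cases "i = n") (auto simp: w'_def MN_simps)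
    have "(\<Oplus>\<^bsub>MN\<^esub>i\<in>{..<Suc n}. w' i) = w' n \<oplus>\<^bsub>MN\<^esub> (\<Oplus>\<^bsub>MN\<^esub>i\<in>{..<n}. w' i)"
      unfolding lessThan_Suc by (rule L.M.finsum_insert) (use wc in auto)
    also have "(\<Oplus>\<^bsub>MN\<^esub>i\<in>{..<n}. w' i) = (\<Oplus>\<^bsub>MN\<^esub>i\<in>{..<n}. w i)"
      by (rule L.M.finsum_cong') (use IH(1) in \<open>auto simp: w'_def\<close>)
    finally have sum: "fscale a (vm m) + y = (\<Oplus>\<^bsub>MN\<^esub>i\<in>{..<Suc n}. w' i)"
      using IH(2) by (simp add: w'_def M_simps)
    have "sp gK \<odot>\<^bsub>MN\<^esub> w' i = k (c' i) \<odot>\<^bsub>MN\<^esub> w' i" if "i < Suc n" for i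
    proof (cases "i = n")
      case True
      thus ?thesis by (simp add: w'_def c'_def MN_simps M_simps u_fscale vm_K mult.commute)
    next
      case False
      thus ?thesis using IH(1) that by (simp add: w'_def c'_def)
    qed
    thus ?case using wc sum by (intro exI[of _ "Suc n"] exI[of _ w'] exI[of _ c']) blast
  qed
qed

lemma MN_type_one: "type_one p \<epsilon> MN"
proof -
  have "\<exists>(n::nat) w c. (\<forall>i<n. w i \<in> carrier MN \<and> spec \<epsilon> (uq_gen K) \<odot>\<^bsub>MN\<^esub> w i = k (c i) \<odot>\<^bsub>MN\<^esub> w i) \<and>
      v = (\<Oplus>\<^bsub>MN\<^esub>i\<in>{..<n}. w i)" if "v \<in> carrier MN" for v
    using eigen_decomposition[of v] that unfolding uq_of_gen by (simp only: MN_simps(1))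
  moreover have "(spec \<epsilon> (uq_gen K) [^]\<^bsub>U\<^esub> p) \<odot>\<^bsub>MN\<^esub> v = v" if "v \<in> carrier MN" for v
    using power_vm[OF sp_closed[OF res_gK(1)] vm_K, of v] that by (simp add: MN_simps uq_of_gen)
  moreover have "(spec \<epsilon> (uq_gen Kinv) [^]\<^bsub>U\<^esub> p) \<odot>\<^bsub>MN\<^esub> v = v" if "v \<in> carrier MN" for v
    using power_vm[OF sp_closed[OF res_gK(2)] vm_Kinv, of v] that by (simp add: MN_simps uq_of_gen)
  ultimately show ?thesis unfolding type_one_def using MN_module by blast
qed

theorem MN_Vres: "is_Vres p \<epsilon> lam MN"
proof -
  interpret L: ueps_module p \<epsilon> MN by (rule ueps_moduleI[OF MN_module])
  let ?C = "{u \<odot>\<^bsub>MN\<^esub> vm lowest | u. u \<in> carrier U}"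
  have v: "vm lowest \<in> carrier MN" using vm_N[OF lowest(1)] by (simp add: MN_simps)
  have "vm lowest \<in> ?C" using L.smult_one[OF v, symmetric] U.one_closed by blast
  hence "?C = N" using submodule_of_N[OF L.cyclic_submodule[OF v]] vm_neq_0[of lowest] by blast
  hence gen: "carrier MN = ?C" by (simp add: MN_simps)
  have E1: "spec \<epsilon> (uq_gen E) \<odot>\<^bsub>MN\<^esub> vm lowest = \<zero>\<^bsub>MN\<^esub>"
    using vm_lowest_E[of 1] by (simp add: M_simps dp_1 uq_of_gen)
  have Ep: "spec \<epsilon> (uq_dpow E p) \<odot>\<^bsub>MN\<^esub> vm lowest = \<zero>\<^bsub>MN\<^esub>"
    using vm_lowest_E[of p] p_gt_1 by (simp add: M_simps uq_of_dp)
  have nz: "vm lowest \<noteq> \<zero>\<^bsub>MN\<^esub>" using vm_neq_0 by (simp add: M_simps)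
  show ?thesis
    unfolding is_Vres_def highest_weight_module_def
    using MN_type_one MN_irreducible vm_lowest_weight nz E1 Ep gen by blast
qed

end

theorem proposition5p2:
  fixes p s s0 s1 :: nat and \<epsilon> :: complex
  assumes "p > 1" and "odd p"
    and "\<epsilon> ^ p = 1" and "\<forall>k. 0 < k \<and> k < p \<longrightarrow> \<epsilon> ^ k \<noteq> 1"
    and "s > 0" and "s = s0 + p * s1" and "s0 < p" and "s0 \<noteq> 0"
  shows "(\<exists>M. is_fock_module \<epsilon> M) \<and>
    (\<forall>M. is_fock_module \<epsilon> M \<longrightarrow>
      submodule (V' p s s0) (Ueps \<epsilon>) M \<and>
      is_Vres p \<epsilon> (- (int p - int s0 + (int s1 + 1) * int p + 1)) (M\<lparr>carrier := V' p s s0\<rparr>) \<and>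
      (\<forall>W :: (ueps, 'w) module.
        is_Vres p \<epsilon> (- (int p - int s0 + (int s1 + 1) * int p + 1)) W \<longrightarrow>
        isomorphic_modules (Ueps \<epsilon>) (M\<lparr>carrier := V' p s s0\<rparr>) W))"
proof -
  interpret odd_root_of_unity p \<epsilon> by unfold_locales (use assms in auto)
  show ?thesis
  proof (intro conjI allI impI)
    show "\<exists>M. is_fock_module \<epsilon> M" using fock_module_exists by blast
  next
    fix M assume M: "is_fock_module \<epsilon> M"
    have "fock_setting p \<epsilon> M s s0 s1"
      by (intro fock_setting.intro fock_setting_axioms.intro ueps_moduleI M assms)
        (use M in \<open>simp add: is_fock_module_def\<close>)
    then interpret fock_setting p \<epsilon> M s s0 s1 .
    show "submodule (V' p s s0) (Ueps \<epsilon>) M" by (rule N_submodule)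
    show V: "is_Vres p \<epsilon> (- (int p - int s0 + (int s1 + 1) * int p + 1)) (M\<lparr>carrier := V' p s s0\<rparr>)"
      using MN_Vres unfolding lam_def .
    fix W :: "(ueps, 'w) module"
    assume "is_Vres p \<epsilon> (- (int p - int s0 + (int s1 + 1) * int p + 1)) W"
    thus "isomorphic_modules (Ueps \<epsilon>) (M\<lparr>carrier := V' p s s0\<rparr>) W" by (rule Vres_unique[OF V])
  qed
qed

end
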